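(* The action of $G_-$ on $GW_0$ defined via the Lagrangian cones formalism is equivalent to the one given by the genus zero restriction of Givental's quantization procedure. That is: let $S(z)=\exp(a)\in G_-$ with $a\in\mathfrak g_-$, let $F\in GW_0$, and let $\mathcal Z=\exp(\hbar^{-1}F_0+F_1+\hbar F_2+\dots)$ be a formal total descendant potential with $F_0=F$. Then the genus zero part $G_0$ of $\exp(\widehat H_a)\mathcal Z=\exp(\hbar^{-1}G_0+G_1+\hbar G_2+\dots)$ is the function whose cone is $\mathcal L_{G_0}=S(z)\mathcal L_F$.
   Context: $H$ is an $N$-dimensional complex vector space with a symmetric non-degenerate bilinear form $(\cdot,\cdot)$ and a distinguished nonzero vector $\mathbf 1$; $\{\phi_\alpha\}_{\alpha=1}^N$ is a basis with $\phi_1=\mathbf 1$, $g_{\alpha,\beta}=(\phi_\alpha,\phi_\beta)$, $(g^{\alpha,\beta})=(g_{\alpha,\beta})^{-1}$, $\phi^\alpha=\sum_\beta g^{\alpha,\beta}\phi_\beta$. Variables: $t_n=\sum_\alpha t_n^\alpha\phi_\alpha\in H$, $n\ge0$; functions of $t_0,t_1,\dots$ are formal power series in the $t_n^\alpha$. Dilaton shift: $q_n^\alpha=t_n^\alpha-\delta_{\alpha,1}\delta_{n,1}$, $q_n=\sum_\alpha q_n^\alpha\phi_\alpha$, $\partial_{\alpha,n}=\partial/\partial q_n^\alpha$. Repeated Greek indices are summed. $GW_0$ is the set of all $F$ satisfying (DE) $\sum_{i\ge 0}q_i^\alpha\partial_{\alpha,i}F=2F$; (SE) $\sum_{i\ge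 0}q_{i+1}^\alpha\partial_{\alpha,i}F=-\frac12(q_0,q_0)$; (TRR) $\partial_{\alpha,k+1}\partial_{\beta,l}\partial_{\gamma,m}F=\partial_{\alpha,k}\partial_{\mu,0}F\; g^{\mu,\nu}\;\partial_{\nu,0}\partial_{\beta,l}\partial_{\gamma,m}F$ for all $k,l,m\ge 0$ and all $\alpha,\beta,\gamma$. Let $\mathcal H=H((z^{-1}))$ with symplectic form $\Omega(f,g)=\frac1{2\pi i}\oint(f(-z),g(z))\,dz$. Elements of $\mathcal H$ are written $f=\sum_{n\ge0}q_nz^n+\sum_{n\ge0}p_n(-z)^{-n-1}$ with $q_n=\sum_\alpha q_n^\alpha\phi_\alpha$, $p_n=\sum_\alpha p_n^\alpha\phi^\alpha$. For a function $F$ let $$\mathcal L_F=\Big\{\sum_{i\ge0}p_i(-z)^{-i-1}+\sum_{i\ge0}q_iz^i:\ p_i^\alpha=\frac{\partial F}{\partial q_i^\alpha}\Big\}.$$ $G_-$ is the group of series $S(z)=\mathrm{Id}+\sum_{i>0}S_iz^{-i}$, $S_i\in\mathrm{End}(H)$, with $S^*(-z)S(z)=\mathrm{Id}$, where $^*$ is the adjoint with respect to $(\cdot,\cdot)$. Its Lie algebra is $\mathfrak g_-=\{\sum_{i>0}a_iz^{-i}:\ a_i^*=(-1)^{i+1}a_i\}$. Cone definition of the action: $\widehat SF$ is the function with $\mathcal L_{\widehat SF}=S(z)\mathcal L_F$. Quantization definition: for $a\in\mathfrak g_-$ the Hamiltonian $H_a(f)=\frac12\Omega(af,f)$ is a quadratic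 function of the $p_i^\alpha,q_j^\beta$; the operator $\widehat H_a$ is obtained from it by $p_i^\alpha p_j^\beta\mapsto\hbar\,\partial_{\alpha,i}\partial_{\beta,j}$, $p_i^\alpha q_j^\beta\mapsto q_j^\beta\partial_{\alpha,i}$, $q_i^\alpha q_j^\beta\mapsto\hbar^{-1}q_i^\alpha q_j^\beta$. The operators $\exp(\widehat H_a)$ act on formal total descendant potentials $\exp(\hbar^{-1}F_0+F_1+\hbar F_2+\dots)$. The linear change of variables induced by $S$, $\mathbf q(z)=\sum_n q_nz^n\mapsto[S^{-1}(z)\mathbf q(z)]_+$ (part with non-negative powers of $z$), is not always a well-defined substitution in formal series (it is when $S_1=0$); the statement is understood whenever it makes sense. *)

theory Defs
  imports
    "HOL-Analysis.Analysis"
    "HOL-Computational_Algebra.Formal_Laurent_Series"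
    "HOL-Library.Multiset"
    "HOL-Library.Groups_Big_Fun"
begin

section \<open>Formal power series in arbitrarily many variables\<close>

text \<open>A monomial is the finite multiset of the variables occurring in it, and a series is an
  arbitrary assignment of coefficients to monomials.\<close>

typedef ('v, 'a) mfps = "UNIV :: ('v multiset \<Rightarrow> 'a) set"
  morphisms mcoeff Mfps ..

lemma mcoeff_Mfps [simp]: "mcoeff (Mfps f) = f"
  by (simp add: Mfps_inverse)

lemma mfps_eqI: "(\<And>m. mcoeff f m = mcoeff g m) \<Longrightarrow> f = g"
  by (metis ext mcoeff_inject)

lemma finite_submultisets [simp]: "finite {a. a \<subseteq># (m :: 'v multiset)}"
proof -
  have "{a. a \<subseteq># m} \<subseteq> mset ` {xs. set xs \<subseteq> set_mset m \<and> length xs \<le> size m}"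
  proof
    fix a assume "a \<in> {a. a \<subseteq># m}"
    then have a: "a \<subseteq># m" by simp
    obtain xs where xs: "mset xs = a" using ex_mset by blast
    have "set xs \<subseteq> set_mset m" using a xs by (metis set_mset_mono set_mset_mset)
    moreover have "length xs \<le> size m" using a xs by (metis size_mset size_mset_mono)
    ultimately show "a \<in> mset ` {xs. set xs \<subseteq> set_mset m \<and> length xs \<le> size m}"
      using xs by blast
  qed
  then show ?thesis
    by (rule finite_subset) (simp add: finite_lists_length_le)
qed

lemma diff_diff_submset: "a \<subseteq># m \<Longrightarrow> m - (m - a) = (a :: 'v multiset)"
  by (rule multiset_eqI) (simp add: subseteq_mset_def)

instantiation mfps :: (type, comm_ring_1) comm_ring_1
begin

definition "0 = Mfps (\<lambda>_. 0)"
definition "1 = Mfps (\<lambda>m. if m = {#} then 1 else 0)"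
definition "f + g = Mfps (\<lambda>m. mcoeff f m + mcoeff g m)"
definition "f - g = Mfps (\<lambda>m. mcoeff f m - mcoeff g m)"
definition "- f = Mfps (\<lambda>m. - mcoeff f m)"
definition "f * g = Mfps (\<lambda>m. \<Sum>a | a \<subseteq># m. mcoeff f a * mcoeff g (m - a))"

instance
proof
  fix f g h :: "('a, 'b) mfps"
  show "f * g * h = f * (g * h)"
  proof (rule mfps_eqI)
    fix m
    let ?F = "\<lambda>(a, b). mcoeff f a * mcoeff g b * mcoeff h (m - a - b)"
    have "mcoeff (f * g * h) m =
        (\<Sum>(c, a)\<in>(SIGMA c:{c. c \<subseteq># m}. {a. a \<subseteq># c}).
          mcoeff f a * mcoeff g (c - a) * mcoeff h (m - c))"
      by (simp add: times_mfps_def sum_distrib_right sum.Sigma)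
    also have "\<dots> = sum ?F (SIGMA a:{a. a \<subseteq># m}. {b. b \<subseteq># m - a})"
    proof (rule sum.reindex_bij_witness[where i = "\<lambda>(a, b). (a + b, a)" and j = "\<lambda>(c, a). (a, c - a)"],
        goal_cases)
      case (1 x)
      then show ?case by (cases x) (simp add: subset_mset.add_diff_inverse)
    next
      case (2 x)
      then show ?case
        by (cases x) (auto simp: subseteq_mset_def intro: le_trans diff_le_mono)
    next
      case (3 x)
      then show ?case by (cases x) simp
    next
      case (4 x)
      then obtain a b where x: "x = (a, b)" "a \<subseteq># m" "b \<subseteq># m - a" by auto
      then have "a + b \<subseteq># m"
        by (metis subset_mset.add_diff_inverse subset_mset.add_left_mono)
      with x show ?case by simp
    next
      case (5 x)
      then obtain c a where x: "x = (c, a)" "a \<subseteq># c" by auto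
      then have "m - a - (c - a) = m - c"
        by (simp add: diff_diff_add_mset subset_mset.add_diff_inverse)
      with x show ?case by simp
    qed
    also have "\<dots> = mcoeff (f * (g * h)) m"
      by (simp add: times_mfps_def sum_distrib_left sum.Sigma mult.assoc)
    finally show "mcoeff (f * g * h) m = mcoeff (f * (g * h)) m" .
  qed
  show "f * g = g * f"
  proof (rule mfps_eqI)
    fix m
    show "mcoeff (f * g) m = mcoeff (g * f) m"
      unfolding times_mfps_def mcoeff_Mfps
      by (rule sum.reindex_bij_witness[where i = "\<lambda>a. m - a" and j = "\<lambda>a. m - a"])
        (auto simp: mult.commute diff_diff_submset)
  qed
  show "1 * f = f"
  proof (rule mfps_eqI)
    fix m
    have "mcoeff (1 * f) m = (\<Sum>a | a \<subseteq># m. if a = {#} then mcoeff f m else 0)"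
      unfolding times_mfps_def one_mfps_def mcoeff_Mfps by (rule sum.cong) auto
    then show "mcoeff (1 * f) m = mcoeff f m" by (simp add: sum.delta)
  qed
  show "(f + g) * h = f * h + g * h"
    by (rule mfps_eqI) (simp add: times_mfps_def plus_mfps_def distrib_right sum.distrib)
  have "mcoeff (0 :: ('a, 'b) mfps) {#} \<noteq> mcoeff 1 {#}"
    by (simp add: zero_mfps_def one_mfps_def)
  then show "(0 :: ('a, 'b) mfps) \<noteq> 1" by metis
  show "f + g + h = f + (g + h)" "f + g = g + f" "0 + f = f" "- f + f = 0" "f - g = f + - g"
    by (rule mfps_eqI; simp add: zero_mfps_def plus_mfps_def minus_mfps_def uminus_mfps_def)+
qed

end

definition mconst :: "'a :: comm_ring_1 \<Rightarrow> ('v, 'a) mfps" where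
  "mconst c = Mfps (\<lambda>m. if m = {#} then c else 0)"

definition mvar :: "'v \<Rightarrow> ('v, 'a :: comm_ring_1) mfps" where
  "mvar v = Mfps (\<lambda>m. if m = {#v#} then 1 else 0)"

definition mderiv :: "'v \<Rightarrow> ('v, 'a :: comm_ring_1) mfps \<Rightarrow> ('v, 'a) mfps" where
  "mderiv v f = Mfps (\<lambda>m. of_nat (Suc (count m v)) * mcoeff f (add_mset v m))"

text \<open>Infinite sums of series, for families in which every monomial occurs only finitely often
  (this is the case for all families below).\<close>

definition formal_sum :: "('i \<Rightarrow> ('v, 'a :: comm_ring_1) mfps) \<Rightarrow> ('v, 'a) mfps" where
  "formal_sum f = Mfps (\<lambda>m. Sum_any (\<lambda>i. mcoeff (f i) m))"

text \<open>The substitution of series \<open>\<tau> v\<close>, possibly with constant terms, for the variables \<open>v\<close>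
  of \<open>\<Phi>\<close> makes sense if each coefficient of the result is given by an (unconditionally, that is,
  absolutely) convergent sum over the monomials of \<open>\<Phi>\<close>.\<close>

definition subst_defined ::
    "('v, complex) mfps \<Rightarrow> ('v \<Rightarrow> ('x, complex) mfps) \<Rightarrow> bool" where
  "subst_defined \<Phi> \<tau> \<longleftrightarrow>
     (\<forall>\<mu>. (\<lambda>m. mcoeff \<Phi> m * mcoeff (\<Prod>v\<in>#m. \<tau> v) \<mu>) summable_on UNIV)"

definition subst ::
    "('v, complex) mfps \<Rightarrow> ('v \<Rightarrow> ('x, complex) mfps) \<Rightarrow> ('x, complex) mfps" where
  "subst \<Phi> \<tau> = Mfps (\<lambda>\<mu>. \<Sum>\<^sub>\<infinity>m. mcoeff \<Phi> m * mcoeff (\<Prod>v\<in>#m. \<tau> v) \<mu>)"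


section \<open>The space $H$ and genus zero potentials\<close>

text \<open>The basis is indexed by a finite type \<open>'n\<close>, so that $N$ is the cardinality of \<open>'n\<close>;
  \<open>unit_ix\<close> is the index (written 1 in the literature) of the distinguished vector.\<close>

record ('h, 'n) gwdata =
  scl :: "complex \<Rightarrow> 'h \<Rightarrow> 'h"
  pair :: "'h \<Rightarrow> 'h \<Rightarrow> complex"
  bas :: "'n \<Rightarrow> 'h"
  unit_ix :: 'n

definition gw_space :: "('h :: ab_group_add, 'n :: finite) gwdata \<Rightarrow> bool" where
  "gw_space X \<longleftrightarrow>
     vector_space (scl X) \<and>
     inj (bas X) \<and> \<not> module.dependent (scl X) (range (bas X)) \<and>
     module.span (scl X) (range (bas X)) = UNIV \<and>
     (\<forall>u. Vector_Spaces.linear (scl X) (*) (pair X u)) \<and>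
     (\<forall>u v. pair X u v = pair X v u) \<and>
     (\<forall>u. (\<forall>v. pair X u v = 0) \<longrightarrow> u = 0)"

definition gram :: "('h, 'n :: finite) gwdata \<Rightarrow> complex ^ 'n ^ 'n" where
  "gram X = (\<chi> \<alpha> \<beta>. pair X (bas X \<alpha>) (bas X \<beta>))"

definition gram_inv :: "('h, 'n :: finite) gwdata \<Rightarrow> 'n \<Rightarrow> 'n \<Rightarrow> complex" where
  "gram_inv X \<alpha> \<beta> = matrix_inv (gram X) $ \<alpha> $ \<beta>"

definition cobas :: "('h :: ab_group_add, 'n :: finite) gwdata \<Rightarrow> 'n \<Rightarrow> 'h" where
  "cobas X \<alpha> = (\<Sum>\<beta>\<in>UNIV. scl X (gram_inv X \<alpha> \<beta>) (bas X \<beta>))"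

definition coords ::
    "('h :: ab_group_add, 'n :: finite) gwdata \<Rightarrow> ('n \<Rightarrow> 'h) \<Rightarrow> 'h \<Rightarrow> 'n \<Rightarrow> complex" where
  "coords X b v = (THE c. v = (\<Sum>\<alpha>\<in>UNIV. scl X (c \<alpha>) (b \<alpha>)))"

text \<open>The variable with index \<open>(n, \<alpha>)\<close> is $t_n^\alpha$.  Since $q_n^\alpha$ and $t_n^\alpha$ differ
  by a constant, \<open>mderiv (n, \<alpha>)\<close> is $\partial_{\alpha,n}$.\<close>

type_synonym 'n var = "nat \<times> 'n"
type_synonym 'n tser = "('n var, complex) mfps"

definition qvar :: "('h, 'n) gwdata \<Rightarrow> 'n var \<Rightarrow> ('n var, 'a :: comm_ring_1) mfps" where
  "qvar X v = mvar v - mconst (if v = (1, unit_ix X) then 1 else 0)"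

definition GW0 :: "('h, 'n :: finite) gwdata \<Rightarrow> 'n tser set" where
  "GW0 X = {F.
     formal_sum (\<lambda>v. qvar X v * mderiv v F) = 2 * F \<and>
     formal_sum (\<lambda>(i, \<alpha>). qvar X (Suc i, \<alpha>) * mderiv (i, \<alpha>) F) =
       mconst (- 1 / 2) *
         (\<Sum>\<alpha>\<in>UNIV. \<Sum>\<beta>\<in>UNIV. mconst (pair X (bas X \<alpha>) (bas X \<beta>)) * qvar X (0, \<alpha>) * qvar X (0, \<beta>)) \<and>
     (\<forall>k l m \<alpha> \<beta> \<gamma>.
       mderiv (Suc k, \<alpha>) (mderiv (l, \<beta>) (mderiv (m, \<gamma>) F)) =
       (\<Sum>\<mu>\<in>UNIV. \<Sum>\<nu>\<in>UNIV. mderiv (k, \<alpha>) (mderiv (0, \<mu>) F) * mconst (gram_inv X \<mu> \<nu>) *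
          mderiv (0, \<nu>) (mderiv (l, \<beta>) (mderiv (m, \<gamma>) F))))}"


section \<open>The loop space and the group\<close>

text \<open>An element $\sum_k f_k z^k$ of $\mathcal H = H((z^{-1}))$ is the function $k \mapsto f_k$.\<close>

definition HH :: "(int \<Rightarrow> 'h :: zero) set" where
  "HH = {f. \<exists>K. \<forall>k>K. f k = 0}"

text \<open>The residue is the coefficient of $z^{-1}$ in $(f(-z), g(z))$.\<close>

definition Omega ::
    "('h, 'n) gwdata \<Rightarrow> (int \<Rightarrow> 'h) \<Rightarrow> (int \<Rightarrow> 'h) \<Rightarrow> complex" where
  "Omega X f g = Sum_any (\<lambda>k. (- 1) powi k * pair X (f k) (g (- 1 - k)))"

definition qbas :: "('h :: ab_group_add, 'n :: finite) gwdata \<Rightarrow> 'n var \<Rightarrow> int \<Rightarrow> 'h" where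
  "qbas X = (\<lambda>(n, \<alpha>) k. if k = int n then bas X \<alpha> else 0)"

definition pbas :: "('h :: ab_group_add, 'n :: finite) gwdata \<Rightarrow> 'n var \<Rightarrow> int \<Rightarrow> 'h" where
  "pbas X = (\<lambda>(n, \<alpha>) k. if k = - int n - 1 then scl X ((- 1) ^ (n + 1)) (cobas X \<alpha>) else 0)"

definition qcoord ::
    "('h :: ab_group_add, 'n :: finite) gwdata \<Rightarrow> (int \<Rightarrow> 'h) \<Rightarrow> 'n var \<Rightarrow> complex" where
  "qcoord X f = (\<lambda>(n, \<alpha>). coords X (bas X) (f (int n)) \<alpha>)"

definition pcoord ::
    "('h :: ab_group_add, 'n :: finite) gwdata \<Rightarrow> (int \<Rightarrow> 'h) \<Rightarrow> 'n var \<Rightarrow> complex" where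
  "pcoord X f = (\<lambda>(n, \<alpha>). coords X (cobas X) (scl X ((- 1) ^ (n + 1)) (f (- int n - 1))) \<alpha>)"

text \<open>A series $\sum_{i\ge0} A_i z^{-i}$ with $A_i \in \mathrm{End}(H)$ is the function
  $i \mapsto A_i$.\<close>

definition ser_one :: "nat \<Rightarrow> 'h \<Rightarrow> 'h :: ab_group_add" where
  "ser_one = (\<lambda>i v. if i = 0 then v else 0)"

definition ser_mult ::
    "(nat \<Rightarrow> 'h \<Rightarrow> 'h) \<Rightarrow> (nat \<Rightarrow> 'h \<Rightarrow> 'h) \<Rightarrow> nat \<Rightarrow> 'h \<Rightarrow> 'h :: ab_group_add" where
  "ser_mult A B = (\<lambda>k v. \<Sum>i\<le>k. A i (B (k - i) v))"

text \<open>For $A_0 = 0$ only the powers $A^n$ with $n \le k$ contribute to the coefficient of $z^{-k}$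
  in $\exp A$.\<close>

definition ser_exp ::
    "('h, 'n) gwdata \<Rightarrow> (nat \<Rightarrow> 'h \<Rightarrow> 'h) \<Rightarrow> nat \<Rightarrow> 'h \<Rightarrow> 'h :: ab_group_add" where
  "ser_exp X A = (\<lambda>k v. \<Sum>n\<le>k. scl X (1 / fact n) ((ser_mult A ^^ n) ser_one k v))"

definition ser_inv :: "(nat \<Rightarrow> 'h \<Rightarrow> 'h) \<Rightarrow> nat \<Rightarrow> 'h \<Rightarrow> 'h :: ab_group_add" where
  "ser_inv A = (THE B. ser_mult B A = ser_one \<and> ser_mult A B = ser_one)"

definition act :: "(nat \<Rightarrow> 'h \<Rightarrow> 'h) \<Rightarrow> (int \<Rightarrow> 'h) \<Rightarrow> int \<Rightarrow> 'h :: ab_group_add" where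
  "act A f = (\<lambda>k. Sum_any (\<lambda>i. A i (f (k + int i))))"

definition adj :: "('h, 'n) gwdata \<Rightarrow> ('h \<Rightarrow> 'h) \<Rightarrow> 'h \<Rightarrow> 'h" where
  "adj X T = (THE T'. \<forall>u v. pair X (T' u) v = pair X u (T v))"

definition G_minus :: "('h :: ab_group_add, 'n) gwdata \<Rightarrow> (nat \<Rightarrow> 'h \<Rightarrow> 'h) set" where
  "G_minus X = {S. S 0 = id \<and> (\<forall>i. Vector_Spaces.linear (scl X) (scl X) (S i)) \<and>
     ser_mult (\<lambda>i v. scl X ((- 1) ^ i) (adj X (S i) v)) S = ser_one}"

definition g_minus :: "('h :: ab_group_add, 'n) gwdata \<Rightarrow> (nat \<Rightarrow> 'h \<Rightarrow> 'h) set" where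
  "g_minus X = {a. a 0 = (\<lambda>_. 0) \<and> (\<forall>i. Vector_Spaces.linear (scl X) (scl X) (a i)) \<and>
     (\<forall>i>0. adj X (a i) = (\<lambda>v. scl X ((- 1) ^ (i + 1)) (a i v)))}"


section \<open>Lagrangian cones\<close>

text \<open>As \<open>F\<close> is only a formal series, its cone is described by formal families of points of
  $\mathcal H$, that is, by series $f = \sum_\mu f_\mu x^\mu$ with $f_\mu \in \mathcal H$ in as many
  parameters $x$ as there are variables \<open>t\<close> (so that the tautological family, parametrized by
  all of the cone, is among them).\<close>

type_synonym ('h, 'n) family = "'n var multiset \<Rightarrow> int \<Rightarrow> 'h"

definition tparam ::
    "('h :: ab_group_add, 'n :: finite) gwdata \<Rightarrow> ('h, 'n) family \<Rightarrow> 'n var \<Rightarrow> 'n tser" where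
  "tparam X f v = Mfps (\<lambda>\<mu>. qcoord X (f \<mu>) v) + mconst (if v = (1, unit_ix X) then 1 else 0)"

definition pparam ::
    "('h :: ab_group_add, 'n :: finite) gwdata \<Rightarrow> ('h, 'n) family \<Rightarrow> 'n var \<Rightarrow> 'n tser" where
  "pparam X f v = Mfps (\<lambda>\<mu>. pcoord X (f \<mu>) v)"

text \<open>All families on which the equations $p_i^\alpha = \partial F / \partial q_i^\alpha$ make sense
  and hold.  The value of $t$ at $x = 0$ may be nonzero as long as the substitution converges.\<close>

definition ext_cone ::
    "('h :: ab_group_add, 'n :: finite) gwdata \<Rightarrow> 'n tser \<Rightarrow> ('h, 'n) family set" where
  "ext_cone X F = {f. (\<forall>\<mu>. f \<mu> \<in> HH) \<and>
     (\<forall>v. subst_defined (mderiv v F) (tparam X f) \<and>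
          pparam X f v = subst (mderiv v F) (tparam X f))}"

text \<open>The families that pass through $t = 0$, that is, $\mathbf q(z) = - z \mathbf 1$, at $x = 0$.\<close>

definition formal_germ :: "('h :: ab_group_add, 'n :: finite) gwdata \<Rightarrow> ('h, 'n) family set" where
  "formal_germ X = {f. \<forall>v. mcoeff (tparam X f v) {#} = 0}"

definition cone ::
    "('h :: ab_group_add, 'n :: finite) gwdata \<Rightarrow> 'n tser \<Rightarrow> ('h, 'n) family set" where
  "cone X F = ext_cone X F \<inter> formal_germ X"

text \<open>$S(z)\mathcal L_F$ near the point $t = 0$.  Multiplication by $S(z)$ moves the point $t = 0$
  by $-S_1 \mathbf 1$ in the $q_0$-direction.  If $S_1 \mathbf 1 = 0$ then
  \<open>cone_image X S F\<close> is just the image of \<open>cone X F\<close>.  Otherwise it is the germ of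
  $S(z)\mathcal L_F$ at a point coming from $t_0 = S_1 \mathbf 1$, and consists of the points at
  which this makes sense.\<close>

definition cone_image ::
    "('h :: ab_group_add, 'n :: finite) gwdata \<Rightarrow> (nat \<Rightarrow> 'h \<Rightarrow> 'h) \<Rightarrow> 'n tser \<Rightarrow>
     ('h, 'n) family set" where
  "cone_image X S F = (\<lambda>f \<mu>. act S (f \<mu>)) ` ext_cone X F \<inter> formal_germ X"

text \<open>\<open>G\<close> is \emph{the} element of $GW_0$ with $\mathcal L_G = S(z)\mathcal L_F$.\<close>

definition is_cone_action ::
    "('h :: ab_group_add, 'n :: finite) gwdata \<Rightarrow> (nat \<Rightarrow> 'h \<Rightarrow> 'h) \<Rightarrow> 'n tser \<Rightarrow> 'n tser \<Rightarrow> bool"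
  where
  "is_cone_action X S F G \<longleftrightarrow>
     G \<in> GW0 X \<and> cone X G = cone_image X S F \<and>
     (\<forall>G'\<in>GW0 X. cone X G' = cone_image X S F \<longrightarrow> G' = G)"

text \<open>The change of variables $\mathbf q(z) \mapsto [S^{-1}(z)\mathbf q(z)]_+$, written in the
  coordinates $t_n^\alpha$: it is applied to the generic point
  $\mathbf q(z) = - z\mathbf 1 + \sum_{n,\alpha} t_n^\alpha \phi_\alpha z^n$, and \<open>tparam\<close> only reads
  the coefficients of the non-negative powers of $z$.\<close>

definition generic_q :: "('h :: ab_group_add, 'n :: finite) gwdata \<Rightarrow> ('h, 'n) family" where
  "generic_q X \<mu> =
     (if \<mu> = {#} then (\<lambda>k. - qbas X (1, unit_ix X) k)
      else if \<exists>v. \<mu> = {#v#} then qbas X (THE v. \<mu> = {#v#}) else (\<lambda>_. 0))"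

definition change_of_vars ::
    "('h :: ab_group_add, 'n :: finite) gwdata \<Rightarrow> (nat \<Rightarrow> 'h \<Rightarrow> 'h) \<Rightarrow> 'n var \<Rightarrow> 'n tser" where
  "change_of_vars X S = tparam X (\<lambda>\<mu>. act (ser_inv S) (generic_q X \<mu>))"


section \<open>Quantization\<close>

text \<open>\<open>ham2 X a f f\<close> is $H_a(f)$; the values of \<open>ham2\<close> on the Darboux basis are the
  coefficients of the quadratic function $H_a$ of the coordinates $p, q$.\<close>

definition ham2 ::
    "('h :: ab_group_add, 'n) gwdata \<Rightarrow> (nat \<Rightarrow> 'h \<Rightarrow> 'h) \<Rightarrow> (int \<Rightarrow> 'h) \<Rightarrow> (int \<Rightarrow> 'h) \<Rightarrow> complex"
  where
  "ham2 X a f g = Omega X (act a f) g / 2"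

text \<open>Series with coefficients in $\mathbb C((\hbar))$.\<close>

type_synonym 'n hser = "('n var, complex fls) mfps"

definition hscalar :: "complex \<Rightarrow> int \<Rightarrow> 'n hser" where
  "hscalar c k = mconst (fls_const c * fls_X_intpow k)"

text \<open>The operator $\widehat H_a$; \<open>D v\<close> is the action of $\partial_v$ on the objects on which
  $\widehat H_a$ acts.\<close>

definition quant ::
    "('h :: ab_group_add, 'n :: finite) gwdata \<Rightarrow> (nat \<Rightarrow> 'h \<Rightarrow> 'h) \<Rightarrow>
     ('n var \<Rightarrow> 'n hser \<Rightarrow> 'n hser) \<Rightarrow> 'n hser \<Rightarrow> 'n hser" where
  "quant X a D \<Phi> = formal_sum (\<lambda>(u, v).
       hscalar (ham2 X a (pbas X u) (pbas X v)) 1 * D u (D v \<Phi>)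
     + hscalar (ham2 X a (pbas X u) (qbas X v) + ham2 X a (qbas X v) (pbas X u)) 0
         * qvar X v * D u \<Phi>
     + hscalar (ham2 X a (qbas X u) (qbas X v)) (- 1) * qvar X u * qvar X v * \<Phi>)"

text \<open>The exponent $E = \hbar^{-1}F_0 + F_1 + \hbar F_2 + \dots$ of a total descendant potential.
  The potential $\exp E$ itself is a formal expression (its expansion would involve infinite sums
  of powers of $\hbar$ unbounded in both directions).\<close>

definition log_pot :: "(nat \<Rightarrow> 'n tser) \<Rightarrow> 'n hser" where
  "log_pot Fs = Mfps (\<lambda>m. fls_shift 1 (fps_to_fls (Abs_fps (\<lambda>g. mcoeff (Fs g) m))))"

text \<open>The action of $\partial_v$ on expressions $e^E P$, where
  $\partial_v (e^E P) = e^E (\partial_v P + (\partial_v E) P)$.\<close>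

definition exp_deriv :: "'n hser \<Rightarrow> 'n var \<Rightarrow> 'n hser \<Rightarrow> 'n hser" where
  "exp_deriv E v P = mderiv v P + mderiv v E * P"

text \<open>The series $e^{-E} \exp(s \widehat H_a) e^E = \sum_n \frac{s^n}{n!} e^{-E} \widehat H_a^n e^E$
  in a formal parameter \<open>s\<close>.\<close>

definition exp_quant ::
    "('h :: ab_group_add, 'n :: finite) gwdata \<Rightarrow> (nat \<Rightarrow> 'h \<Rightarrow> 'h) \<Rightarrow> 'n hser \<Rightarrow> 'n hser fps"
  where
  "exp_quant X a E = Abs_fps (\<lambda>n. hscalar (1 / fact n) 0 * (quant X a (exp_deriv E) ^^ n) 1)"

text \<open>The exponential of a power series in \<open>s\<close> without constant term.\<close>

definition fps_expo :: "'n hser fps \<Rightarrow> 'n hser fps" where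
  "fps_expo U = Abs_fps (\<lambda>n. \<Sum>k\<le>n. hscalar (1 / fact k) 0 * fps_nth (U ^ k) n)"

text \<open>$\exp(\widehat H_a)\exp(\hbar^{-1}F_0 + F_1 + \dots) = \exp(\hbar^{-1}G_0 + G_1 + \dots)$:
  here $\exp(s\widehat H_a)\, e^E = e^{W(s)}$ as formal series in \<open>s\<close>, with $W(0) = E$, and the
  coefficients of $W$ at each monomial in $t$ and $\hbar$ are evaluated, as convergent power series
  in \<open>s\<close>, at $s = 1$.\<close>

definition quantized_action ::
    "('h :: ab_group_add, 'n :: finite) gwdata \<Rightarrow> (nat \<Rightarrow> 'h \<Rightarrow> 'h) \<Rightarrow>
     (nat \<Rightarrow> 'n tser) \<Rightarrow> (nat \<Rightarrow> 'n tser) \<Rightarrow> bool" where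
  "quantized_action X a Fs Gs \<longleftrightarrow>
     (\<exists>W. fps_nth W 0 = log_pot Fs \<and>
        exp_quant X a (log_pot Fs) = fps_expo (W - fps_const (log_pot Fs)) \<and>
        (\<forall>m k. (\<lambda>n. fls_nth (mcoeff (fps_nth W n) m) k) sums fls_nth (mcoeff (log_pot Gs) m) k))"

end

theory Submission
  imports Defs
begin

text \<open>
  Since $a$ lowers powers of $z$, its Hamiltonian contains no terms $pp$, so that
  $\widehat H_a = V + \hbar^{-1} Q$ with $V$ the linear vector field
  $\mathbf q \mapsto -[a\mathbf q]_+$ and $Q$ a quadratic form.  Hence
  $\log(\exp(s\widehat H_a)e^E)$ is the solution $W(s)$ of $W' = VW + \hbar^{-1}Q$, $W(0) = E$.
  The field $V$ is the sum of a commuting constant field and a locally nilpotent one, which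
  exponentiate to a translation in $t_0$ and to a linear substitution; at $s = 1$ this gives
  $G_0(\mathbf q) = F([S^{-1}\mathbf q]_+) + \frac12 \sum_{k,l} (q_k, B_{kl}q_l)$ with
  $\sum_{k,l} w^{-k}z^{-l} B_{kl} = ((S^{-1}(w))^* S^{-1}(z) - \mathrm{Id}) / (w^{-1} + z^{-1})$.
  The chain rule together with the symplectic condition on $S$ turns
  $p = \partial G_0$ at $f$ into $p = \partial F$ at $S^{-1}f$.  The dilaton and string operators
  commute with $V$, so their equations are preserved along the flow; the topological recursion
  relation follows from the chain rule and $B_{0,k} = (S^{-1})_{k+1}$.
\<close>

text \<open>The obstacle is convergence. If S_1 moves the unit vector, the change of variables has
  constant terms, so the coefficients of F([S^{-1}q]_+) are infinite sums, known to converge only by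
  assumption. Everything else is arranged to be finite at each coefficient: linear substitutions
  without constant terms can be composed freely and undone, so the assumed convergence passes to the
  translation alone, and inverting the Jacobian passes it to all partial derivatives. The form B
  comes from solving (w^{-1} + z^{-1}) B = N with N = (S^{-1}(w))^* S^{-1}(z) - Id: the equations
  B_{k-1,l} + B_{k,l-1} = N_{k,l}, solved upwards in k, give the alternating sum in
  \<open>quad_coeff\<close>. The division is exact and B is symmetric because N vanishes at w = -z,
  which is the symplectic condition. Uniqueness of the quantized action is obtained in the formal
  parameter s, where the exponential of series without constant term is injective. Since V is free
  of hbar, each genus evolves by itself, and the source Q enters genus zero only.\<close>

unbundle no vec_syntax
unbundle fps_syntax

section \<open>Series and derivations\<close>

lemma mcoeff_0 [simp]: "mcoeff 0 m = 0"
  by (simp add: zero_mfps_def)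

lemma mcoeff_1: "mcoeff 1 m = (if m = {#} then 1 else 0)"
  by (simp add: one_mfps_def)

lemma mcoeff_add [simp]: "mcoeff (f + g) m = mcoeff f m + mcoeff g m"
  by (simp add: plus_mfps_def)

lemma mcoeff_diff [simp]: "mcoeff (f - g) m = mcoeff f m - mcoeff g m"
  by (simp add: minus_mfps_def)

lemma mcoeff_uminus [simp]: "mcoeff (- f) m = - mcoeff f m"
  by (simp add: uminus_mfps_def)

lemma mcoeff_sum: "mcoeff (sum f I) m = (\<Sum>i\<in>I. mcoeff (f i) m)"
  by (induction I rule: infinite_finite_induct) auto

lemma mcoeff_mult: "mcoeff (f * g) m = (\<Sum>a | a \<subseteq># m. mcoeff f a * mcoeff g (m - a))"
  by (simp add: times_mfps_def)

lemma mcoeff_mconst: "mcoeff (mconst c) m = (if m = {#} then c else 0)"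
  by (simp add: mconst_def)

lemma mcoeff_mvar: "mcoeff (mvar v) m = (if m = {#v#} then 1 else 0)"
  by (simp add: mvar_def)

lemma mcoeff_mderiv: "mcoeff (mderiv v f) m = of_nat (Suc (count m v)) * mcoeff f (add_mset v m)"
  by (simp add: mderiv_def)

lemma mcoeff_mconst_mult [simp]: "mcoeff (mconst c * f) m = c * mcoeff f m"
proof -
  have "mcoeff (mconst c * f) m = (\<Sum>a | a \<subseteq># m. if a = {#} then c * mcoeff f m else 0)"
    unfolding mcoeff_mult by (rule sum.cong) (auto simp: mcoeff_mconst)
  then show ?thesis by (simp add: sum.delta)
qed

lemma mconst_0 [simp]: "mconst 0 = 0"
  by (rule mfps_eqI) (simp add: mcoeff_mconst)

lemma mconst_1 [simp]: "mconst 1 = 1"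
  by (rule mfps_eqI) (simp add: mcoeff_mconst mcoeff_1)

lemma mconst_add: "mconst (a + b) = mconst a + mconst b"
  by (rule mfps_eqI) (simp add: mcoeff_mconst)

lemma mconst_uminus: "mconst (- a) = - mconst a"
  by (rule mfps_eqI) (simp add: mcoeff_mconst)

lemma mconst_mult: "mconst (a * b) = mconst a * mconst b"
  by (rule mfps_eqI) (simp add: mcoeff_mconst)

lemma mconst_sum: "mconst (sum f I) = (\<Sum>i\<in>I. mconst (f i))"
  by (rule mfps_eqI) (simp add: mcoeff_mconst mcoeff_sum)

lemma mcoeff_mvar_mult:
  "mcoeff (mvar v * f) m = (if v \<in># m then mcoeff f (m - {#v#}) else 0)"
proof -
  have "mcoeff (mvar v * f) m = (\<Sum>a | a \<subseteq># m. if a = {#v#} then mcoeff f (m - {#v#}) else 0)"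
    unfolding mcoeff_mult by (rule sum.cong) (auto simp: mcoeff_mvar)
  then show ?thesis by (simp add: sum.delta)
qed

lemma mderiv_0 [simp]: "mderiv v 0 = 0"
  by (rule mfps_eqI) (simp add: mcoeff_mderiv)

lemma mderiv_mconst [simp]: "mderiv v (mconst c) = 0"
  by (rule mfps_eqI) (simp add: mcoeff_mderiv mcoeff_mconst)

lemma mderiv_1 [simp]: "mderiv v 1 = 0"
  using mderiv_mconst[of v 1] by simp

lemma mderiv_add: "mderiv v (f + g) = mderiv v f + mderiv v g"
  by (rule mfps_eqI) (simp add: mcoeff_mderiv algebra_simps)

lemma mderiv_diff: "mderiv v (f - g) = mderiv v f - mderiv v g"
  by (rule mfps_eqI) (simp add: mcoeff_mderiv algebra_simps)

lemma mderiv_sum: "mderiv v (sum f I) = (\<Sum>i\<in>I. mderiv v (f i))"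
  by (induction I rule: infinite_finite_induct) (auto simp: mderiv_add)

lemma mderiv_mconst_mult: "mderiv v (mconst c * f) = mconst c * mderiv v f"
  by (rule mfps_eqI) (simp add: mcoeff_mderiv)

lemma mderiv_mvar: "mderiv v (mvar w) = (if v = w then 1 else 0)"
  by (rule mfps_eqI) (auto simp: mcoeff_mderiv mcoeff_mvar mcoeff_1)

lemma mderiv_commute: "mderiv v (mderiv w f) = mderiv w (mderiv v f)"
  by (rule mfps_eqI) (auto simp: mcoeff_mderiv add_mset_commute algebra_simps)

text \<open>Submultisets without \<open>v\<close> have weight zero, and the others arise by adding
  \<open>v\<close> to a submultiset of \<open>m\<close>. This index shift is behind the product
  rule.\<close>

lemma sum_submset_count:
  fixes F :: "'v multiset \<Rightarrow> 'a :: comm_ring_1"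
  shows "(\<Sum>a | a \<subseteq># add_mset v m. of_nat (count a v) * F a)
       = (\<Sum>b | b \<subseteq># m. of_nat (Suc (count b v)) * F (add_mset v b))"
proof -
  have "(\<Sum>a | a \<subseteq># add_mset v m. of_nat (count a v) * F a)
      = (\<Sum>a | a \<subseteq># add_mset v m \<and> v \<in># a. of_nat (count a v) * F a)"
    by (rule sum.mono_neutral_right) (auto simp: not_in_iff)
  also have "\<dots> = (\<Sum>b | b \<subseteq># m. of_nat (Suc (count b v)) * F (add_mset v b))"
    by (rule sum.reindex_bij_witness[where i = "add_mset v" and j = "\<lambda>a. a - {#v#}"])
      (auto simp: insert_subset_eq_iff subset_eq_diff_conv)
  finally show ?thesis .
qed

text \<open>Differentiating one factor weights each splitting of the monomial by the multiplicity of
  \<open>v\<close> in that factor, and the two multiplicities add up to the one in the whole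
  monomial.\<close>

lemma mderiv_mult: "mderiv v (f * g) = mderiv v f * g + f * mderiv v g"
proof (rule mfps_eqI)
  fix m
  have *: "mcoeff (mderiv v f * g) m =
      (\<Sum>a | a \<subseteq># add_mset v m. of_nat (count a v) * (mcoeff f a * mcoeff g (add_mset v m - a)))"
    for f g :: "('a, 'b) mfps"
    unfolding sum_submset_count mcoeff_mult mcoeff_mderiv by (simp add: mult_ac)
  have "mcoeff (f * mderiv v g) m = (\<Sum>a | a \<subseteq># add_mset v m.
      of_nat (count a v) * (mcoeff g a * mcoeff f (add_mset v m - a)))"
    by (subst mult.commute) (rule *)
  also have "\<dots> = (\<Sum>a | a \<subseteq># add_mset v m.
      of_nat (count (add_mset v m - a) v) * (mcoeff f a * mcoeff g (add_mset v m - a)))"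
    by (rule sum.reindex_bij_witness[where i = "\<lambda>a. add_mset v m - a" and j = "\<lambda>a. add_mset v m - a"])
      (auto simp: diff_diff_submset mult_ac)
  finally have "mcoeff (mderiv v f * g + f * mderiv v g) m = (\<Sum>a | a \<subseteq># add_mset v m.
      of_nat (count a v + count (add_mset v m - a) v) * (mcoeff f a * mcoeff g (add_mset v m - a)))"
    by (simp add: * sum.distrib[symmetric] ring_distribs)
  also have "\<dots> = (\<Sum>a | a \<subseteq># add_mset v m.
      of_nat (count (add_mset v m) v) * (mcoeff f a * mcoeff g (add_mset v m - a)))"
  proof (rule sum.cong, goal_cases)
    case (2 a)
    then have "count a v + count (add_mset v m - a) v = count (add_mset v m) v"
      using mset_subset_eq_count[of a "add_mset v m" v] by (simp only: count_diff) auto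
    then show ?case by (simp only:)
  qed simp
  also have "\<dots> = mcoeff (mderiv v (f * g)) m"
    by (simp add: mcoeff_mderiv mcoeff_mult sum_distrib_left)
  finally show "mcoeff (mderiv v (f * g)) m = mcoeff (mderiv v f * g + f * mderiv v g) m" by simp
qed

definition monomial :: "'v multiset \<Rightarrow> ('v, 'a :: comm_ring_1) mfps" where
  "monomial k = Mfps (\<lambda>m. if m = k then 1 else 0)"

lemma mcoeff_monomial: "mcoeff (monomial k) m = (if m = k then 1 else 0)"
  by (simp add: monomial_def)

lemma monomial_eq_prod: "monomial k = (\<Prod>v\<in>#k. mvar v)"
proof (induction k)
  case empty
  then show ?case by (intro mfps_eqI) (simp add: mcoeff_monomial mcoeff_1)
next
  case (add v k)
  have "(\<Prod>v\<in>#add_mset v k. mvar v) = (mvar v * monomial k :: ('a, 'b) mfps)"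
    using add by simp
  also have "\<dots> = monomial (add_mset v k)"
    by (rule mfps_eqI) (auto simp: mcoeff_monomial mcoeff_mvar_mult dest!: multi_member_split)
  finally show ?case by simp
qed

text \<open>The families substituted below are affine, so their derivatives are constants
  \<open>P v\<close>; the product rule then collects equal factors with their multiplicity.\<close>

lemma mderiv_prod_mset:
  assumes A: "finite A" "\<And>v. v \<notin> A \<Longrightarrow> P v = 0" and \<tau>: "\<And>v. mderiv u (\<tau> v) = mconst (P v)"
  shows "mderiv u (\<Prod>v\<in>#m. \<tau> v) =
    (\<Sum>v\<in>A. mconst (of_nat (count m v) * P v) * (\<Prod>v\<in>#m - {#v#}. \<tau> v))"
proof (induction m)
  case empty
  then show ?case by simp
next
  case (add x m)
  have *: "mconst (of_nat (count m v) * P v) * (\<Prod>v\<in>#add_mset x m - {#v#}. \<tau> v)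
      = \<tau> x * (mconst (of_nat (count m v) * P v) * (\<Prod>v\<in>#m - {#v#}. \<tau> v))" for v
  proof (cases "v \<in># m")
    case True
    then obtain m' where "m = add_mset v m'" by (auto dest: multi_member_split)
    then show ?thesis by (cases "x = v") (auto simp: mult_ac)
  next
    case False
    then show ?thesis by (simp add: not_in_iff)
  qed
  have **: "mconst (of_nat (count (add_mset x m) v) * P v) * (\<Prod>v\<in>#add_mset x m - {#v#}. \<tau> v)
      = \<tau> x * (mconst (of_nat (count m v) * P v) * (\<Prod>v\<in>#m - {#v#}. \<tau> v))
        + (if v = x then mconst (P x) * (\<Prod>v\<in>#m. \<tau> v) else 0)" for v
    unfolding *[symmetric] by (auto simp: algebra_simps mconst_add)
  have "(\<Sum>v\<in>A. mconst (of_nat (count (add_mset x m) v) * P v) * (\<Prod>v\<in>#add_mset x m - {#v#}. \<tau> v))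
      = \<tau> x * mderiv u (\<Prod>v\<in>#m. \<tau> v) + (if x \<in> A then mconst (P x) * (\<Prod>v\<in>#m. \<tau> v) else 0)"
    unfolding ** add.IH sum.distrib sum_distrib_left using A by (simp add: sum.delta)
  also have "\<dots> = mderiv u (\<Prod>v\<in>#add_mset x m. \<tau> v)"
    using A(2)[of x] by (simp add: mderiv_mult \<tau>)
  finally show ?case by simp
qed

text \<open>Modulo series that vanish on all monomials in the variables of index at most \<open>K\<close>, the
  infinite sums over variables below become finite.\<close>

definition agree :: "nat \<Rightarrow> ('n var, 'a) mfps \<Rightarrow> ('n var, 'a) mfps \<Rightarrow> bool" where
  "agree K f g \<longleftrightarrow> (\<forall>m. (\<forall>v\<in>#m. fst v \<le> K) \<longrightarrow> mcoeff f m = mcoeff g m)"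

lemma agreeD: "agree K f g \<Longrightarrow> (\<And>v. v \<in># m \<Longrightarrow> fst v \<le> K) \<Longrightarrow> mcoeff f m = mcoeff g m"
  by (auto simp: agree_def)

lemma agree_refl [simp]: "agree K f f"
  by (simp add: agree_def)

lemma agree_sym: "agree K f g \<Longrightarrow> agree K g f"
  by (simp add: agree_def)

lemma agree_trans [trans]: "agree K f g \<Longrightarrow> agree K g h \<Longrightarrow> agree K f h"
  by (simp add: agree_def)

lemma agree_eq_trans [trans]: "agree K f g \<Longrightarrow> g = h \<Longrightarrow> agree K f h"
  "f = g \<Longrightarrow> agree K g h \<Longrightarrow> agree K f h"
  by auto

lemma agree_add: "agree K f f' \<Longrightarrow> agree K g g' \<Longrightarrow> agree K (f + g) (f' + g')"
  by (simp add: agree_def)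

lemma agree_mult: "agree K f f' \<Longrightarrow> agree K g g' \<Longrightarrow> agree K (f * g) (f' * g')"
  unfolding agree_def mcoeff_mult
  by (intro allI impI sum.cong arg_cong2[where f = times]) (auto dest: in_diffD mset_subset_eqD)

lemma agree_sum: "(\<And>i. i \<in> I \<Longrightarrow> agree K (f i) (g i)) \<Longrightarrow> agree K (sum f I) (sum g I)"
  by (auto simp: agree_def mcoeff_sum)

lemma agree_mderiv: "fst u \<le> K \<Longrightarrow> agree K f g \<Longrightarrow> agree K (mderiv u f) (mderiv u g)"
  by (auto simp: agree_def mcoeff_mderiv)

lemma mset_index_bound: obtains K where "K \<ge> K0" "\<And>v. v \<in># m \<Longrightarrow> fst v \<le> (K :: nat)"
proof
  show "Max (insert K0 (fst ` set_mset m)) \<ge> K0" by (intro Max_ge) auto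
  show "fst v \<le> Max (insert K0 (fst ` set_mset m))" if "v \<in># m" for v
    using that by (intro Max_ge) auto
qed

text \<open>A monomial contains finitely many variables, so some cutoff sees all of it. The bound
  \<open>K0\<close> leaves room for arguments that work only for large cutoffs.\<close>

lemma agree_imp_eq:
  fixes f g :: "('a var, 'b) mfps"
  assumes "\<And>K. K \<ge> K0 \<Longrightarrow> agree K f g"
  shows "f = g"
proof (rule mfps_eqI)
  fix m :: "'a var multiset"
  obtain K where "K \<ge> K0" "\<And>v. v \<in># m \<Longrightarrow> fst v \<le> K" using mset_index_bound by blast
  then show "mcoeff f m = mcoeff g m" using assms agreeD by blast
qed

lemma agree_formal_sum:
  fixes f :: "'i \<Rightarrow> ('b var, 'a :: comm_ring_1) mfps"
  assumes "finite I" "\<And>i. i \<notin> I \<Longrightarrow> agree K (f i) 0"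
  shows "agree K (formal_sum f) (sum f I)"
  unfolding agree_def formal_sum_def mcoeff_Mfps mcoeff_sum
proof (intro allI impI)
  fix m :: "'b var multiset" assume "\<forall>v\<in>#m. fst v \<le> K"
  then have "mcoeff (f i) m = 0" if "i \<notin> I" for i
    using assms(2)[OF that] by (simp add: agree_def)
  then show "Sum_any (\<lambda>i. mcoeff (f i) m) = (\<Sum>i\<in>I. mcoeff (f i) m)"
    using assms(1) by (intro Sum_any.expand_superset) auto
qed

definition vars :: "nat \<Rightarrow> ('n :: finite) var set" where
  "vars K = {v. fst v \<le> K}"

lemma finite_vars [simp]: "finite (vars K)"
proof -
  have "vars K = {..K} \<times> (UNIV :: 'a set)" by (auto simp: vars_def)
  then show ?thesis by simp
qed

lemma in_vars [simp]: "v \<in> vars K \<longleftrightarrow> fst v \<le> K"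
  by (simp add: vars_def)

lemma mderiv_qvar: "mderiv u (qvar X v) = (if u = v then 1 else 0)"
  by (simp add: qvar_def mderiv_diff mderiv_mvar)

text \<open>The cutoff has to reach index 1, because the dilaton-shifted variable has the constant
  term -1, which no bound on the variables removes.\<close>

lemma agree_qvar_0: "K \<ge> 1 \<Longrightarrow> fst v > K \<Longrightarrow> agree K (qvar X v) 0"
  by (auto simp: agree_def qvar_def mcoeff_mvar)

section \<open>Vector fields\<close>

text \<open>The derivative along the linear field q -> hq: \<open>v\<close> is the source coordinate
  and \<open>u\<close> the target.\<close>

definition vfield :: "('h, 'n) gwdata \<Rightarrow> ('n var \<Rightarrow> 'n var \<Rightarrow> 'a :: comm_ring_1) \<Rightarrow>
    ('n var, 'a) mfps \<Rightarrow> ('n var, 'a) mfps" where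
  "vfield X h f = formal_sum (\<lambda>(u, v). mconst (h u v) * qvar X v * mderiv u f)"

definition vfield_upto :: "('h, 'n :: finite) gwdata \<Rightarrow> ('n var \<Rightarrow> 'n var \<Rightarrow> 'a :: comm_ring_1) \<Rightarrow>
    nat \<Rightarrow> ('n var, 'a) mfps \<Rightarrow> ('n var, 'a) mfps" where
  "vfield_upto X h K f = (\<Sum>v\<in>vars K. \<Sum>u\<in>vars K. mconst (h u v) * qvar X v * mderiv u f)"

text \<open>This makes the sum in \<open>vfield\<close> finite modulo a cutoff: a derivative beyond
  the cutoff comes only with a variable beyond it.\<close>

definition lowering :: "('n var \<Rightarrow> 'n var \<Rightarrow> 'a :: zero) \<Rightarrow> bool" where
  "lowering h \<longleftrightarrow> (\<forall>u v. h u v \<noteq> 0 \<longrightarrow> fst u \<le> fst v)"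

lemma loweringD: "lowering h \<Longrightarrow> fst v < fst u \<Longrightarrow> h u v = 0"
  by (meson lowering_def not_less)

lemma agree_vfield:
  fixes X :: "('h, 'n :: finite) gwdata"
  assumes "lowering h" "K \<ge> 1"
  shows "agree K (vfield X h f) (vfield_upto X h K f)"
proof -
  have "agree K (vfield X h f) (\<Sum>(u, v)\<in>vars K \<times> vars K. mconst (h u v) * qvar X v * mderiv u f)"
    unfolding vfield_def
  proof (rule agree_formal_sum, goal_cases)
    case (2 i)
    obtain u v where i: "i = (u, v)" by (cases i)
    show ?case
    proof (cases "fst v \<le> K")
      case True
      with 2 i assms have "h u v = 0" by (auto intro!: loweringD)
      then show ?thesis by (simp add: i)
    next
      case False
      have "agree K (mconst (h u v) * qvar X v * mderiv u f) (mconst (h u v) * 0 * mderiv u f)"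
        using False assms by (intro agree_mult agree_refl agree_qvar_0) auto
      then show ?thesis by (simp add: i)
    qed
  qed simp
  also have "\<dots> = vfield_upto X h K f"
    unfolding vfield_upto_def by (subst sum.cartesian_product[symmetric]) (rule sum.swap)
  finally show ?thesis .
qed

lemma agree_vfield_upto:
  fixes X :: "('h, 'n :: finite) gwdata"
  shows "agree K f g \<Longrightarrow> agree K (vfield_upto X h K f) (vfield_upto X h K g)"
  unfolding vfield_upto_def by (intro agree_sum agree_mult agree_refl agree_mderiv) auto

lemma agree_vfield_cong:
  fixes X :: "('h, 'n :: finite) gwdata"
  shows "lowering h \<Longrightarrow> K \<ge> 1 \<Longrightarrow> agree K f g \<Longrightarrow> agree K (vfield X h f) (vfield_upto X h K g)"
  using agree_vfield agree_vfield_upto agree_trans by blast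

lemma vfield_upto_mult:
  fixes X :: "('h, 'n :: finite) gwdata"
  shows "vfield_upto X h K (f * g) = vfield_upto X h K f * g + f * vfield_upto X h K g"
  by (simp add: vfield_upto_def mderiv_mult ring_distribs sum.distrib sum_distrib_left
      sum_distrib_right mult_ac)

lemma vfield_mult:
  fixes X :: "('h, 'n :: finite) gwdata"
  assumes "lowering h"
  shows "vfield X h (f * g) = vfield X h f * g + f * vfield X h g"
proof (rule agree_imp_eq)
  fix K :: nat assume "K \<ge> 1"
  note * = agree_vfield[OF assms this]
  show "agree K (vfield X h (f * g)) (vfield X h f * g + f * vfield X h g)"
    by (rule agree_trans[OF *], subst vfield_upto_mult)
      (intro agree_add agree_mult agree_refl agree_sym[OF *])
qed

lemma vfield_upto_add:
  fixes X :: "('h, 'n :: finite) gwdata"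
  shows "vfield_upto X h K (f + g) = vfield_upto X h K f + vfield_upto X h K g"
  by (simp add: vfield_upto_def mderiv_add ring_distribs sum.distrib)

lemma vfield_add:
  fixes X :: "('h, 'n :: finite) gwdata"
  assumes "lowering h"
  shows "vfield X h (f + g) = vfield X h f + vfield X h g"
proof (rule agree_imp_eq)
  fix K :: nat assume "K \<ge> 1"
  note * = agree_vfield[OF assms this]
  show "agree K (vfield X h (f + g)) (vfield X h f + vfield X h g)"
    by (rule agree_trans[OF *], subst vfield_upto_add) (intro agree_add agree_sym[OF *])
qed

lemma vfield_mconst [simp]: "vfield X h (mconst c) = 0"
  by (rule mfps_eqI) (simp add: vfield_def formal_sum_def split_beta)

lemma vfield_mconst_mult:
  fixes X :: "('h, 'n :: finite) gwdata"
  shows "lowering h \<Longrightarrow> vfield X h (mconst c * f) = mconst c * vfield X h f"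
  by (simp add: vfield_mult)

lemma vfield_0 [simp]: "vfield X h 0 = 0"
  using vfield_mconst[of X h 0] by simp

lemma vfield_sum:
  fixes X :: "('h, 'n :: finite) gwdata"
  shows "lowering h \<Longrightarrow> vfield X h (sum f I) = (\<Sum>i\<in>I. vfield X h (f i))"
  by (induction I rule: infinite_finite_induct) (auto simp: vfield_add)

text \<open>The commutator of a coordinate derivative with a linear field is the constant field
  given by column \<open>w\<close> of \<open>h\<close>. That column ends at the index of
  \<open>w\<close>, so \<open>L\<close> can stay fixed while the cutoff in the proof grows.\<close>

lemma mderiv_vfield:
  fixes X :: "('h, 'n :: finite) gwdata"
  assumes "lowering h" and w: "fst w \<le> L"
  shows "mderiv w (vfield X h f) = vfield X h (mderiv w f) + (\<Sum>u\<in>vars L. mconst (h u w) * mderiv u f)"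
proof (rule agree_imp_eq)
  fix K :: nat assume K: "K \<ge> max 1 L"
  have "agree K (mderiv w (vfield X h f)) (mderiv w (vfield_upto X h K f))"
    using K w assms by (intro agree_mderiv agree_vfield) auto
  also have "\<dots> = vfield_upto X h K (mderiv w f) + (\<Sum>u\<in>vars K. mconst (h u w) * mderiv u f)"
  proof -
    have "mderiv w (vfield_upto X h K f) = (\<Sum>v\<in>vars K. \<Sum>u\<in>vars K.
        mconst (h u v) * qvar X v * mderiv u (mderiv w f)
        + (if v = w then mconst (h u w) * mderiv u f else 0))"
      by (auto simp: vfield_upto_def mderiv_sum mderiv_mult mderiv_qvar mult.assoc
          mderiv_commute[of _ w] ring_distribs intro!: sum.cong)
    also have "\<dots> = vfield_upto X h K (mderiv w f)
        + (\<Sum>u\<in>vars K. \<Sum>v\<in>vars K. if v = w then mconst (h u w) * mderiv u f else 0)"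
      unfolding vfield_upto_def sum.distrib by (subst (3) sum.swap) simp
    finally show ?thesis using w K by (simp add: sum.delta)
  qed
  also have "(\<Sum>u\<in>vars K. mconst (h u w) * mderiv u f) = (\<Sum>u\<in>vars L. mconst (h u w) * mderiv u f)"
    using K w assms by (intro sum.mono_neutral_right) (simp_all add: loweringD not_le subset_iff)
  finally show "agree K (mderiv w (vfield X h f))
      (vfield X h (mderiv w f) + (\<Sum>u\<in>vars L. mconst (h u w) * mderiv u f))"
    by (rule agree_trans) (use K in \<open>intro agree_add agree_refl agree_sym[OF agree_vfield] assms; simp\<close>)
qed

lemma sum_swap4:
  "(\<Sum>v\<in>A. \<Sum>u\<in>B. \<Sum>w\<in>C. \<Sum>x\<in>D. F v u w x) = (\<Sum>w\<in>C. \<Sum>x\<in>D. \<Sum>v\<in>A. \<Sum>u\<in>B. F v u w x)"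
proof -
  have "(\<Sum>v\<in>A. \<Sum>u\<in>B. \<Sum>w\<in>C. \<Sum>x\<in>D. F v u w x)
      = (\<Sum>v\<in>A. \<Sum>u\<in>B. \<Sum>q\<in>C \<times> D. F v u (fst q) (snd q))"
    by (intro sum.cong refl) (simp add: sum.cartesian_product split_beta)
  also have "\<dots> = (\<Sum>q\<in>C \<times> D. \<Sum>v\<in>A. \<Sum>u\<in>B. F v u (fst q) (snd q))"
    by (subst sum.swap[of _ A "C \<times> D"], intro sum.cong refl, rule sum.swap)
  finally show ?thesis
    by (simp add: sum.cartesian_product[of _ D C] split_beta)
qed

text \<open>The second-order terms of the two compositions agree by symmetry of mixed derivatives;
  the first-order terms carry the two matrix products.\<close>

lemma vfield_commute:
  fixes X :: "('h, 'n :: finite) gwdata"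
  assumes "lowering h" "lowering g"
    and comm: "\<And>u w K. fst w \<le> K \<Longrightarrow> (\<Sum>v\<in>vars K. h u v * g v w) = (\<Sum>v\<in>vars K. g u v * h v w)"
  shows "vfield X g (vfield X h f) = vfield X h (vfield X g f)"
proof (rule agree_imp_eq)
  fix K :: nat assume K: "K \<ge> 1"
  have *: "vfield_upto X g K (vfield_upto X h K f) =
      (\<Sum>w\<in>vars K. \<Sum>u\<in>vars K. mconst (\<Sum>v\<in>vars K. h u v * g v w) * qvar X w * mderiv u f)
      + (\<Sum>v\<in>vars K. \<Sum>u\<in>vars K. \<Sum>w\<in>vars K. \<Sum>x\<in>vars K.
          mconst (g u v) * mconst (h x w) * qvar X v * qvar X w * mderiv x (mderiv u f))"
    (is "_ = ?A + ?B") for g h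
  proof -
    have "vfield_upto X g K (vfield_upto X h K f) =
      (\<Sum>v\<in>vars K. \<Sum>u\<in>vars K. \<Sum>w\<in>vars K. \<Sum>x\<in>vars K.
        (if w = u then mconst (h x u * g u v) * qvar X v * mderiv x f else 0)
         + mconst (g u v) * mconst (h x w) * qvar X v * qvar X w * mderiv x (mderiv u f))"
      unfolding vfield_upto_def mderiv_sum mderiv_mult mderiv_qvar sum_distrib_left
      by (intro sum.cong refl) (simp add: mderiv_commute mconst_mult algebra_simps)
    also have "\<dots> = (\<Sum>v\<in>vars K. \<Sum>u\<in>vars K. \<Sum>w\<in>vars K. \<Sum>x\<in>vars K.
        (if w = u then mconst (h x u * g u v) * qvar X v * mderiv x f else 0)) + ?B"
      by (simp only: sum.distrib)
    also have "(\<Sum>v\<in>vars K. \<Sum>u\<in>vars K. \<Sum>w\<in>vars K. \<Sum>x\<in>vars K.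
        (if w = u then mconst (h x u * g u v) * qvar X v * mderiv x f else 0)) = ?A"
    proof (rule sum.cong)
      fix v :: "'n var" assume "v \<in> vars K"
      have "(\<Sum>u\<in>vars K. \<Sum>w\<in>vars K. \<Sum>x\<in>vars K.
          (if w = u then mconst (h x u * g u v) * qvar X v * mderiv x f else 0)) =
        (\<Sum>u\<in>vars K. \<Sum>x\<in>vars K. \<Sum>w\<in>vars K.
          (if w = u then mconst (h x u * g u v) * qvar X v * mderiv x f else 0))"
        by (intro sum.cong[OF refl] sum.swap)
      also have "\<dots> = (\<Sum>u\<in>vars K. \<Sum>x\<in>vars K. mconst (h x u * g u v) * qvar X v * mderiv x f)"
        by (intro sum.cong refl) (simp add: sum.delta)
      also have "\<dots> = (\<Sum>x\<in>vars K. \<Sum>u\<in>vars K. mconst (h x u * g u v) * qvar X v * mderiv x f)"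
        by (rule sum.swap)
      also have "\<dots> = (\<Sum>u\<in>vars K. mconst (\<Sum>w\<in>vars K. h u w * g w v) * qvar X v * mderiv u f)"
        by (simp add: mconst_sum sum_distrib_right)
      finally show "(\<Sum>u\<in>vars K. \<Sum>w\<in>vars K. \<Sum>x\<in>vars K.
          (if w = u then mconst (h x u * g u v) * qvar X v * mderiv x f else 0)) =
          (\<Sum>u\<in>vars K. mconst (\<Sum>w\<in>vars K. h u w * g w v) * qvar X v * mderiv u f)" .
    qed simp
    finally show ?thesis .
  qed
  have "vfield_upto X g K (vfield_upto X h K f) = vfield_upto X h K (vfield_upto X g K f)"
    unfolding *
  proof (rule arg_cong2[where f = "(+)"], goal_cases)
    case 1
    show ?case by (intro sum.cong refl) (simp add: comm)
  next
    case 2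
    show ?case
      by (subst sum_swap4) (intro sum.cong refl, simp add: mderiv_commute mult_ac)
  qed
  then show "agree K (vfield X g (vfield X h f)) (vfield X h (vfield X g f))"
    using agree_vfield_cong[OF assms(2) K agree_vfield[OF assms(1) K]]
      agree_vfield_cong[OF assms(1) K agree_vfield[OF assms(2) K]]
    by (metis agree_sym agree_trans)
qed

section \<open>Exponentials of the quantized Hamiltonian\<close>

lemma hscalar_0_mult: "hscalar a 0 * hscalar b k = hscalar (a * b) k"
  by (simp add: hscalar_def mconst_mult[symmetric] mult.assoc[symmetric])

lemma hscalar_add: "hscalar (a + b) k = hscalar a k + hscalar b k"
  by (simp add: hscalar_def mconst_add[symmetric] fls_plus_const[symmetric] ring_distribs)

lemma hscalar_0 [simp]: "hscalar 0 k = 0"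
  by (simp add: hscalar_def)

lemma hscalar_1 [simp]: "hscalar 1 0 = 1"
  by (simp add: hscalar_def)

lemma hscalar_of_nat: "hscalar (of_nat n) 0 = of_nat n"
  by (induction n) (simp_all add: hscalar_add)

lemma of_nat_mult_hscalar: "n > 0 \<Longrightarrow> of_nat n * (hscalar (1 / of_nat n) 0 * x) = x"
  by (simp add: hscalar_of_nat[symmetric] mult.assoc[symmetric] hscalar_0_mult)

lemma of_nat_hser_cancel:
  fixes x y :: "'n hser"
  assumes "of_nat (Suc n) * x = of_nat (Suc n) * y"
  shows "x = y"
proof -
  have "hscalar (1 / of_nat (Suc n)) 0 * (of_nat (Suc n) * x) = x" for x :: "'n hser"
    using of_nat_mult_hscalar[of "Suc n" x] by (simp only: mult.left_commute)
  with assms show ?thesis by metis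
qed

lemma fps_expo_nth_0 [simp]: "fps_expo U $ 0 = 1"
  by (simp add: fps_expo_def)

text \<open>A derivation that looks at finitely many coefficients at a time satisfies the chain rule
  for the exponential, because it can be replaced by a partial sum of the exponential series.\<close>

lemma derivation_fps_expo:
  fixes D :: "'n hser fps \<Rightarrow> 'n hser fps"
  assumes add: "\<And>x y. D (x + y) = D x + D y" and mult: "\<And>x y. D (x * y) = x * D y + D x * y"
    and const: "\<And>c. D (fps_const (hscalar c 0)) = 0"
    and loc: "\<And>P Q n. (\<And>j. j \<le> Suc n \<Longrightarrow> P $ j = Q $ j) \<Longrightarrow> D P $ n = D Q $ n"
    and U: "U $ 0 = 0"
  shows "D (fps_expo U) = D U * fps_expo U"
proof (rule fps_ext)
  fix n
  define e where "e N = (\<Sum>k\<le>N. fps_const (hscalar (1 / fact k) 0) * U ^ k)" for N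
  \<comment> \<open>\<open>U\<close> starts at order one, so its powers beyond \<open>j\<close> do
    not reach the coefficient \<open>j\<close>.\<close>
  have e: "fps_expo U $ j = e N $ j" if "j \<le> N" for j N
  proof -
    have "e N $ j = (\<Sum>k\<le>N. hscalar (1 / fact k) 0 * (U ^ k) $ j)"
      by (simp add: e_def fps_sum_nth)
    also have "\<dots> = (\<Sum>k\<le>j. hscalar (1 / fact k) 0 * (U ^ k) $ j)"
      using that startsby_zero_power_prefix[OF U] by (intro sum.mono_neutral_right) auto
    finally show ?thesis by (simp add: fps_expo_def)
  qed
  have D1: "D 1 = 0"
    using const[of 1] by simp
  have Dpow: "D (U ^ Suc k) = of_nat (Suc k) * (U ^ k * D U)" for k
    by (induction k) (simp_all add: mult D1 algebra_simps)
  have D0: "D 0 = 0" using add[of 0 0] by simp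
  have De: "D (e (Suc N)) = D U * e N" for N
  proof -
    have D_sum: "D (sum f I) = (\<Sum>i\<in>I. D (f i))" for f and I :: "nat set"
      by (induction I rule: infinite_finite_induct) (auto simp: add D0)
    have "fps_const (hscalar (1 / fact (Suc k)) 0) * of_nat (Suc k)
        = (fps_const (hscalar (1 / fact k) 0) :: 'n hser fps)"
      for k
    proof -
      have "hscalar (1 / fact (Suc k)) 0 * of_nat (Suc k) = (hscalar (1 / fact k) 0 :: 'n hser)"
        unfolding hscalar_of_nat[symmetric] hscalar_0_mult by (simp add: field_simps del: of_nat_Suc)
      then show ?thesis by (simp only: fps_of_nat[symmetric] fps_const_mult)
    qed
    then have "D (fps_const (hscalar (1 / fact (Suc k)) 0) * U ^ Suc k)
        = fps_const (hscalar (1 / fact k) 0) * (U ^ k * D U)" for k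
      by (simp only: mult const Dpow mult.assoc[symmetric] mult_zero_left add_0_right)
    moreover have "D (e (Suc N)) = D (fps_const (hscalar (1 / fact 0) 0) * U ^ 0)
        + (\<Sum>k\<le>N. D (fps_const (hscalar (1 / fact (Suc k)) 0) * U ^ Suc k))"
      by (simp only: e_def sum.atMost_Suc_shift add D_sum)
    ultimately show ?thesis
      by (simp add: D1 e_def sum_distrib_left mult_ac del: power_Suc fact_Suc)
  qed
  have "D (fps_expo U) $ n = D (e (Suc n)) $ n"
    by (rule loc) (rule e)
  also have "\<dots> = (D U * fps_expo U) $ n"
    unfolding De fps_mult_nth using e[of "n - i" n for i, symmetric] by (intro sum.cong refl) auto
  finally show "D (fps_expo U) $ n = (D U * fps_expo U) $ n" .
qed

lemma fps_deriv_fps_expo: "U $ 0 = 0 \<Longrightarrow> fps_deriv (fps_expo U) = fps_deriv U * fps_expo U"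
  by (rule derivation_fps_expo) auto

text \<open>The logarithmic derivative recovers the exponent: the common exponential P solves P' =
  V'P for both exponents V, and this equation determines V recursively.\<close>

lemma fps_expo_inject:
  assumes "fps_expo U = fps_expo U'" "U $ 0 = 0" "U' $ 0 = 0"
  shows "U = U'"
proof -
  let ?P = "fps_expo U"
  \<comment> \<open>Because \<open>?P $ 0 = 1\<close>, the last term of the convolution is the
    coefficient to be solved for.\<close>
  have *: "of_nat (Suc n) * V $ Suc n = fps_deriv ?P $ n - (\<Sum>i<n. fps_deriv V $ i * ?P $ (n - i))"
    if "fps_deriv ?P = fps_deriv V * ?P" for V n
    unfolding that fps_mult_nth by (simp add: atLeast0AtMost lessThan_Suc_atMost[symmetric])
  have d: "fps_deriv ?P = fps_deriv U * ?P" "fps_deriv ?P = fps_deriv U' * ?P"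
    using assms fps_deriv_fps_expo[of U] fps_deriv_fps_expo[of U'] by auto
  have "U $ n = U' $ n" for n
  proof (induction n rule: less_induct)
    case (less n)
    show ?case
    proof (cases n)
      case 0
      then show ?thesis using assms by simp
    next
      case (Suc k)
      have "(\<Sum>i<k. fps_deriv U $ i * ?P $ (k - i)) = (\<Sum>i<k. fps_deriv U' $ i * ?P $ (k - i))"
        using less Suc by (intro sum.cong) auto
      then have "of_nat (Suc k) * U $ Suc k = of_nat (Suc k) * U' $ Suc k"
        unfolding *[OF d(1)] *[OF d(2)] by simp
      then show ?thesis unfolding Suc by (rule of_nat_hser_cancel)
    qed
  qed
  then show ?thesis by (rule fps_ext)
qed

definition qform :: "('h, 'n) gwdata \<Rightarrow> ('n var \<Rightarrow> 'n var \<Rightarrow> 'a :: comm_ring_1) \<Rightarrow> ('n var, 'a) mfps" where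
  "qform X B = formal_sum (\<lambda>(u, v). mconst (B u v) * qvar X u * qvar X v)"

lemma agree_qform:
  fixes X :: "('h, 'n :: finite) gwdata"
  assumes K: "K \<ge> 1"
  shows "agree K (qform X B) (\<Sum>u\<in>vars K. \<Sum>v\<in>vars K. mconst (B u v) * qvar X u * qvar X v)"
proof -
  have "agree K (qform X B) (\<Sum>(u, v)\<in>vars K \<times> vars K. mconst (B u v) * qvar X u * qvar X v)"
    unfolding qform_def
  proof (rule agree_formal_sum, goal_cases)
    case (2 i)
    obtain u v where i: "i = (u, v)" by (cases i)
    have *: "agree K (mconst (B u v) * qvar X u * qvar X v)
        (mconst (B u v) * (if fst u > K then 0 else qvar X u) * (if fst v > K then 0 else qvar X v))"
      using K by (intro agree_mult agree_refl) (auto intro: agree_qvar_0)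
    have "fst u > K \<or> fst v > K" using 2 i by auto
    then have "mconst (B u v) * (if fst u > K then 0 else qvar X u) * (if fst v > K then 0 else qvar X v) = 0"
      by auto
    then show ?case using * by (simp only: i prod.case)
  qed simp
  then show ?thesis by (subst sum.cartesian_product)
qed

section \<open>Components by powers of hbar\<close>

definition hbar_comp :: "int \<Rightarrow> 'n hser \<Rightarrow> 'n tser" where
  "hbar_comp k \<Phi> = Mfps (\<lambda>m. mcoeff \<Phi> m $$ k)"

lemma mcoeff_hbar_comp [simp]: "mcoeff (hbar_comp k \<Phi>) m = mcoeff \<Phi> m $$ k"
  by (simp add: hbar_comp_def)

lemma hbar_comp_add: "hbar_comp k (f + g) = hbar_comp k f + hbar_comp k g"
  by (rule mfps_eqI) simp

lemma hbar_comp_0 [simp]: "hbar_comp k 0 = 0"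
  by (rule mfps_eqI) simp

lemma hbar_comp_mconst_mult: "hbar_comp k (mconst (fls_const c) * f) = mconst c * hbar_comp k f"
  by (rule mfps_eqI) simp

lemma hbar_comp_sum: "hbar_comp k (sum f I) = (\<Sum>i\<in>I. hbar_comp k (f i))"
  by (induction I rule: infinite_finite_induct) (auto simp: hbar_comp_add)

lemma mcoeff_qvar_mult:
  "mcoeff (qvar X v * f) m =
    (if v \<in># m then mcoeff f (m - {#v#}) else 0) - (if v = (1, unit_ix X) then mcoeff f m else 0)"
  by (simp add: qvar_def left_diff_distrib mcoeff_mvar_mult)

lemma hbar_comp_qvar_mult: "hbar_comp k (qvar X v * f) = qvar X v * hbar_comp k f"
  by (rule mfps_eqI) (simp add: mcoeff_qvar_mult)

lemma hbar_comp_mderiv: "hbar_comp k (mderiv v f) = mderiv v (hbar_comp k f)"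
  by (rule mfps_eqI)
    (simp add: mcoeff_mderiv fls_of_nat[symmetric] algebra_simps flip: fls_of_nat)

lemma hbar_comp_hscalar_mult: "hbar_comp k (hscalar c j * f) = mconst c * hbar_comp (k - j) f"
proof (rule mfps_eqI)
  fix m
  have "fls_const c * fls_X_intpow j * mcoeff f m = fls_const c * (fls_X_intpow j * mcoeff f m)"
    by (rule mult.assoc)
  then show "mcoeff (hbar_comp k (hscalar c j * f)) m = mcoeff (mconst c * hbar_comp (k - j) f) m"
    by (simp only: hscalar_def mcoeff_hbar_comp mcoeff_mconst_mult fls_mult_const_nth
        fls_X_intpow_times_conv_shift(1)[of j] fls_shift_nth) simp
qed

lemma hbar_comp_1: "hbar_comp k 1 = (if k = 0 then 1 else 0)"
  by (rule mfps_eqI) (simp add: mcoeff_1)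

lemma agree_hbar_comp: "agree K f g \<Longrightarrow> agree K (hbar_comp k f) (hbar_comp k g)"
  by (simp add: agree_def)

text \<open>The matrix of the field is free of hbar, so its flow does not mix genera.\<close>

lemma hbar_comp_vfield:
  fixes X :: "('h, 'n :: finite) gwdata"
  assumes h: "lowering h"
  shows "hbar_comp k (vfield X (\<lambda>u v. fls_const (h u v)) f) = vfield X h (hbar_comp k f)"
proof (rule agree_imp_eq)
  fix K :: nat assume K: "K \<ge> 1"
  have h': "lowering (\<lambda>u v. fls_const (h u v))" using h by (auto simp: lowering_def)
  have "hbar_comp k (vfield_upto X (\<lambda>u v. fls_const (h u v)) K f) = vfield_upto X h K (hbar_comp k f)"
    unfolding vfield_upto_def hbar_comp_sum mult.assoc hbar_comp_mconst_mult hbar_comp_qvar_mult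
      hbar_comp_mderiv ..
  then show "agree K (hbar_comp k (vfield X (\<lambda>u v. fls_const (h u v)) f)) (vfield X h (hbar_comp k f))"
    using agree_hbar_comp[OF agree_vfield[OF h' K], of k X f] agree_sym[OF agree_vfield[OF h K]]
    by (auto intro: agree_trans)
qed

definition hqform :: "('h, 'n) gwdata \<Rightarrow> ('n var \<Rightarrow> 'n var \<Rightarrow> complex) \<Rightarrow> 'n hser" where
  "hqform X B = qform X (\<lambda>u v. fls_const (B u v) * fls_X_intpow (- 1))"

lemma hbar_comp_hqform:
  fixes X :: "('h, 'n :: finite) gwdata"
  shows "hbar_comp k (hqform X B) = (if k = - 1 then qform X B else 0)"
proof (rule agree_imp_eq)
  fix K :: nat assume K: "K \<ge> 1"
  have *: "hbar_comp k (hscalar c (- 1) * qvar X u * qvar X v) =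
      (if k = - 1 then mconst c * qvar X u * qvar X v else 0)" for c u v
    using hbar_comp_hscalar_mult[of k c "- 1" "qvar X u * (qvar X v * 1)"]
    unfolding hbar_comp_qvar_mult hbar_comp_1 by (simp add: mult.assoc)
  have "hbar_comp k (\<Sum>u\<in>vars K. \<Sum>v\<in>vars K.
        mconst (fls_const (B u v) * fls_X_intpow (- 1)) * qvar X u * qvar X v) =
      (if k = - 1 then (\<Sum>u\<in>vars K. \<Sum>v\<in>vars K. mconst (B u v) * qvar X u * qvar X v) else 0)"
    unfolding hbar_comp_sum hscalar_def[symmetric] * by simp
  moreover have "agree K (hbar_comp k (hqform X B)) (hbar_comp k (\<Sum>u\<in>vars K. \<Sum>v\<in>vars K.
        mconst (fls_const (B u v) * fls_X_intpow (- 1)) * qvar X u * qvar X v))"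
    unfolding hqform_def by (intro agree_hbar_comp agree_qform K)
  ultimately show "agree K (hbar_comp k (hqform X B)) (if k = - 1 then qform X B else 0)"
    using agree_qform[OF K, of X B] by (auto intro: agree_trans agree_sym)
qed

text \<open>Conjugation by e^E replaces a derivative D by D + (DE). For an operator of first order
  this only adds a multiplication; a pp-part would bring in products of derivatives of E.\<close>

lemma quant_exp_deriv:
  fixes X :: "('h :: ab_group_add, 'n :: finite) gwdata"
  assumes pp: "\<And>u v. ham2 X a (pbas X u) (pbas X v) = 0"
    and pq: "\<And>u v. ham2 X a (pbas X u) (qbas X v) + ham2 X a (qbas X v) (pbas X u) = h u v"
    and qq: "\<And>u v. ham2 X a (qbas X u) (qbas X v) = B u v"
    and h: "lowering h"
  shows "quant X a (exp_deriv E) P =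
    vfield X (\<lambda>u v. fls_const (h u v)) P + (vfield X (\<lambda>u v. fls_const (h u v)) E + hqform X B) * P"
    (is "_ = ?R")
proof (rule agree_imp_eq)
  fix K :: nat assume K: "K \<ge> 1"
  let ?h = "\<lambda>u v. fls_const (h u v)"
  have h': "lowering ?h" using h by (auto simp: lowering_def)
  let ?t = "\<lambda>u v. mconst (?h u v) * qvar X v * exp_deriv E u P
      + mconst (fls_const (B u v) * fls_X_intpow (- 1)) * qvar X u * qvar X v * P"
  have q1: "quant X a (exp_deriv E) P = formal_sum (\<lambda>(u, v). ?t u v)"
    unfolding quant_def pp pq qq by (simp add: hscalar_def)
  have q2: "agree K (formal_sum (\<lambda>(u, v). ?t u v)) (\<Sum>(u, v)\<in>vars K \<times> vars K. ?t u v)"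
  proof (rule agree_formal_sum, goal_cases)
    case (2 i)
    obtain u v where i: "i = (u, v)" by (cases i)
    let ?q = "\<lambda>u. if fst u > K then 0 else qvar X u"
    have "agree K (?t u v) (mconst (?h u v) * ?q v * exp_deriv E u P
      + mconst (fls_const (B u v) * fls_X_intpow (- 1)) * ?q u * ?q v * P)"
      using K by (intro agree_add agree_mult agree_refl) (auto intro: agree_qvar_0)
    \<comment> \<open>Outside the square, either the variable of \<open>v\<close> is zero modulo the
      cutoff, or only \<open>u\<close> lies beyond it and then both \<open>h u v\<close> and the
      variable of \<open>u\<close> drop out.\<close>
    moreover have "fst u > K \<or> fst v > K" using 2 i by auto
    then have "mconst (?h u v) * ?q v * exp_deriv E u P
      + mconst (fls_const (B u v) * fls_X_intpow (- 1)) * ?q u * ?q v * P = 0"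
      using loweringD[OF h, of v u] by auto
    ultimately show ?case by (simp only: i prod.case)
  qed simp
  have q3: "(\<Sum>(u, v)\<in>vars K \<times> vars K. ?t u v) = (\<Sum>u\<in>vars K. \<Sum>v\<in>vars K. ?t u v)"
    by (rule sum.cartesian_product[symmetric])
  have q4: "(\<Sum>u\<in>vars K. \<Sum>v\<in>vars K. ?t u v) = vfield_upto X ?h K P + (vfield_upto X ?h K E +
      (\<Sum>u\<in>vars K. \<Sum>v\<in>vars K. mconst (fls_const (B u v) * fls_X_intpow (- 1)) * qvar X u * qvar X v)) * P"
  proof -
    have "vfield_upto X ?h K f = (\<Sum>u\<in>vars K. \<Sum>v\<in>vars K. mconst (?h u v) * qvar X v * mderiv u f)" for f
      unfolding vfield_upto_def by (rule sum.swap)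
    then show ?thesis
      by (simp add: exp_deriv_def ring_distribs sum.distrib sum_distrib_right mult.assoc)
  qed
  have q5: "agree K ?R (vfield_upto X ?h K P + (vfield_upto X ?h K E +
      (\<Sum>u\<in>vars K. \<Sum>v\<in>vars K. mconst (fls_const (B u v) * fls_X_intpow (- 1)) * qvar X u * qvar X v)) * P)"
    unfolding hqform_def by (intro agree_add agree_mult agree_refl agree_vfield agree_qform h' K)
  show "agree K (quant X a (exp_deriv E) P) ?R"
    unfolding q1 by (rule agree_trans[OF q2 agree_eq_trans(2)[OF trans[OF q3 q4] agree_sym[OF q5]]])
qed

text \<open>With $c = VE + Q$ both $e^{-E}\exp(s\widehat H_a)e^E$ and $e^{W(s)-E}$ solve
  $P' = VP + cP$, $P(0) = 1$.\<close>

lemma exp_quant_eq_fps_expo: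
  fixes X :: "('h :: ab_group_add, 'n :: finite) gwdata" and V :: "'n hser \<Rightarrow> 'n hser"
  assumes add: "\<And>x y. V (x + y) = V x + V y" and mult: "\<And>x y. V (x * y) = V x * y + x * V y"
    and const: "\<And>c. V (hscalar c 0) = 0"
    and quant: "\<And>P. quant X a (exp_deriv E) P = V P + (V E + Q) * P"
    and W0: "W $ 0 = E"
    and W: "\<And>n. of_nat (Suc n) * W $ Suc n = V (W $ n) + (if n = 0 then Q else 0)"
  shows "exp_quant X a E = fps_expo (W - fps_const E)"
proof -
  define U where "U = W - fps_const E"
  define D where "D P = Abs_fps (\<lambda>n. V (P $ n))" for P :: "'n hser fps"
  have V0: "V 0 = 0" using add[of 0 0] by simp
  have V_sum: "V (sum f I) = (\<Sum>i\<in>I. V (f i))" for f and I :: "nat set"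
    by (induction I rule: infinite_finite_induct) (auto simp: add V0)
  have U0: "U $ 0 = 0" by (simp add: U_def W0)
  have D: "D (fps_expo U) = D U * fps_expo U"
  proof (rule derivation_fps_expo)
    show "D (x * y) = x * D y + D x * y" for x y
      by (rule fps_ext) (simp add: D_def fps_mult_nth V_sum mult sum.distrib)
    show "D (fps_const (hscalar c 0)) = 0" for c
      by (rule fps_ext) (simp add: D_def const V0)
  qed (auto simp: D_def add U0 intro!: fps_ext)
  have dU: "fps_deriv U = D U + fps_const (V E + Q)"
  proof (rule fps_ext)
    fix n show "fps_deriv U $ n = (D U + fps_const (V E + Q)) $ n"
      using W[of n] by (cases n) (simp_all add: U_def D_def W0 V0)
  qed
  \<comment> \<open>The differential equation becomes the recursion by which
    \<open>exp_quant\<close> is defined.\<close>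
  have P: "of_nat (Suc n) * fps_expo U $ Suc n = quant X a (exp_deriv E) (fps_expo U $ n)" for n
  proof -
    have "of_nat (Suc n) * fps_expo U $ Suc n = fps_deriv (fps_expo U) $ n" by simp
    also have "\<dots> = (D (fps_expo U) + fps_const (V E + Q) * fps_expo U) $ n"
      unfolding fps_deriv_fps_expo[OF U0] dU D by (simp add: ring_distribs)
    finally show ?thesis by (simp add: quant D_def)
  qed
  have qlin: "quant X a (exp_deriv E) (hscalar c 0 * P) = hscalar c 0 * quant X a (exp_deriv E) P" for c P
    by (simp add: quant mult const algebra_simps)
  have "exp_quant X a E $ n = fps_expo U $ n" for n
  proof (induction n)
    case 0
    show ?case by (simp add: exp_quant_def)
  next
    case (Suc n)
    have "of_nat (Suc n) * exp_quant X a E $ Suc n = quant X a (exp_deriv E) (exp_quant X a E $ n)"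
      unfolding exp_quant_def fps_nth_Abs_fps qlin hscalar_of_nat[symmetric] mult.assoc[symmetric]
        hscalar_0_mult funpow.simps comp_apply
      by (simp add: field_simps del: of_nat_Suc)
    then show ?case unfolding Suc P[symmetric] by (rule of_nat_hser_cancel)
  qed
  then show ?thesis unfolding U_def by (rule fps_ext)
qed

section \<open>Substitution\<close>

text \<open>Complex unconditional sums converge absolutely, and so does the family of products; the
  double sum may therefore be evaluated iteratively.\<close>

lemma has_sum_prod_complex:
  fixes f :: "'i \<Rightarrow> complex" and g :: "'j \<Rightarrow> complex"
  assumes f: "(f has_sum a) UNIV" and g: "(g has_sum b) UNIV"
  shows "((\<lambda>(x, y). f x * g y) has_sum a * b) UNIV"
proof -
  have nf: "(\<lambda>x. norm (f x)) summable_on UNIV" and ng: "(\<lambda>y. norm (g y)) summable_on UNIV"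
    using f g by (auto simp: summable_on_iff_abs_summable_on_complex[symmetric] summable_on_def)
  have *: "(\<lambda>y. norm (f x * g y)) summable_on UNIV" for x
    unfolding norm_mult by (intro summable_on_cmult_right ng)
  have **: "(\<lambda>x. norm (infsum (\<lambda>y. norm (f x * g y)) UNIV)) summable_on UNIV"
  proof -
    have "infsum (\<lambda>y. norm (f x * g y)) UNIV = norm (f x) * infsum (\<lambda>y. norm (g y)) UNIV" for x
      unfolding norm_mult by (intro infsum_cmult_right) (use ng in auto)
    moreover have "infsum (\<lambda>y. norm (g y)) UNIV \<ge> 0" by (rule infsum_nonneg) simp
    ultimately have "norm (infsum (\<lambda>y. norm (f x * g y)) UNIV) = norm (f x) * infsum (\<lambda>y. norm (g y)) UNIV" for x
      by (simp only: real_norm_def abs_of_nonneg mult_nonneg_nonneg norm_ge_zero)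
    then show ?thesis by (simp only: summable_on_cmult_left nf)
  qed
  have "(\<lambda>p. norm (case p of (x, y) \<Rightarrow> f x * g y)) summable_on (Sigma UNIV (\<lambda>_. UNIV))"
    unfolding Infinite_Sum.abs_summable_on_Sigma_iff using * ** by simp
  then have "(\<lambda>(x, y). f x * g y) summable_on (Sigma UNIV (\<lambda>_. UNIV))"
    by (rule abs_summable_summable)
  then have "((\<lambda>(x, y). f x * g y) has_sum a * b) (Sigma UNIV (\<lambda>_. UNIV))"
    by (intro has_sum_SigmaI[where g = "\<lambda>x. f x * b"])
      (use f g in \<open>auto intro: has_sum_cmult_right has_sum_cmult_left\<close>)
  then show ?thesis by simp
qed

lemma has_sum_sum:
  fixes f :: "'i \<Rightarrow> 'b \<Rightarrow> 'c :: topological_comm_monoid_add"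
  assumes "finite I" "\<And>i. i \<in> I \<Longrightarrow> (f i has_sum s i) A"
  shows "((\<lambda>x. \<Sum>i\<in>I. f i x) has_sum (\<Sum>i\<in>I. s i)) A"
  using assms by (induction I rule: finite_induct) (auto intro!: has_sum_add)

lemma subst_has_sum:
  "subst_defined f \<tau> \<Longrightarrow>
    ((\<lambda>m. mcoeff f m * mcoeff (\<Prod>v\<in>#m. \<tau> v) \<mu>) has_sum mcoeff (subst f \<tau>) \<mu>) UNIV"
  by (simp add: subst_defined_def subst_def)

lemma subst_eqI:
  assumes "\<And>\<mu>. ((\<lambda>m. mcoeff f m * mcoeff (\<Prod>v\<in>#m. \<tau> v) \<mu>) has_sum mcoeff g \<mu>) UNIV"
  shows "subst_defined f \<tau>" "subst f \<tau> = g"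
  using assms by (auto simp: subst_defined_def subst_def summable_on_def intro!: mfps_eqI infsumI)

lemma subst_add:
  assumes "subst_defined f \<tau>" "subst_defined g \<tau>"
  shows "subst_defined (f + g) \<tau>" "subst (f + g) \<tau> = subst f \<tau> + subst g \<tau>"
  by (rule subst_eqI[where g = "subst f \<tau> + subst g \<tau>"],
      simp add: ring_distribs, intro has_sum_add subst_has_sum assms)+

lemma subst_mconst_mult:
  assumes "subst_defined f \<tau>"
  shows "subst_defined (mconst c * f) \<tau>" "subst (mconst c * f) \<tau> = mconst c * subst f \<tau>"
  by (rule subst_eqI[where g = "mconst c * subst f \<tau>"],
      simp add: mult.assoc, intro has_sum_cmult_right subst_has_sum assms)+

lemma subst_monomial: "subst_defined (monomial k) \<tau>" "subst (monomial k) \<tau> = (\<Prod>v\<in>#k. \<tau> v)"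
  by (rule subst_eqI[where g = "\<Prod>v\<in>#k. \<tau> v"],
      rule has_sum_finite_neutralI[where B = "{k}"], auto simp: mcoeff_monomial)+

lemma subst_mvar: "subst_defined (mvar v) \<tau>" "subst (mvar v) \<tau> = \<tau> v"
  using subst_monomial[of "{#v#}" \<tau>] by (auto simp: monomial_eq_prod)

lemma subst_mconst: "subst_defined (mconst c) \<tau>" "subst (mconst c) \<tau> = mconst c"
  using subst_mconst_mult[of "monomial {#}" \<tau> c] subst_monomial[of "{#}" \<tau>] by (auto simp: monomial_eq_prod)

lemma subst_0: "subst_defined 0 \<tau>" "subst 0 \<tau> = 0"
  using subst_mconst[of 0] by auto

lemma subst_sum:
  assumes "\<And>i. i \<in> I \<Longrightarrow> subst_defined (f i) \<tau>"
  shows "subst_defined (sum f I) \<tau> \<and> subst (sum f I) \<tau> = (\<Sum>i\<in>I. subst (f i) \<tau>)"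
  using assms by (induction I rule: infinite_finite_induct) (auto simp: subst_0 subst_add)

text \<open>The convergent double sum over pairs \<open>(a, b)\<close> is regrouped by the product
  monomial \<open>a + b\<close>; each group is finite.\<close>

lemma subst_mult:
  assumes f: "subst_defined f \<tau>" and g: "subst_defined g \<tau>"
  shows "subst_defined (f * g) \<tau>" "subst (f * g) \<tau> = subst f \<tau> * subst g \<tau>"
proof -
  have "((\<lambda>m. mcoeff (f * g) m * mcoeff (\<Prod>v\<in>#m. \<tau> v) \<mu>) has_sum mcoeff (subst f \<tau> * subst g \<tau>) \<mu>) UNIV"
    for \<mu>
  proof -
    let ?P = "\<lambda>m. \<Prod>v\<in>#m. \<tau> v"
    let ?Z = "\<lambda>(a, b). mcoeff f a * mcoeff g b * mcoeff (?P (a + b)) \<mu>"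
    have "((\<lambda>p. \<Sum>x | x \<subseteq># \<mu>. (case p of (a, b) \<Rightarrow>
          (mcoeff f a * mcoeff (?P a) x) * (mcoeff g b * mcoeff (?P b) (\<mu> - x)))) has_sum
        (\<Sum>x | x \<subseteq># \<mu>. mcoeff (subst f \<tau>) x * mcoeff (subst g \<tau>) (\<mu> - x))) UNIV"
      by (intro has_sum_sum has_sum_prod_complex subst_has_sum f g) auto
    then have "(?Z has_sum mcoeff (subst f \<tau> * subst g \<tau>) \<mu>) UNIV"
      by (simp add: mcoeff_mult sum_distrib_left case_prod_unfold mult_ac)
    then have "((\<lambda>(m, a). mcoeff f a * mcoeff g (m - a) * mcoeff (?P m) \<mu>) has_sum
        mcoeff (subst f \<tau> * subst g \<tau>) \<mu>) (Sigma UNIV (\<lambda>m. {a. a \<subseteq># m}))"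
      by (subst (asm) has_sum_reindex_bij_witness[where T = "Sigma UNIV (\<lambda>m. {a. a \<subseteq># m})"
          and i = "\<lambda>(m, a). (a, m - a)" and j = "\<lambda>(a, b). (a + b, a)"
          and h = "\<lambda>(m, a). mcoeff f a * mcoeff g (m - a) * mcoeff (?P m) \<mu>"])
        (auto simp: subset_mset.add_diff_inverse)
    then show ?thesis
      by (rule has_sum_SigmaD) (auto simp: mcoeff_mult sum_distrib_right)
  qed
  from subst_eqI[OF this] show "subst_defined (f * g) \<tau>" "subst (f * g) \<tau> = subst f \<tau> * subst g \<tau>"
    by auto
qed

text \<open>These families may be substituted into every series, each coefficient of the result
  being a finite sum.\<close>

definition formal_fam :: "('v \<Rightarrow> ('x, complex) mfps) \<Rightarrow> bool" where
  "formal_fam \<sigma> \<longleftrightarrow> (\<forall>x. mcoeff (\<sigma> x) {#} = 0) \<and> (\<forall>\<mu>. finite {x. mcoeff (\<sigma> x) \<mu> \<noteq> 0})"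

lemma finite_bounded_multisets:
  assumes "finite U"
  shows "finite {k. set_mset k \<subseteq> U \<and> size k \<le> (n :: nat)}"
proof -
  have "{k. set_mset k \<subseteq> U \<and> size k \<le> n} \<subseteq> mset ` {xs. set xs \<subseteq> U \<and> length xs \<le> n}"
  proof
    fix k assume k: "k \<in> {k. set_mset k \<subseteq> U \<and> size k \<le> n}"
    obtain xs where "mset xs = k" using ex_mset by blast
    with k show "k \<in> mset ` {xs. set xs \<subseteq> U \<and> length xs \<le> n}" by force
  qed
  then show ?thesis by (rule finite_subset) (simp add: finite_lists_length_le assms)
qed

text \<open>Without constant terms each factor uses up at least one variable of
  \<open>\<mu>\<close>, which bounds the number of factors; and only finitely many members of the
  family have a coefficient at some divisor of \<open>\<mu>\<close>.\<close>

lemma formal_fam_finite: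
  assumes \<sigma>: "formal_fam \<sigma>"
  shows "finite {k. mcoeff (\<Prod>x\<in>#k. \<sigma> x) \<mu> \<noteq> 0}"
proof -
  let ?U = "\<lambda>\<mu>. \<Union>a\<in>{a. a \<subseteq># \<mu>}. {x. mcoeff (\<sigma> x) a \<noteq> 0}"
  have "set_mset k \<subseteq> ?U \<mu> \<and> size k \<le> size \<mu>" if "mcoeff (\<Prod>x\<in>#k. \<sigma> x) \<mu> \<noteq> 0" for k
    using that
  proof (induction k arbitrary: \<mu>)
    case empty
    then show ?case by simp
  next
    case (add x k)
    then have "(\<Sum>a | a \<subseteq># \<mu>. mcoeff (\<sigma> x) a * mcoeff (\<Prod>x\<in>#k. \<sigma> x) (\<mu> - a)) \<noteq> 0"
      by (simp add: mcoeff_mult)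
    then obtain a where a: "a \<subseteq># \<mu>" "mcoeff (\<sigma> x) a \<noteq> 0" "mcoeff (\<Prod>x\<in>#k. \<sigma> x) (\<mu> - a) \<noteq> 0"
      by (auto elim!: sum.not_neutral_contains_not_neutral)
    have "a \<noteq> {#}" using a(2) \<sigma> by (auto simp: formal_fam_def)
    then have "size (\<mu> - a) < size \<mu>"
      using size_Diff_submset[OF a(1)] size_mset_mono[OF a(1)] by (cases "size a") auto
    moreover have sub: "?U (\<mu> - a) \<subseteq> ?U \<mu>"
      by (auto dest: subset_mset.order_trans[OF _ diff_subset_eq_self])
    moreover have "x \<in> ?U \<mu>" using a(1,2) by blast
    moreover note add.IH[OF a(3)]
    ultimately show ?case
      by (simp only: set_mset_add_mset_insert size_add_mset insert_subset simp_thms Suc_le_eq)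
        (use le_less_trans order_trans in blast)
  qed
  then have "{k. mcoeff (\<Prod>x\<in>#k. \<sigma> x) \<mu> \<noteq> 0} \<subseteq> {k. set_mset k \<subseteq> ?U \<mu> \<and> size k \<le> size \<mu>}"
    by blast
  moreover have "finite (?U \<mu>)" using \<sigma> by (auto simp: formal_fam_def)
  ultimately show ?thesis by (rule finite_subset[OF _ finite_bounded_multisets])
qed

lemma subst_defined_formal: "formal_fam \<sigma> \<Longrightarrow> subst_defined f \<sigma>"
  unfolding subst_defined_def
  by (intro allI finite_nonzero_values_imp_summable_on) (auto intro: finite_subset[OF _ formal_fam_finite])

lemma mcoeff_subst_formal:
  assumes "formal_fam \<sigma>"
  shows "mcoeff (subst f \<sigma>) \<mu> =
    (\<Sum>k | mcoeff (\<Prod>x\<in>#k. \<sigma> x) \<mu> \<noteq> 0. mcoeff f k * mcoeff (\<Prod>x\<in>#k. \<sigma> x) \<mu>)"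
  unfolding subst_def mcoeff_Mfps
  by (intro infsumI has_sum_finite_neutralI) (auto intro: formal_fam_finite assms)

lemma subst_prod_mset:
  assumes "formal_fam \<sigma>"
  shows "subst (\<Prod>v\<in>#m. \<tau> v) \<sigma> = (\<Prod>v\<in>#m. subst (\<tau> v) \<sigma>)"
proof (induction m)
  case empty
  show ?case using subst_mconst[of 1 \<sigma>] by simp
qed (simp add: subst_mult subst_defined_formal assms)

text \<open>Infinite sums occur only in the substitution of \<open>\<tau>\<close>. A coefficient
  after the formal substitution is a finite combination of coefficients before it, so no two
  infinite sums are exchanged.\<close>

lemma subst_subst:
  assumes f: "subst_defined f \<tau>" and \<sigma>: "formal_fam \<sigma>"
  shows "subst_defined f (\<lambda>v. subst (\<tau> v) \<sigma>)" "subst f (\<lambda>v. subst (\<tau> v) \<sigma>) = subst (subst f \<tau>) \<sigma>"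
proof -
  have "((\<lambda>m. mcoeff f m * mcoeff (\<Prod>v\<in>#m. subst (\<tau> v) \<sigma>) \<mu>) has_sum mcoeff (subst (subst f \<tau>) \<sigma>) \<mu>) UNIV"
    for \<mu>
  proof -
    let ?S = "{k. mcoeff (\<Prod>x\<in>#k. \<sigma> x) \<mu> \<noteq> 0}"
    have "((\<lambda>m. \<Sum>k\<in>?S. mcoeff f m * mcoeff (\<Prod>v\<in>#m. \<tau> v) k * mcoeff (\<Prod>x\<in>#k. \<sigma> x) \<mu>) has_sum
        (\<Sum>k\<in>?S. mcoeff (subst f \<tau>) k * mcoeff (\<Prod>x\<in>#k. \<sigma> x) \<mu>)) UNIV"
      by (intro has_sum_sum has_sum_cmult_left subst_has_sum f) (auto intro: formal_fam_finite \<sigma>)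
    then show ?thesis
      by (simp add: subst_prod_mset[OF \<sigma>, symmetric] mcoeff_subst_formal[OF \<sigma>] sum_distrib_left mult.assoc)
  qed
  from subst_eqI[OF this] show "subst_defined f (\<lambda>v. subst (\<tau> v) \<sigma>)"
    "subst f (\<lambda>v. subst (\<tau> v) \<sigma>) = subst (subst f \<tau>) \<sigma>" by auto
qed

text \<open>Such operators pass through coefficientwise convergent sums, and their values on
  monomials determine them.\<close>

definition row_finite :: "(('v, complex) mfps \<Rightarrow> ('x, complex) mfps) \<Rightarrow> bool" where
  "row_finite R \<longleftrightarrow> (\<forall>\<mu>. \<exists>S r. finite S \<and> (\<forall>f. mcoeff (R f) \<mu> = (\<Sum>k\<in>S. r k * mcoeff f k)))"

lemma row_finite_id: "row_finite (\<lambda>f :: ('v, complex) mfps. f)"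
  unfolding row_finite_def
proof
  fix \<mu> :: "'v multiset"
  show "\<exists>S r. finite S \<and> (\<forall>f :: ('v, complex) mfps. mcoeff f \<mu> = (\<Sum>k\<in>S. r k * mcoeff f k))"
    by (rule exI[of _ "{\<mu>}"], rule exI[of _ "\<lambda>_. 1 :: complex"]) simp
qed

lemma row_finite_sum:
  assumes "finite I" "\<And>i. i \<in> I \<Longrightarrow> row_finite (R i)"
  shows "row_finite (\<lambda>f. \<Sum>i\<in>I. mconst (c i) * R i f)"
  unfolding row_finite_def
proof
  fix \<mu>
  have "\<forall>i\<in>I. \<exists>S r. finite S \<and> (\<forall>f. mcoeff (R i f) \<mu> = (\<Sum>k\<in>S. r k * mcoeff f k))"
    using assms by (auto simp: row_finite_def)
  then obtain S r where Sr: "\<And>i. i \<in> I \<Longrightarrow> finite (S i)"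
    "\<And>i f. i \<in> I \<Longrightarrow> mcoeff (R i f) \<mu> = (\<Sum>k\<in>S i. r i k * mcoeff f k)"
    by metis
  let ?S = "\<Union>i\<in>I. S i" and ?r = "\<lambda>k. \<Sum>i\<in>I. c i * (if k \<in> S i then r i k else 0)"
  have "mcoeff (\<Sum>i\<in>I. mconst (c i) * R i f) \<mu> = (\<Sum>k\<in>?S. ?r k * mcoeff f k)" for f
  proof -
    have "mcoeff (\<Sum>i\<in>I. mconst (c i) * R i f) \<mu> =
        (\<Sum>i\<in>I. c i * (\<Sum>k\<in>?S. (if k \<in> S i then r i k else 0) * mcoeff f k))"
    proof -
      have "(\<Sum>k\<in>S i. r i k * mcoeff f k) = (\<Sum>k\<in>?S. (if k \<in> S i then r i k else 0) * mcoeff f k)"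
        if "i \<in> I" for i
        using that assms(1) Sr(1) by (intro sum.mono_neutral_cong_left) auto
      then show ?thesis by (simp add: mcoeff_sum Sr)
    qed
    also have "\<dots> = (\<Sum>k\<in>?S. ?r k * mcoeff f k)"
      unfolding sum_distrib_left sum_distrib_right by (subst sum.swap) (simp add: mult.assoc)
    finally show ?thesis .
  qed
  then show "\<exists>S r. finite S \<and> (\<forall>f. mcoeff (\<Sum>i\<in>I. mconst (c i) * R i f) \<mu> = (\<Sum>k\<in>S. r k * mcoeff f k))"
    using assms(1) Sr(1) by (intro exI[of _ ?S] exI[of _ ?r]) auto
qed

lemma row_finite_comp:
  assumes "row_finite R" "row_finite T"
  shows "row_finite (\<lambda>f. R (T f))"
  unfolding row_finite_def
proof
  fix \<mu>
  obtain S r where S: "finite S" "\<And>f. mcoeff (R f) \<mu> = (\<Sum>k\<in>S. r k * mcoeff f k)"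
    using assms(1) unfolding row_finite_def by metis
  have "\<forall>k. \<exists>S' r'. finite S' \<and> (\<forall>f. mcoeff (T f) k = (\<Sum>j\<in>S'. r' j * mcoeff f j))"
    using assms(2) unfolding row_finite_def by blast
  then obtain S' r' where S': "\<And>k. finite (S' k)"
    "\<And>k f. mcoeff (T f) k = (\<Sum>j\<in>S' k. r' k j * mcoeff f j)"
    by metis
  let ?S = "\<Union>k\<in>S. S' k" and ?r = "\<lambda>j. \<Sum>k\<in>S. r k * (if j \<in> S' k then r' k j else 0)"
  have "mcoeff (R (T f)) \<mu> = (\<Sum>j\<in>?S. ?r j * mcoeff f j)" for f
  proof -
    have "(\<Sum>j\<in>S' k. r' k j * mcoeff f j) = (\<Sum>j\<in>?S. (if j \<in> S' k then r' k j else 0) * mcoeff f j)"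
      if "k \<in> S" for k
      using that S(1) S'(1) by (intro sum.mono_neutral_cong_left) auto
    then have "mcoeff (R (T f)) \<mu> =
        (\<Sum>k\<in>S. r k * (\<Sum>j\<in>?S. (if j \<in> S' k then r' k j else 0) * mcoeff f j))"
      by (simp add: S(2) S'(2))
    also have "\<dots> = (\<Sum>j\<in>?S. ?r j * mcoeff f j)"
      unfolding sum_distrib_left sum_distrib_right by (subst sum.swap) (simp add: mult.assoc)
    finally show ?thesis .
  qed
  then show "\<exists>S r. finite S \<and> (\<forall>f. mcoeff (R (T f)) \<mu> = (\<Sum>k\<in>S. r k * mcoeff f k))"
    using S(1) S'(1) by (intro exI[of _ ?S] exI[of _ ?r]) auto
qed

lemma row_finite_sums:
  assumes "row_finite R" and g: "\<And>m. (\<lambda>n. mcoeff (g n) m) sums mcoeff h m"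
  shows "(\<lambda>n. mcoeff (R (g n)) m) sums mcoeff (R h) m"
proof -
  obtain S r where S: "finite S" "\<And>f. mcoeff (R f) m = (\<Sum>k\<in>S. r k * mcoeff f k)"
    using assms(1) unfolding row_finite_def by metis
  show ?thesis unfolding S by (intro sums_sum sums_mult g)
qed

text \<open>By multiplicativity a monomial goes to the product of the images of its variables. Each
  output coefficient depends on finitely many monomials, which extends this to all series.\<close>

lemma row_finite_hom_eq_subst:
  assumes R: "row_finite R" and R1: "R 1 = 1" and mult: "\<And>f g. R (f * g) = R f * R g"
  shows "subst_defined f (\<lambda>v. R (mvar v))" "subst f (\<lambda>v. R (mvar v)) = R f"
proof -
  have monomial: "R (monomial m) = (\<Prod>v\<in>#m. R (mvar v))" for m
    unfolding monomial_eq_prod by (induction m) (simp_all add: R1 mult)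
  have "((\<lambda>m. mcoeff f m * mcoeff (\<Prod>v\<in>#m. R (mvar v)) \<mu>) has_sum mcoeff (R f) \<mu>) UNIV" for \<mu>
  proof -
    obtain S r where S: "finite S" "\<And>f. mcoeff (R f) \<mu> = (\<Sum>k\<in>S. r k * mcoeff f k)"
      using R unfolding row_finite_def by metis
    show ?thesis
      by (rule has_sum_finite_neutralI[where B = S])
        (auto simp: monomial[symmetric] S mcoeff_monomial if_distrib mult.commute cong: if_cong)
  qed
  from subst_eqI[OF this] show "subst_defined f (\<lambda>v. R (mvar v))" "subst f (\<lambda>v. R (mvar v)) = R f"
    by auto
qed

section \<open>The chain rule for convergent substitutions\<close>

lemma has_sum_mderiv_iff:
  "((\<lambda>m. mcoeff (mderiv v f) m * mcoeff (\<Prod>v\<in>#m. \<tau> v) \<mu>) has_sum s) UNIV \<longleftrightarrow>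
   ((\<lambda>m. mcoeff f m * (of_nat (count m v) * mcoeff (\<Prod>v\<in>#m - {#v#}. \<tau> v) \<mu>)) has_sum s) UNIV"
    (is "?L \<longleftrightarrow> (?x has_sum s) UNIV")
proof -
  have "?L \<longleftrightarrow> ((?x \<circ> add_mset v) has_sum s) UNIV"
    by (rule has_sum_cong) (simp add: mcoeff_mderiv mult_ac)
  also have "\<dots> \<longleftrightarrow> (?x has_sum s) (range (add_mset v))"
    by (rule has_sum_reindex[symmetric]) (auto intro: injI)
  also have "\<dots> \<longleftrightarrow> (?x has_sum s) UNIV"
  proof -
    have "count m v = 0" if "m \<notin> range (add_mset v)" for m
      using that by (auto simp: not_in_iff[symmetric] dest: multi_member_split)
    then show ?thesis by (intro has_sum_cong_neutral) auto
  qed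
  finally show ?thesis .
qed

text \<open>Convergence at the coefficient \<open>add_mset u \<mu>\<close> gives convergence of the
  termwise derivative in \<open>u\<close>, where the partial derivatives of \<open>f\<close> are
  mixed by the Jacobian \<open>P\<close>. The finitely many weights \<open>P'\<close> form a column
  of its inverse and isolate the derivative in \<open>w\<close>.\<close>

lemma subst_defined_mderiv:
  assumes f: "subst_defined f \<tau>" and \<tau>: "\<And>u v. mderiv u (\<tau> v) = mconst (P v u)"
    and fin: "\<And>u. finite {v. P v u \<noteq> 0}"
    and B: "finite B" and inv: "\<And>v. (\<Sum>u\<in>B. P v u * P' u) = (if v = w then 1 else 0)"
  shows "subst_defined (mderiv w f) \<tau>"
  unfolding subst_defined_def
proof
  fix \<mu>
  let ?A = "\<Union>u\<in>B. {v. P v u \<noteq> 0}"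
  have A: "finite ?A" using B fin by auto
  let ?x = "\<lambda>v m. mcoeff f m * (of_nat (count m v) * mcoeff (\<Prod>v\<in>#m - {#v#}. \<tau> v) \<mu>)"
  have d: "mcoeff (mderiv u (\<Prod>v\<in>#m. \<tau> v)) \<mu> =
      (\<Sum>v\<in>?A. P v u * (of_nat (count m v) * mcoeff (\<Prod>v\<in>#m - {#v#}. \<tau> v) \<mu>))" if "u \<in> B" for u m
    using that by (subst mderiv_prod_mset[OF A, where P = "\<lambda>v. P v u"])
      (auto simp: \<tau> mcoeff_sum intro!: sum.cong)
  have "(\<lambda>m. \<Sum>u\<in>B. mcoeff f m * mcoeff (mderiv u (\<Prod>v\<in>#m. \<tau> v)) \<mu> * P' u) summable_on UNIV"
  proof -
    have "(\<lambda>m. mcoeff f m * mcoeff (\<Prod>v\<in>#m. \<tau> v) (add_mset u \<mu>) * (of_nat (Suc (count \<mu> u)) * P' u))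
        summable_on UNIV" for u
      using f by (intro summable_on_cmult_left) (auto simp: subst_defined_def)
    then have s: "(\<lambda>m. mcoeff f m * mcoeff (mderiv u (\<Prod>v\<in>#m. \<tau> v)) \<mu> * P' u) summable_on UNIV" for u
      by (simp add: mcoeff_mderiv mult_ac)
    show ?thesis by (rule has_sum_imp_summable[OF has_sum_sum[OF B has_sum_infsum[OF s]]])
  qed
  also have "(\<lambda>m. \<Sum>u\<in>B. mcoeff f m * mcoeff (mderiv u (\<Prod>v\<in>#m. \<tau> v)) \<mu> * P' u) = ?x w"
  proof
    fix m
    let ?y = "\<lambda>v. of_nat (count m v) * mcoeff (\<Prod>v\<in>#m - {#v#}. \<tau> v) \<mu>"
    have "(\<Sum>u\<in>B. mcoeff f m * mcoeff (mderiv u (\<Prod>v\<in>#m. \<tau> v)) \<mu> * P' u)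
        = mcoeff f m * (\<Sum>u\<in>B. \<Sum>v\<in>?A. P v u * P' u * ?y v)"
      unfolding sum_distrib_left by (intro sum.cong refl) (simp add: d sum_distrib_left sum_distrib_right mult_ac)
    also have "(\<Sum>u\<in>B. \<Sum>v\<in>?A. P v u * P' u * ?y v) = (\<Sum>v\<in>?A. (\<Sum>u\<in>B. P v u * P' u) * ?y v)"
      unfolding sum_distrib_right by (rule sum.swap)
    also have "\<dots> = (if w \<in> ?A then ?y w else 0)"
      unfolding inv using A by (simp add: if_distrib[of "\<lambda>x. x * _"] cong: if_cong)
    also have "\<dots> = ?y w"
    proof -
      have "w \<in> ?A"
      proof (rule ccontr)
        assume "w \<notin> ?A"
        then have "(\<Sum>u\<in>B. P w u * P' u) = 0" by (intro sum.neutral) auto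
        with inv[of w] show False by simp
      qed
      then show ?thesis by simp
    qed
    finally show "(\<Sum>u\<in>B. mcoeff f m * mcoeff (mderiv u (\<Prod>v\<in>#m. \<tau> v)) \<mu> * P' u) = ?x w m" .
  qed
  finally show "(\<lambda>m. mcoeff (mderiv w f) m * mcoeff (\<Prod>v\<in>#m. \<tau> v) \<mu>) summable_on UNIV"
    unfolding summable_on_def has_sum_mderiv_iff .
qed

text \<open>The defining sum is differentiated termwise, and uniqueness of sums identifies it with
  the finite combination of the series for the partial derivatives.\<close>

lemma mderiv_subst:
  assumes f: "subst_defined f \<tau>" and df: "\<And>v. v \<in> A \<Longrightarrow> subst_defined (mderiv v f) \<tau>"
    and \<tau>: "\<And>v. mderiv u (\<tau> v) = mconst (P v)"
    and A: "finite A" "\<And>v. v \<notin> A \<Longrightarrow> P v = 0"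
  shows "mderiv u (subst f \<tau>) = (\<Sum>v\<in>A. mconst (P v) * subst (mderiv v f) \<tau>)"
proof (rule mfps_eqI)
  fix \<mu>
  have h: "((\<lambda>m. mcoeff f m * mcoeff (mderiv u (\<Prod>v\<in>#m. \<tau> v)) \<mu>) has_sum mcoeff (mderiv u (subst f \<tau>)) \<mu>) UNIV"
    using has_sum_cmult_left[OF subst_has_sum[OF f, of "add_mset u \<mu>"], of "of_nat (Suc (count \<mu> u))"]
    by (simp add: mcoeff_mderiv mult_ac)
  have eq: "mcoeff f m * mcoeff (mderiv u (\<Prod>v\<in>#m. \<tau> v)) \<mu> =
      (\<Sum>v\<in>A. P v * (mcoeff f m * (of_nat (count m v) * mcoeff (\<Prod>v\<in>#m - {#v#}. \<tau> v) \<mu>)))" for m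
    by (subst mderiv_prod_mset[OF A \<tau>]) (auto simp: mcoeff_sum sum_distrib_left intro!: sum.cong)
  have "((\<lambda>m. \<Sum>v\<in>A. P v * (mcoeff f m * (of_nat (count m v) * mcoeff (\<Prod>v\<in>#m - {#v#}. \<tau> v) \<mu>)))
      has_sum (\<Sum>v\<in>A. P v * mcoeff (subst (mderiv v f) \<tau>) \<mu>)) UNIV"
  proof (intro has_sum_sum has_sum_cmult_right)
    fix v assume "v \<in> A"
    from subst_has_sum[OF df[OF this], of \<mu>]
    show "((\<lambda>m. mcoeff f m * (of_nat (count m v) * mcoeff (\<Prod>v\<in>#m - {#v#}. \<tau> v) \<mu>)) has_sum
        mcoeff (subst (mderiv v f) \<tau>) \<mu>) UNIV"
      unfolding has_sum_mderiv_iff .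
  qed (use A in auto)
  from has_sum_unique[OF h[unfolded eq] this]
  show "mcoeff (mderiv u (subst f \<tau>)) \<mu> = mcoeff (\<Sum>v\<in>A. mconst (P v) * subst (mderiv v f) \<tau>) \<mu>"
    by (simp add: mcoeff_sum)
qed

section \<open>The flow of a strictly lowering vector field\<close>

text \<open>The linear form with coefficients \<open>l\<close>. It is given by its coefficients
  because infinitely many of them may be nonzero.\<close>

definition linser :: "('v \<Rightarrow> complex) \<Rightarrow> ('v, complex) mfps" where
  "linser l = Mfps (\<lambda>m. if size m = 1 then l (THE v. m = {#v#}) else 0)"

lemma mcoeff_linser_single [simp]: "mcoeff (linser l) {#v#} = l v"
  by (simp add: linser_def)

lemma mcoeff_linser_eq_0: "size m \<noteq> 1 \<Longrightarrow> mcoeff (linser l) m = 0"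
  by (simp add: linser_def)

lemma mcoeff_linser_empty [simp]: "mcoeff (linser l) {#} = 0"
  by (simp add: linser_def)

lemma linser_mvar: "mvar v = linser (\<lambda>w. if v = w then 1 else 0)"
proof (rule mfps_eqI)
  fix m :: "'a multiset"
  show "mcoeff (mvar v) m = mcoeff (linser (\<lambda>w. if v = w then 1 else 0)) m"
  proof (cases "size m = 1")
    case True
    then obtain w where "m = {#w#}" using size_1_singleton_mset by metis
    then show ?thesis by (simp add: mcoeff_mvar)
  qed (auto simp: mcoeff_mvar mcoeff_linser_eq_0)
qed

lemma mderiv_linser: "mderiv u (linser l) = mconst (l u)"
  by (rule mfps_eqI) (auto simp: mcoeff_mderiv mcoeff_mconst mcoeff_linser_eq_0)

lemma subst_linser:
  assumes "finite A" "\<And>u. u \<notin> A \<Longrightarrow> mcoeff (\<sigma> u) \<mu> = 0"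
  shows "mcoeff (subst (linser l) \<sigma>) \<mu> = (\<Sum>u\<in>A. l u * mcoeff (\<sigma> u) \<mu>)"
proof -
  have "((\<lambda>m. mcoeff (linser l) m * mcoeff (\<Prod>v\<in>#m. \<sigma> v) \<mu>) has_sum (\<Sum>u\<in>A. l u * mcoeff (\<sigma> u) \<mu>)) UNIV"
  proof (rule has_sum_finite_neutralI[where B = "(\<lambda>u. {#u#}) ` A"])
    fix m assume m: "m \<in> UNIV - (\<lambda>u. {#u#}) ` A"
    show "mcoeff (linser l) m * mcoeff (\<Prod>v\<in>#m. \<sigma> v) \<mu> = 0"
    proof (cases "size m = 1")
      case True
      then obtain u where "m = {#u#}" using size_1_singleton_mset by metis
      with m assms show ?thesis by auto
    qed (simp add: mcoeff_linser_eq_0)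
  qed (use assms in \<open>auto simp: sum.reindex inj_on_def\<close>)
  then show ?thesis by (simp add: subst_def infsumI)
qed

text \<open>Column \<open>w\<close> of a lowering matrix is supported on the finitely many variables
  of index at most that of \<open>w\<close>.\<close>

lemma formal_fam_linser:
  fixes P :: "('n :: finite) var \<Rightarrow> 'n var \<Rightarrow> complex"
  assumes "lowering P"
  shows "formal_fam (\<lambda>v. linser (P v))"
  unfolding formal_fam_def
proof (intro conjI allI)
  fix \<mu> :: "'n var multiset"
  show "finite {v. mcoeff (linser (P v)) \<mu> \<noteq> 0}"
  proof (cases "size \<mu> = 1")
    case True
    then obtain w where w: "\<mu> = {#w#}" using size_1_singleton_mset by metis
    have "{v. mcoeff (linser (P v)) \<mu> \<noteq> 0} \<subseteq> vars (fst w)"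
    proof
      fix v assume "v \<in> {v. mcoeff (linser (P v)) \<mu> \<noteq> 0}"
      then have "P v w \<noteq> 0" by (simp add: w)
      then show "v \<in> vars (fst w)" using assms unfolding lowering_def in_vars by blast
    qed
    then show ?thesis by (rule finite_subset) simp
  qed (simp add: mcoeff_linser_eq_0)
qed simp

text \<open>\<open>T i j\<close> models a product of divided powers A^i/i! and B^j/j!: raising an
  exponent brings in its new value as a factor. The two factors that meet at one term, i and n+1-i,
  add up to n+1.\<close>

lemma sum_divided_powers:
  fixes T :: "nat \<Rightarrow> nat \<Rightarrow> 'a :: comm_ring_1"
  assumes sum: "\<And>f (I :: nat set). D (sum f I) = (\<Sum>i\<in>I. D (f i))"
    and T: "\<And>i j. D (T i j) = of_nat (Suc i) * T (Suc i) j + of_nat (Suc j) * T i (Suc j)"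
  shows "D (\<Sum>i\<le>n. T i (n - i)) = of_nat (Suc n) * (\<Sum>i\<le>Suc n. T i (Suc n - i))"
proof -
  have "D (\<Sum>i\<le>n. T i (n - i)) =
      (\<Sum>i\<le>n. of_nat (Suc i) * T (Suc i) (n - i)) + (\<Sum>i\<le>n. of_nat (Suc (n - i)) * T i (Suc (n - i)))"
    unfolding sum T by (rule sum.distrib)
  also have "(\<Sum>i\<le>n. of_nat (Suc i) * T (Suc i) (n - i)) = (\<Sum>i\<le>Suc n. of_nat i * T i (Suc n - i))"
    by (subst sum.atMost_Suc_shift) simp
  also have "(\<Sum>i\<le>n. of_nat (Suc (n - i)) * T i (Suc (n - i))) =
      (\<Sum>i\<le>Suc n. of_nat (Suc n - i) * T i (Suc n - i))"
    by (subst sum.atMost_Suc, simp only: diff_self_eq_0 of_nat_0 mult_zero_left add_0_right,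
        intro sum.cong refl) (simp only: atMost_iff Suc_diff_le)
  also have "(\<Sum>i\<le>Suc n. of_nat i * T i (Suc n - i)) + \<dots> =
      (\<Sum>i\<le>Suc n. of_nat (Suc n) * T i (Suc n - i))"
    unfolding sum.distrib[symmetric] distrib_right[symmetric] of_nat_add[symmetric]
    by (intro sum.cong refl) (simp del: of_nat_Suc)
  finally show ?thesis by (simp only: sum_distrib_left)
qed

lemma sum_triangle_eq_rectangle:
  fixes H :: "nat \<Rightarrow> nat \<Rightarrow> 'a :: comm_monoid_add"
  assumes H: "\<And>i j. i > p \<or> j > q \<Longrightarrow> H i j = 0" and N: "p + q \<le> N"
  shows "(\<Sum>k\<le>N. \<Sum>i\<le>k. H i (k - i)) = (\<Sum>i\<le>p. \<Sum>j\<le>q. H i j)"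
proof -
  have "(\<Sum>k\<le>N. \<Sum>i\<le>k. H i (k - i)) = (\<Sum>(i, j)\<in>{(i, j). i + j \<le> N}. H i j)"
    by (rule sum.triangle_reindex_eq[symmetric])
  also have "\<dots> = (\<Sum>(i, j)\<in>{..p} \<times> {..q}. H i j)"
  proof (rule sum.mono_neutral_right)
    have "{(i, j). i + j \<le> N} \<subseteq> {..N} \<times> {..N}" by auto
    then show "finite {(i, j). i + j \<le> N}" by (rule finite_subset) simp
    show "\<forall>x\<in>{(i, j). i + j \<le> N} - {..p} \<times> {..q}. (case x of (i, j) \<Rightarrow> H i j) = 0"
    proof
      fix x assume "x \<in> {(i, j). i + j \<le> N} - {..p} \<times> {..q}"
      then have "fst x > p \<or> snd x > q" by auto
      then show "(case x of (i, j) \<Rightarrow> H i j) = 0" unfolding split_beta by (rule H)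
    qed
  qed (use N in auto)
  finally show ?thesis by (simp add: sum.cartesian_product)
qed

text \<open>The coefficient of s^n in exp(sD)f. With this normalization the Leibniz and binomial
  formulas become plain convolutions.\<close>

definition divpow :: "(('v, complex) mfps \<Rightarrow> ('v, complex) mfps) \<Rightarrow> nat \<Rightarrow> ('v, complex) mfps \<Rightarrow>
    ('v, complex) mfps" where
  "divpow D n f = mconst (1 / fact n) * (D ^^ n) f"

lemma divpow_0 [simp]: "divpow D 0 f = f"
  by (simp add: divpow_def)

lemma mconst_of_nat: "mconst (of_nat n) = of_nat n"
  by (induction n) (simp_all add: mconst_add)

lemma apply_divpow:
  fixes f :: "('v, complex) mfps"
  assumes "\<And>c f. D (mconst c * f) = mconst c * D f"
  shows "D (divpow D n f) = of_nat (Suc n) * divpow D (Suc n) f"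
proof -
  have "(mconst (1 / fact n) :: ('v, complex) mfps) = of_nat (Suc n) * mconst (1 / fact (Suc n))"
    unfolding mconst_of_nat[symmetric] mconst_mult[symmetric] by (simp add: field_simps del: of_nat_Suc)
  then show ?thesis
    unfolding divpow_def assms by (simp only: funpow.simps comp_apply mult.assoc)
qed

text \<open>The recursion can be solved by dividing by n+1. It serves to recognize convolutions as
  divided powers.\<close>

lemma divpow_unique:
  assumes "\<And>c f. D (mconst c * f) = mconst c * D f"
    and "S 0 = f" "\<And>n. D (S n) = of_nat (Suc n) * S (Suc n)"
  shows "S n = divpow D n f"
proof (induction n)
  case (Suc n)
  have "of_nat (Suc n) * S (Suc n) = of_nat (Suc n) * divpow D (Suc n) f"
    using Suc assms(3)[of n] apply_divpow[OF assms(1), of n f] by simp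
  then have "mconst (of_nat (Suc n)) * S (Suc n) = mconst (of_nat (Suc n)) * divpow D (Suc n) f"
    by (simp only: mconst_of_nat)
  then have "mcoeff (mconst (of_nat (Suc n)) * S (Suc n)) m =
      mcoeff (mconst (of_nat (Suc n)) * divpow D (Suc n) f) m" for m
    by simp
  then show ?case by (intro mfps_eqI) (simp del: of_nat_Suc)
qed (simp add: assms)

lemma divpow_mult:
  assumes sum: "\<And>f (I :: nat set). D (sum f I) = (\<Sum>i\<in>I. D (f i))"
    and mult: "\<And>f g. D (f * g) = D f * g + f * D g"
    and mconst: "\<And>c f. D (mconst c * f) = mconst c * D f"
  shows "divpow D n (f * g) = (\<Sum>i\<le>n. divpow D i f * divpow D (n - i) g)"
  by (rule divpow_unique[symmetric, where S = "\<lambda>n. \<Sum>i\<le>n. divpow D i f * divpow D (n - i) g"], rule mconst, simp,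
      rule sum_divided_powers, rule sum, unfold mult apply_divpow[OF mconst], simp only: mult_ac)

text \<open>This is exp(s(A+B)) = exp(sA)exp(sB) at each power of s: \<open>B\<close> passes through
  the powers of \<open>A\<close>, so the convolution satisfies the recursion of the divided powers
  of the sum.\<close>

lemma divpow_add_commuting:
  fixes A B :: "('v, complex) mfps \<Rightarrow> ('v, complex) mfps"
  assumes sum: "\<And>f (I :: nat set). A (sum f I) = (\<Sum>i\<in>I. A (f i))" "\<And>f (I :: nat set). B (sum f I) = (\<Sum>i\<in>I. B (f i))"
    and mconst: "\<And>c f. A (mconst c * f) = mconst c * A f" "\<And>c f. B (mconst c * f) = mconst c * B f"
    and comm: "\<And>f. B (A f) = A (B f)"
  shows "divpow (\<lambda>f. A f + B f) n f = (\<Sum>i\<le>n. divpow A i (divpow B (n - i) f))"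
proof -
  have B_pow: "B ((A ^^ i) f) = (A ^^ i) (B f)" for i f
    by (induction i) (simp_all add: comm)
  have pow_mconst: "(A ^^ i) (mconst c * f) = mconst c * (A ^^ i) f" for i c f
    by (induction i) (simp_all add: mconst)
  have of_nat: "divpow A i (of_nat n * f) = of_nat n * divpow A i f" for i n f
    unfolding divpow_def mconst_of_nat[symmetric] pow_mconst by (rule mult.left_commute)
  have B_div: "B (divpow A i f) = divpow A i (B f)" for i f
    by (simp add: divpow_def mconst B_pow)
  show ?thesis
  proof (rule divpow_unique[symmetric, where S = "\<lambda>n. \<Sum>i\<le>n. divpow A i (divpow B (n - i) f)"])
    show "(\<Sum>i\<le>0. divpow A i (divpow B (0 - i) f)) = f" by simp
    show "A (\<Sum>i\<le>n. divpow A i (divpow B (n - i) f)) + B (\<Sum>i\<le>n. divpow A i (divpow B (n - i) f)) =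
        of_nat (Suc n) * (\<Sum>i\<le>Suc n. divpow A i (divpow B (Suc n - i) f))" for n
      by (rule sum_divided_powers[where D = "\<lambda>f. A f + B f" and T = "\<lambda>i j. divpow A i (divpow B j f)"])
        (simp_all add: sum sum.distrib apply_divpow[of A, OF mconst(1)] apply_divpow[of B, OF mconst(2)]
          B_div of_nat del: of_nat_Suc)
  qed (simp add: mconst ring_distribs)
qed

lemma row_finiteI:
  assumes "\<And>\<mu>. \<exists>(I :: 'i set) k r. finite I \<and> (\<forall>f. mcoeff (R f) \<mu> = (\<Sum>i\<in>I. r i * mcoeff f (k i)))"
  shows "row_finite R"
  unfolding row_finite_def
proof
  fix \<mu>
  obtain I :: "'i set" and k r where I: "finite I" "\<And>f. mcoeff (R f) \<mu> = (\<Sum>i\<in>I. r i * mcoeff f (k i))"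
    using assms[of \<mu>] by blast
  have "mcoeff (R f) \<mu> = (\<Sum>j\<in>k ` I. (\<Sum>i | i \<in> I \<and> k i = j. r i) * mcoeff f j)" for f
    unfolding I sum.image_gen[OF I(1), of _ k] sum_distrib_right by (intro sum.cong refl) auto
  then show "\<exists>S r. finite S \<and> (\<forall>f. mcoeff (R f) \<mu> = (\<Sum>k\<in>S. r k * mcoeff f k))"
    using I(1) by (intro exI[of _ "k ` I"] exI[of _ "\<lambda>j. \<Sum>i | i \<in> I \<and> k i = j. r i"]) auto
qed

definition strictly_lowering :: "('n var \<Rightarrow> 'n var \<Rightarrow> 'a :: zero) \<Rightarrow> bool" where
  "strictly_lowering h \<longleftrightarrow> (\<forall>u v. h u v \<noteq> 0 \<longrightarrow> fst u < fst v)"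

lemma strictly_loweringD: "strictly_lowering h \<Longrightarrow> fst v \<le> fst u \<Longrightarrow> h u v = 0"
  by (meson strictly_lowering_def not_less)

lemma strictly_lowering_imp_lowering: "strictly_lowering h \<Longrightarrow> lowering h"
  by (meson lowering_def strictly_lowering_def less_imp_le)

text \<open>The vector field splits into its part at $t = 0$, which generates translations, and the part
  homogeneous in $t$, which raises the weight \<open>index_weight\<close>.\<close>

definition translation_part :: "('h, 'n :: finite) gwdata \<Rightarrow> ('n var \<Rightarrow> 'n var \<Rightarrow> complex) \<Rightarrow>
    'n tser \<Rightarrow> 'n tser" where
  "translation_part X h f = (\<Sum>u\<in>vars 0. mconst (- h u (1, unit_ix X)) * mderiv u f)"

definition linear_part :: "('h, 'n :: finite) gwdata \<Rightarrow> ('n var \<Rightarrow> 'n var \<Rightarrow> complex) \<Rightarrow>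
    'n tser \<Rightarrow> 'n tser" where
  "linear_part X h f = vfield X h f - translation_part X h f"

definition index_weight :: "'n var multiset \<Rightarrow> nat" where
  "index_weight m = (\<Sum>v\<in>#m. fst v)"

lemma index_weight_simps [simp]:
  "index_weight {#} = 0" "index_weight (add_mset v m) = fst v + index_weight m"
  by (simp_all add: index_weight_def)

lemma translation_part_sum: "translation_part X h (sum f I) = (\<Sum>i\<in>I. translation_part X h (f i))"
  unfolding translation_part_def mderiv_sum sum_distrib_left by (rule sum.swap)

lemma translation_part_mconst_mult:
  "translation_part X h (mconst c * f) = mconst c * translation_part X h f"
  unfolding translation_part_def mderiv_mconst_mult sum_distrib_left
  by (intro sum.cong refl mult.left_commute)

lemma translation_part_mult:
  "translation_part X h (f * g) = translation_part X h f * g + f * translation_part X h g"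
  by (simp add: translation_part_def mderiv_mult sum_distrib_left sum_distrib_right ring_distribs
      sum.distrib mult_ac)

lemma linear_part_sum:
  fixes X :: "('h, 'n :: finite) gwdata"
  assumes "strictly_lowering h"
  shows "linear_part X h (sum f I) = (\<Sum>i\<in>I. linear_part X h (f i))"
  by (simp add: linear_part_def vfield_sum[OF strictly_lowering_imp_lowering[OF assms]]
      translation_part_sum sum_subtractf)

lemma linear_part_mult:
  fixes X :: "('h, 'n :: finite) gwdata"
  assumes "strictly_lowering h"
  shows "linear_part X h (f * g) = linear_part X h f * g + f * linear_part X h g"
  by (simp add: linear_part_def vfield_mult[OF strictly_lowering_imp_lowering[OF assms]]
      translation_part_mult algebra_simps)

lemma linear_part_mconst_mult:
  fixes X :: "('h, 'n :: finite) gwdata"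
  assumes "strictly_lowering h"
  shows "linear_part X h (mconst c * f) = mconst c * linear_part X h f"
  unfolding linear_part_def vfield_mconst_mult[OF strictly_lowering_imp_lowering[OF assms]]
    translation_part_mconst_mult right_diff_distrib ..

lemma translation_part_diff:
  "translation_part X h (f - g) = translation_part X h f - translation_part X h g"
  by (simp add: translation_part_def mderiv_diff sum_subtractf right_diff_distrib)

text \<open>The translation goes along variables of index 0, and the corresponding columns of a
  strictly lowering matrix vanish; so these derivatives commute with the field.\<close>

lemma translation_linear_commute:
  fixes X :: "('h, 'n :: finite) gwdata"
  assumes h: "strictly_lowering h"
  shows "translation_part X h (linear_part X h f) = linear_part X h (translation_part X h f)"
proof -
  note l = strictly_lowering_imp_lowering[OF h]
  have d: "mderiv w (vfield X h f) = vfield X h (mderiv w f)" if "fst w = 0" for w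
  proof -
    have "h u w = 0" for u by (rule strictly_loweringD[OF h]) (simp add: that)
    then show ?thesis using that mderiv_vfield[OF l, of w 0 X f] by simp
  qed
  have c: "translation_part X h (vfield X h f) = vfield X h (translation_part X h f)"
    unfolding translation_part_def
    by (subst vfield_sum[OF l], intro sum.cong refl) (simp add: d vfield_mconst_mult l)
  show ?thesis
    by (simp add: linear_part_def c translation_part_diff)
qed

lemma mset_index_ball:
  obtains K :: nat where "K \<ge> K0" "\<forall>v\<in>#m. fst v \<le> K"
proof (rule mset_index_bound[of K0 m])
  fix K assume "K \<ge> K0" "\<And>v. v \<in># m \<Longrightarrow> fst v \<le> K"
  then show thesis by (intro that[of K]) auto
qed

text \<open>The constant -1 in the dilaton-shifted variable accounts for the translation part. What
  remains relates \<open>m\<close> to the monomials in which one of its variables \<open>v\<close>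
  is replaced by some \<open>u\<close>.\<close>

lemma mcoeff_linear_part:
  fixes X :: "('h, 'n :: finite) gwdata"
  assumes h: "strictly_lowering h" and K: "K \<ge> 1" "\<forall>v\<in>#m. fst v \<le> K"
  shows "mcoeff (linear_part X h f) m = (\<Sum>v\<in>vars K. \<Sum>u\<in>vars K.
    (if v \<in># m then h u v * of_nat (Suc (count (m - {#v#}) u)) else 0) * mcoeff f (add_mset u (m - {#v#})))"
proof -
  let ?e = "(1, unit_ix X)"
  let ?T = "\<lambda>v u. (if v \<in># m then h u v * of_nat (Suc (count (m - {#v#}) u)) else 0) * mcoeff f (add_mset u (m - {#v#}))"
  have "mcoeff (vfield X h f) m = mcoeff (vfield_upto X h K f) m"
    by (rule agreeD[OF agree_vfield[OF strictly_lowering_imp_lowering[OF h] K(1)]]) (use K in blast)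
  also have "\<dots> = (\<Sum>v\<in>vars K. \<Sum>u\<in>vars K.
      ?T v u - (if v = ?e then h u ?e * mcoeff (mderiv u f) m else 0))"
    unfolding vfield_upto_def mcoeff_sum mult.assoc mcoeff_mconst_mult mcoeff_qvar_mult
    by (intro sum.cong refl) (auto simp: mcoeff_mderiv algebra_simps)
  also have "\<dots> = (\<Sum>v\<in>vars K. \<Sum>u\<in>vars K. ?T v u)
      - (\<Sum>u\<in>vars K. \<Sum>v\<in>vars K. if v = ?e then h u ?e * mcoeff (mderiv u f) m else 0)"
    unfolding sum_subtractf by (rule arg_cong2[where f = "(-)"], rule refl, rule sum.swap)
  also have "(\<Sum>u\<in>vars K. \<Sum>v\<in>vars K. if v = ?e then h u ?e * mcoeff (mderiv u f) m else 0)
      = (\<Sum>u\<in>vars K. h u ?e * mcoeff (mderiv u f) m)"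
    using K(1) by (simp add: sum.delta)
  \<comment> \<open>From a source of index 1, strict lowering leaves only targets of index
    0.\<close>
  also have "\<dots> = (\<Sum>u\<in>vars 0. h u ?e * mcoeff (mderiv u f) m)"
    using K(1) strictly_loweringD[OF h, of ?e] by (intro sum.mono_neutral_right) auto
  also have "\<dots> = - mcoeff (translation_part X h f) m"
    by (simp add: translation_part_def mcoeff_sum sum_negf)
  finally show ?thesis by (simp add: linear_part_def)
qed

lemma row_finite_linear_part:
  fixes X :: "('h, 'n :: finite) gwdata"
  assumes h: "strictly_lowering h"
  shows "row_finite (linear_part X h)"
proof (rule row_finiteI)
  fix \<mu> :: "'n var multiset"
  obtain K where K: "K \<ge> 1" "\<forall>v\<in>#\<mu>. fst v \<le> K"
    by (rule mset_index_ball)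
  let ?k = "\<lambda>(v, u). add_mset u (\<mu> - {#v#})"
  let ?r = "\<lambda>(v, u). if v \<in># \<mu> then h u v * of_nat (Suc (count (\<mu> - {#v#}) u)) else 0"
  have "mcoeff (linear_part X h f) \<mu> = (\<Sum>i\<in>vars K \<times> vars K. ?r i * mcoeff f (?k i))" for f
    unfolding mcoeff_linear_part[OF h K] sum.cartesian_product by (intro sum.cong refl) (auto split: prod.splits)
  then show "\<exists>(I :: ('n var \<times> 'n var) set) k r. finite I \<and> (\<forall>f. mcoeff (linear_part X h f) \<mu> = (\<Sum>i\<in>I. r i * mcoeff f (k i)))"
    by (intro exI[of _ "vars K \<times> vars K :: ('n var \<times> 'n var) set"] exI[of _ ?k] exI[of _ ?r]) auto
qed

text \<open>Every application refers back to monomials of strictly smaller weight.\<close>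

lemma linear_part_nilpotent:
  fixes X :: "('h, 'n :: finite) gwdata"
  assumes h: "strictly_lowering h" and "index_weight m < i"
  shows "mcoeff ((linear_part X h ^^ i) f) m = 0"
  using assms(2)
proof (induction i arbitrary: m)
  case (Suc i)
  obtain K where K: "K \<ge> 1" "\<forall>v\<in>#m. fst v \<le> K"
    by (rule mset_index_ball)
  have z: "(if v \<in># m then h u v * of_nat (Suc (count (m - {#v#}) u)) else 0)
      * mcoeff ((linear_part X h ^^ i) f) (add_mset u (m - {#v#})) = 0" for u v
  proof (cases "v \<in># m \<and> h u v \<noteq> 0")
    case True
    then obtain m' where m': "m = add_mset v m'" by (auto dest: multi_member_split)
    have "fst u < fst v" using True h unfolding strictly_lowering_def by blast
    then have "mcoeff ((linear_part X h ^^ i) f) (add_mset u (m - {#v#})) = 0"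
      using Suc by (intro Suc.IH) (simp add: m')
    then show ?thesis by simp
  qed auto
  show ?case
    unfolding funpow.simps comp_apply mcoeff_linear_part[OF h K] by (simp only: z sum.neutral_const)
qed simp

text \<open>Beyond the weight of \<open>m\<close> all terms of the exponential series vanish at
  \<open>m\<close>.\<close>

definition exp_linear :: "('h, 'n :: finite) gwdata \<Rightarrow> ('n var \<Rightarrow> 'n var \<Rightarrow> complex) \<Rightarrow>
    'n tser \<Rightarrow> 'n tser" where
  "exp_linear X h f = Mfps (\<lambda>m. \<Sum>i\<le>index_weight m. mcoeff (divpow (linear_part X h) i f) m)"

lemma divpow_linear_part_nilpotent:
  fixes X :: "('h, 'n :: finite) gwdata"
  assumes "strictly_lowering h" "index_weight m < i"
  shows "mcoeff (divpow (linear_part X h) i f) m = 0"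
  by (simp add: divpow_def linear_part_nilpotent[OF assms])

lemma index_weight_diff: "a \<subseteq># m \<Longrightarrow> index_weight a + index_weight (m - a) = index_weight m"
  unfolding index_weight_def by (metis image_mset_union subset_mset.add_diff_inverse sum_mset.union)

text \<open>The exponential of a derivation is multiplicative. As the weights of \<open>a\<close>
  and \<open>m - a\<close> add up to that of \<open>m\<close>, the triangular sum from the Leibniz
  rule contains the whole rectangle of nonzero terms.\<close>

lemma exp_linear_mult:
  fixes X :: "('h, 'n :: finite) gwdata"
  assumes h: "strictly_lowering h"
  shows "exp_linear X h (f * g) = exp_linear X h f * exp_linear X h g"
proof (rule mfps_eqI)
  fix m
  let ?D = "divpow (linear_part X h)"
  have "mcoeff (exp_linear X h (f * g)) m =
      (\<Sum>k\<le>index_weight m. \<Sum>i\<le>k. \<Sum>a | a \<subseteq># m. mcoeff (?D i f) a * mcoeff (?D (k - i) g) (m - a))"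
    by (simp add: exp_linear_def divpow_mult[OF linear_part_sum[OF h] linear_part_mult[OF h]
          linear_part_mconst_mult[OF h]] mcoeff_sum mcoeff_mult)
  also have "\<dots> = (\<Sum>k\<le>index_weight m. \<Sum>a | a \<subseteq># m. \<Sum>i\<le>k. mcoeff (?D i f) a * mcoeff (?D (k - i) g) (m - a))"
    by (intro sum.cong refl sum.swap)
  also have "\<dots> = (\<Sum>a | a \<subseteq># m. \<Sum>k\<le>index_weight m. \<Sum>i\<le>k. mcoeff (?D i f) a * mcoeff (?D (k - i) g) (m - a))"
    by (rule sum.swap)
  also have "\<dots> = (\<Sum>a | a \<subseteq># m. mcoeff (exp_linear X h f) a * mcoeff (exp_linear X h g) (m - a))"
  proof (intro sum.cong refl)
    fix a assume "a \<in> {a. a \<subseteq># m}"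
    then have "index_weight m = index_weight a + index_weight (m - a)"
      by (simp add: index_weight_diff)
    then show "(\<Sum>k\<le>index_weight m. \<Sum>i\<le>k. mcoeff (?D i f) a * mcoeff (?D (k - i) g) (m - a)) =
        mcoeff (exp_linear X h f) a * mcoeff (exp_linear X h g) (m - a)"
      unfolding exp_linear_def mcoeff_Mfps
      unfolding sum_product
      by (intro sum_triangle_eq_rectangle[where H = "\<lambda>i j. mcoeff (?D i f) a * mcoeff (?D j g) (m - a)"])
        (auto simp: divpow_linear_part_nilpotent[OF h])
  qed
  finally show "mcoeff (exp_linear X h (f * g)) m = mcoeff (exp_linear X h f * exp_linear X h g) m"
    by (simp add: mcoeff_mult)
qed

lemma row_finite_divpow: "row_finite D \<Longrightarrow> row_finite (divpow D n)"
proof -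
  assume D: "row_finite D"
  have "row_finite (\<lambda>f. (D ^^ n) f)"
    by (induction n) (simp_all add: row_finite_id row_finite_comp D)
  from row_finite_sum[of "{()}" "\<lambda>_. \<lambda>f. (D ^^ n) f" "\<lambda>_. 1 / fact n", OF _ this]
  show ?thesis by (simp add: divpow_def[abs_def])
qed

lemma row_finite_exp_linear:
  fixes X :: "('h, 'n :: finite) gwdata"
  assumes h: "strictly_lowering h"
  shows "row_finite (exp_linear X h)"
  unfolding row_finite_def
proof
  fix \<mu> :: "'n var multiset"
  have "row_finite (\<lambda>f. \<Sum>i\<le>index_weight \<mu>. mconst 1 * divpow (linear_part X h) i f)"
    by (intro row_finite_sum row_finite_divpow row_finite_linear_part h) auto
  moreover have "mcoeff (exp_linear X h f) \<mu> = mcoeff (\<Sum>i\<le>index_weight \<mu>. mconst 1 * divpow (linear_part X h) i f) \<mu>"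
    for f
    by (simp add: exp_linear_def mcoeff_sum)
  ultimately show "\<exists>S r. finite S \<and> (\<forall>f. mcoeff (exp_linear X h f) \<mu> = (\<Sum>k\<in>S. r k * mcoeff f k))"
    unfolding row_finite_def by simp
qed

text \<open>The intermediate index stops at that of \<open>w\<close>, where the column of a lowering
  matrix ends.\<close>

primrec hpow :: "(('n :: finite) var \<Rightarrow> 'n var \<Rightarrow> complex) \<Rightarrow> nat \<Rightarrow> 'n var \<Rightarrow> 'n var \<Rightarrow> complex" where
  "hpow h 0 v w = (if v = w then 1 else 0)"
| "hpow h (Suc i) v w = (\<Sum>u\<in>vars (fst w). hpow h i v u * h u w)"

text \<open>A strictly lowering matrix drops the index at each step, so the powers beyond the index
  of \<open>w\<close> vanish.\<close>

definition hexp :: "(('n :: finite) var \<Rightarrow> 'n var \<Rightarrow> complex) \<Rightarrow> 'n var \<Rightarrow> 'n var \<Rightarrow> complex" where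
  "hexp h v w = (\<Sum>i\<le>fst w. hpow h i v w / fact i)"

lemma linear_part_linser:
  fixes X :: "('h, 'n :: finite) gwdata"
  assumes h: "strictly_lowering h"
  shows "linear_part X h (linser l) = linser (\<lambda>w. \<Sum>u\<in>vars (fst w). l u * h u w)"
proof (rule mfps_eqI)
  fix m :: "'n var multiset"
  obtain K where K: "K \<ge> 1" "\<forall>v\<in>#m. fst v \<le> K"
    by (rule mset_index_ball)
  show "mcoeff (linear_part X h (linser l)) m = mcoeff (linser (\<lambda>w. \<Sum>u\<in>vars (fst w). l u * h u w)) m"
  proof (cases "size m = 1")
    case True
    then obtain w where m: "m = {#w#}" using size_1_singleton_mset by metis
    have "mcoeff (linear_part X h (linser l)) m = (\<Sum>v\<in>vars K. if v = w then \<Sum>u\<in>vars K. h u w * l u else 0)"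
      unfolding mcoeff_linear_part[OF h K] by (intro sum.cong refl) (auto simp: m)
    also have "\<dots> = (\<Sum>u\<in>vars K. h u w * l u)"
      using K(2) by (simp add: m)
    also have "\<dots> = (\<Sum>u\<in>vars (fst w). h u w * l u)"
      using K(2) by (intro sum.mono_neutral_right) (auto simp: m strictly_loweringD[OF h] not_le)
    finally show ?thesis by (simp add: m mult.commute)
  next
    case False
    have "mcoeff (linser l) (add_mset u (m - {#v#})) = 0" if "v \<in># m" for u v
      using that False by (intro mcoeff_linser_eq_0) (auto dest!: multi_member_split)
    then show ?thesis
      unfolding mcoeff_linear_part[OF h K] using False
      by (auto simp: mcoeff_linser_eq_0 intro!: sum.neutral)
  qed
qed

lemma exp_linear_mvar:
  fixes X :: "('h, 'n :: finite) gwdata"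
  assumes h: "strictly_lowering h"
  shows "exp_linear X h (mvar v) = linser (hexp h v)"
proof (rule mfps_eqI)
  fix m :: "'n var multiset"
  have *: "(linear_part X h ^^ i) (mvar v) = linser (hpow h i v)" for i
    by (induction i) (simp_all add: linser_mvar linear_part_linser[OF h])
  show "mcoeff (exp_linear X h (mvar v)) m = mcoeff (linser (hexp h v)) m"
  proof (cases "size m = 1")
    case True
    then obtain w where "m = {#w#}" using size_1_singleton_mset by metis
    then show ?thesis by (simp add: exp_linear_def divpow_def * hexp_def)
  next
    case False
    then show ?thesis by (simp add: exp_linear_def divpow_def * mcoeff_linser_eq_0)
  qed
qed

text \<open>A row-finite ring homomorphism is a substitution, and on the variables the exponential
  of the field is the exponential of its matrix.\<close>

lemma exp_linear_eq_subst:
  fixes X :: "('h, 'n :: finite) gwdata"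
  assumes h: "strictly_lowering h"
  shows "exp_linear X h f = subst f (\<lambda>v. linser (hexp h v))"
proof -
  have "linear_part X h 1 = 0"
    using linear_part_mult[OF h, of X 1 1] by simp
  then have "(linear_part X h ^^ Suc i) 1 = 0" for i
    using linear_part_sum[OF h, of X "\<lambda>_. 0" "{}"] by (induction i) simp_all
  then have D: "divpow (linear_part X h) i 1 = (if i = 0 then 1 else 0)" for i
    by (cases i) (auto simp: divpow_def simp del: funpow.simps)
  have "exp_linear X h 1 = 1"
    by (rule mfps_eqI) (simp add: exp_linear_def D if_distrib[of "\<lambda>f. mcoeff f _"] sum.delta cong: if_cong)
  from row_finite_hom_eq_subst(2)[OF row_finite_exp_linear[OF h] this exp_linear_mult[OF h], of f]
  show ?thesis by (simp add: exp_linear_mvar[OF h])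
qed

text \<open>An Euler identity: the product is homogeneous of degree \<open>size m\<close> in
  variables and shifts together, and the derivation with coefficients \<open>c\<close> accounts for
  the part of the degree carried by the shifts.\<close>

lemma translation_coeff:
  fixes c :: "'v \<Rightarrow> complex"
  assumes U: "finite U" "\<And>u. u \<notin> U \<Longrightarrow> c u = 0"
  shows "(of_nat (size m) - of_nat (size k)) * mcoeff (\<Prod>v\<in>#m. mvar v + mconst (c v)) k =
    (\<Sum>u\<in>U. c u * of_nat (Suc (count k u)) * mcoeff (\<Prod>v\<in>#m. mvar v + mconst (c v)) (add_mset u k))"
proof -
  define E where "E f = Mfps (\<lambda>k. of_nat (size k) * mcoeff f k)" for f :: "('v, complex) mfps"
  define C where "C f = (\<Sum>u\<in>U. mconst (c u) * mderiv u f)" for f :: "('v, complex) mfps"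
  let ?P = "\<lambda>m. \<Prod>v\<in>#m. mvar v + mconst (c v)"
  have E_mvar: "E (mvar v * f) = mvar v * E f + mvar v * f" for v f
    by (rule mfps_eqI) (auto simp: E_def mcoeff_mvar_mult ring_distribs dest!: multi_member_split)
  have E_add: "E (f + g) = E f + E g" for f g
    by (rule mfps_eqI) (simp add: E_def algebra_simps)
  have E_mconst: "E (mconst c * f) = mconst c * E f" for c f
    by (rule mfps_eqI) (simp add: E_def)
  have C_mult: "C (f * g) = C f * g + f * C g" for f g
    by (simp add: C_def mderiv_mult sum_distrib_left sum_distrib_right ring_distribs sum.distrib mult_ac)
  have C_var: "C (mvar v + mconst (c v)) = mconst (c v)" for v
  proof -
    have "C (mvar v + mconst (c v)) = (\<Sum>u\<in>U. if u = v then mconst (c v) else 0)"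
      unfolding C_def by (intro sum.cong refl) (auto simp: mderiv_add mderiv_mvar)
    then show ?thesis using U by auto
  qed
  have "mconst (of_nat (size m)) * ?P m - E (?P m) = C (?P m)" for m
  proof (induction m)
    case empty
    have "E 1 = 0" by (rule mfps_eqI) (simp add: E_def mcoeff_1)
    then show ?case by (simp add: C_def)
  next
    case (add v m)
    have "C (?P (add_mset v m)) = C (mvar v + mconst (c v)) * ?P m + (mvar v + mconst (c v)) * C (?P m)"
      by (simp add: C_mult)
    also have "\<dots> = mconst (of_nat (size (add_mset v m))) * ?P (add_mset v m) - E (?P (add_mset v m))"
      unfolding C_var add.IH[symmetric]
      by (simp add: ring_distribs E_add E_mvar E_mconst mconst_add mult_ac)
    finally show ?case by simp
  qed
  from arg_cong[OF this, of "\<lambda>f. mcoeff f k"] show ?thesis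
    by (simp add: E_def C_def mcoeff_sum mcoeff_mderiv ring_distribs mult_ac del: of_nat_Suc)
qed

lemma translation_coeff_degree:
  fixes c :: "'v \<Rightarrow> complex"
  shows "size k \<ge> size m \<Longrightarrow>
    mcoeff (\<Prod>v\<in>#m. mvar v + mconst (c v)) k = (if k = m then 1 else 0)"
proof (induction m arbitrary: k)
  case empty
  then show ?case by (simp add: mcoeff_1)
next
  case (add v m)
  have "mcoeff (\<Prod>v\<in>#m. mvar v + mconst (c v)) k = 0"
    using add by (subst add.IH) auto
  then show ?case
    using add.prems add.IH[of "k - {#v#}"]
    by (auto simp: ring_distribs mcoeff_mvar_mult dest!: multi_member_split)
qed

definition translation_vec :: "('h, 'n) gwdata \<Rightarrow> ('n var \<Rightarrow> 'n var \<Rightarrow> complex) \<Rightarrow> 'n var \<Rightarrow> complex" where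
  "translation_vec X h u = (if fst u = 0 then - h u (1, unit_ix X) else 0)"

text \<open>A j-fold translation derivative lowers degrees by j. So the j-th Taylor term at
  \<open>k\<close> is the slice of the substitution sum over monomials of degree
  \<open>size k + j\<close>.\<close>

lemma divpow_translation_part_has_sum:
  fixes X :: "('h, 'n :: finite) gwdata" and f :: "'n tser"
  shows "((\<lambda>m. mcoeff f m * mcoeff (\<Prod>v\<in>#m. mvar v + mconst (translation_vec X h v)) k) has_sum
    mcoeff (divpow (translation_part X h) j f) k) {m. size m = size k + j}"
proof (induction j arbitrary: k)
  case 0
  show ?case
    by (rule has_sum_finite_neutralI[where B = "{k}"]) (auto simp: translation_coeff_degree)
next
  case (Suc j)
  let ?C = "translation_part X h" and ?P = "\<lambda>m. \<Prod>v\<in>#m. mvar v + mconst (translation_vec X h v)"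
  have "((\<lambda>m. \<Sum>u\<in>vars 0. translation_vec X h u * of_nat (Suc (count k u)) * (mcoeff f m * mcoeff (?P m) (add_mset u k))) has_sum
      (\<Sum>u\<in>vars 0. translation_vec X h u * of_nat (Suc (count k u)) * mcoeff (divpow ?C j f) (add_mset u k)))
      {m. size m = size k + Suc j}"
    using Suc[of "add_mset u k" for u] by (intro has_sum_sum has_sum_cmult_right) auto
  also have "(\<Sum>u\<in>vars 0. translation_vec X h u * of_nat (Suc (count k u)) * mcoeff (divpow ?C j f) (add_mset u k))
      = mcoeff (?C (divpow ?C j f)) k"
    by (simp add: translation_part_def mcoeff_sum mcoeff_mderiv translation_vec_def mult.assoc)
  also have "\<dots> = of_nat (Suc j) * mcoeff (divpow ?C (Suc j) f) k"
    unfolding apply_divpow[of ?C, OF translation_part_mconst_mult] mconst_of_nat[symmetric]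
    by (simp only: mcoeff_mconst_mult)
  also have "((\<lambda>m. \<Sum>u\<in>vars 0. translation_vec X h u * of_nat (Suc (count k u)) * (mcoeff f m * mcoeff (?P m) (add_mset u k))) has_sum
      of_nat (Suc j) * mcoeff (divpow ?C (Suc j) f) k) {m. size m = size k + Suc j} \<longleftrightarrow>
      ((\<lambda>m. of_nat (Suc j) * (mcoeff f m * mcoeff (?P m) k)) has_sum
      of_nat (Suc j) * mcoeff (divpow ?C (Suc j) f) k) {m. size m = size k + Suc j}"
  proof (rule has_sum_cong)
    fix m :: "'n var multiset" assume "m \<in> {m. size m = size k + Suc j}"
    \<comment> \<open>On this slice the degree defect is j+1, the factor in the recursion for
      divided powers.\<close>
    then have "(of_nat (size m) - of_nat (size k) :: complex) = of_nat (Suc j)" by simp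
    then have "of_nat (Suc j) * mcoeff (?P m) k =
        (\<Sum>u\<in>vars 0. translation_vec X h u * of_nat (Suc (count k u)) * mcoeff (?P m) (add_mset u k))"
      using translation_coeff[of "vars 0" "translation_vec X h" m k] by (simp add: translation_vec_def)
    then show "(\<Sum>u\<in>vars 0. translation_vec X h u * of_nat (Suc (count k u)) * (mcoeff f m * mcoeff (?P m) (add_mset u k))) =
        of_nat (Suc j) * (mcoeff f m * mcoeff (?P m) k)"
      unfolding mult.left_commute[of "of_nat (Suc j)"] by (simp add: sum_distrib_left mult_ac del: of_nat_Suc)
  qed
  finally show ?case
    by (subst (asm) has_sum_cmult_right_iff) (simp_all del: of_nat_Suc)
qed

text \<open>The unconditionally convergent substitution sum is regrouped into its slices by degree,
  which are the Taylor terms.\<close>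

lemma divpow_translation_part_sums:
  fixes X :: "('h, 'n :: finite) gwdata" and f :: "'n tser"
  assumes f: "subst_defined f (\<lambda>v. mvar v + mconst (translation_vec X h v))"
  shows "(\<lambda>j. mcoeff (divpow (translation_part X h) j f) k) sums
    mcoeff (subst f (\<lambda>v. mvar v + mconst (translation_vec X h v))) k"
proof (rule has_sum_imp_sums)
  let ?x = "\<lambda>m. mcoeff f m * mcoeff (\<Prod>v\<in>#m. mvar v + mconst (translation_vec X h v)) k"
  have "(?x has_sum mcoeff (subst f (\<lambda>v. mvar v + mconst (translation_vec X h v))) k) {m. size m \<ge> size k}"
    by (subst has_sum_cong_neutral[where T = UNIV and g = ?x])
      (auto simp: translation_coeff_degree subst_has_sum[OF f])
  then have "((\<lambda>(j, m). ?x m) has_sum mcoeff (subst f (\<lambda>v. mvar v + mconst (translation_vec X h v))) k)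
      (Sigma UNIV (\<lambda>j. {m. size m = size k + j}))"
    by (subst has_sum_reindex_bij_witness[where T = "{m. size m \<ge> size k}" and h = ?x
          and i = "\<lambda>m. (size m - size k, m)" and j = snd]) auto
  then show "((\<lambda>j. mcoeff (divpow (translation_part X h) j f) k) has_sum
      mcoeff (subst f (\<lambda>v. mvar v + mconst (translation_vec X h v))) k) UNIV"
    by (rule has_sum_SigmaD)
      (use divpow_translation_part_has_sum[of f X h k] in simp)
qed

lemma sums_if_shift:
  fixes f :: "nat \<Rightarrow> complex"
  assumes "f sums s"
  shows "(\<lambda>n. if i \<le> n then f (n - i) else 0) sums s"
proof -
  have "(\<lambda>n. if i \<le> n + i then f (n + i - i) else 0) sums s" using assms by simp
  then show ?thesis by (subst (asm) sums_iff_shift) (simp add: lessThan_def)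
qed

text \<open>The two parts commute.  The translation part contributes the Taylor series of a translation,
  which converges by assumption, and the linear part contributes finitely many terms to each
  coefficient.\<close>

lemma divpow_vfield_sums:
  fixes X :: "('h, 'n :: finite) gwdata" and f :: "'n tser"
  assumes h: "strictly_lowering h" and L: "lowering (hexp h)"
    and Q: "lowering Q" "\<And>v w. (\<Sum>u\<in>vars (fst w). hexp h v u * Q u w) = (if v = w then 1 else 0)"
    and f: "subst_defined f (\<lambda>v. linser (hexp h v) + mconst (translation_vec X h v))"
  shows "(\<lambda>n. mcoeff (divpow (vfield X h) n f) m) sums
    mcoeff (subst f (\<lambda>v. linser (hexp h v) + mconst (translation_vec X h v))) m"
proof -
  let ?T = "\<lambda>v. mvar v + mconst (translation_vec X h v)"
  note fQ = formal_fam_linser[OF Q(1)] and fL = formal_fam_linser[OF L]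
  have LQ: "subst (linser (hexp h v)) (\<lambda>v. linser (Q v)) = mvar v" for v
  proof (rule mfps_eqI)
    fix \<mu> :: "'n var multiset"
    show "mcoeff (subst (linser (hexp h v)) (\<lambda>v. linser (Q v))) \<mu> = mcoeff (mvar v) \<mu>"
    proof (cases "size \<mu> = 1")
      case True
      then obtain w where w: "\<mu> = {#w#}" using size_1_singleton_mset by metis
      have "Q u w = 0" if "fst u > fst w" for u using loweringD[OF Q(1) that] .
      then have "mcoeff (subst (linser (hexp h v)) (\<lambda>v. linser (Q v))) \<mu>
          = (\<Sum>u\<in>vars (fst w). hexp h v u * Q u w)"
        by (subst subst_linser[where A = "vars (fst w)"]) (auto simp: w not_le)
      then show ?thesis using Q(2) by (simp add: w mcoeff_mvar)
    next
      case False
      then show ?thesis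
        by (subst subst_linser[where A = "{}"]) (auto simp: mcoeff_linser_eq_0 mcoeff_mvar)
    qed
  qed
  \<comment> \<open>Undoing the linear part with the inverse matrix \<open>Q\<close> shows that the
    translation alone converges on \<open>f\<close>.\<close>
  have "subst (linser (hexp h v) + mconst (translation_vec X h v)) (\<lambda>v. linser (Q v)) = ?T v" for v
    by (simp add: subst_add subst_defined_formal[OF fQ] subst_mconst LQ)
  with subst_subst(1)[OF f fQ] have fT: "subst_defined f ?T" by simp
  have "subst (?T v) (\<lambda>v. linser (hexp h v)) = linser (hexp h v) + mconst (translation_vec X h v)" for v
    by (simp add: subst_add subst_defined_formal[OF fL] subst_mconst subst_mvar)
  with subst_subst(2)[OF fT fL]
  have eq: "subst f (\<lambda>v. linser (hexp h v) + mconst (translation_vec X h v)) = exp_linear X h (subst f ?T)"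
    by (simp add: exp_linear_eq_subst[OF h])
  let ?N = "divpow (linear_part X h)" and ?C = "divpow (translation_part X h)"
  have V: "divpow (vfield X h) n f = (\<Sum>i\<le>n. ?N i (?C (n - i) f))" for n
    using divpow_add_commuting[where A = "linear_part X h" and B = "translation_part X h" and n = n and f = f]
    by (simp add: linear_part_sum[OF h] linear_part_mconst_mult[OF h] translation_part_sum
        translation_part_mconst_mult translation_linear_commute[OF h]) (simp add: linear_part_def)
  have "mcoeff (divpow (vfield X h) n f) m =
      (\<Sum>i\<le>index_weight m. if i \<le> n then mcoeff (?N i (?C (n - i) f)) m else 0)" for n
  proof -
    have "mcoeff (divpow (vfield X h) n f) m = (\<Sum>i\<le>n. mcoeff (?N i (?C (n - i) f)) m)"
      by (simp add: V mcoeff_sum)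
    also have "\<dots> = (\<Sum>i\<in>{..n} \<inter> {..index_weight m}. mcoeff (?N i (?C (n - i) f)) m)"
    proof (rule sum.mono_neutral_right)
      show "\<forall>i\<in>{..n} - {..n} \<inter> {..index_weight m}. mcoeff (?N i (?C (n - i) f)) m = 0"
        by (intro ballI divpow_linear_part_nilpotent[OF h]) auto
    qed auto
    also have "\<dots> = (\<Sum>i\<le>index_weight m. if i \<le> n then mcoeff (?N i (?C (n - i) f)) m else 0)"
      by (rule sum.mono_neutral_cong_left) auto
    finally show ?thesis .
  qed
  \<comment> \<open>Each of the finitely many orders \<open>i\<close> that reach \<open>m\<close>
    leaves a Taylor series with its index shifted by \<open>i\<close>.\<close>
  moreover have "(\<lambda>n. if i \<le> n then mcoeff (?N i (?C (n - i) f)) m else 0) sums mcoeff (?N i (subst f ?T)) m" for i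
    by (rule sums_if_shift[where f = "\<lambda>j. mcoeff (?N i (?C j f)) m", OF row_finite_sums[OF
          row_finite_divpow[OF row_finite_linear_part[OF h]] divpow_translation_part_sums[OF fT]]])
  from sums_sum[OF this] have "(\<lambda>n. \<Sum>i\<le>index_weight m. if i \<le> n then mcoeff (?N i (?C (n - i) f)) m else 0) sums
      (\<Sum>i\<le>index_weight m. mcoeff (?N i (subst f ?T)) m)" .
  ultimately show ?thesis
    by (simp add: eq exp_linear_def)
qed

section \<open>The group $G_-$ in coordinates\<close>

lemma gw_vector_space: "gw_space X \<Longrightarrow> vector_space (scl X)"
  by (simp add: gw_space_def)

lemma pair_commute: "gw_space X \<Longrightarrow> pair X u v = pair X v u"
  unfolding gw_space_def by blast

lemma pair_right_simps:
  assumes "gw_space X"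
  shows "pair X u (v + w) = pair X u v + pair X u w" "pair X u (scl X c v) = c * pair X u v"
    "pair X u 0 = 0" "pair X u (- v) = - pair X u v" "pair X u (v - w) = pair X u v - pair X u w"
proof -
  interpret Vector_Spaces.linear "scl X" "(*)" "pair X u"
    using assms by (simp add: gw_space_def)
  show "pair X u (v + w) = pair X u v + pair X u w" "pair X u (scl X c v) = c * pair X u v"
    "pair X u 0 = 0" "pair X u (- v) = - pair X u v" "pair X u (v - w) = pair X u v - pair X u w"
    by (simp_all add: add scale neg diff)
qed

lemma pair_left_simps:
  assumes "gw_space X"
  shows "pair X (v + w) u = pair X v u + pair X w u" "pair X (scl X c v) u = c * pair X v u"
    "pair X 0 u = 0" "pair X (- v) u = - pair X v u" "pair X (v - w) u = pair X v u - pair X w u"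
  using pair_right_simps[OF assms] by (simp_all add: pair_commute[OF assms, of _ u])

lemma pair_sum_right: "gw_space X \<Longrightarrow> pair X u (sum f I) = (\<Sum>i\<in>I. pair X u (f i))"
  by (induction I rule: infinite_finite_induct) (auto simp: pair_right_simps)

lemma pair_sum_left: "gw_space X \<Longrightarrow> pair X (sum f I) u = (\<Sum>i\<in>I. pair X (f i) u)"
  by (induction I rule: infinite_finite_induct) (auto simp: pair_left_simps)

lemma pair_eqI:
  assumes X: "gw_space X" and "\<And>v. pair X u v = pair X w v"
  shows "u = w"
proof -
  have "\<forall>v. pair X (u - w) v = 0" using assms by (simp add: pair_left_simps)
  then have "u - w = 0" using X unfolding gw_space_def by blast
  then show ?thesis by simp
qed

lemma pair_eqI_bas:
  assumes X: "gw_space X" and eq: "\<And>\<alpha>. pair X (bas X \<alpha>) u = pair X (bas X \<alpha>) w"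
  shows "u = w"
proof (rule pair_eqI[OF X])
  fix v
  interpret vs: vector_space "scl X" by (rule gw_vector_space[OF X])
  have "v \<in> vs.span (range (bas X))" using X by (simp add: gw_space_def)
  then have "pair X v u = pair X v w"
    by (induction rule: vs.span_induct_alt) (auto simp: pair_left_simps[OF X] eq)
  then show "pair X u v = pair X w v" by (simp add: pair_commute[OF X])
qed

lemma scl_simps:
  assumes "gw_space X"
  shows "scl X c (v + w) = scl X c v + scl X c w" "scl X (a + b) v = scl X a v + scl X b v"
    "scl X a (scl X b v) = scl X (a * b) v" "scl X 1 v = v" "scl X 0 v = 0" "scl X c 0 = 0"
    "scl X c (- v) = - scl X c v" "scl X (- c) v = - scl X c v"
proof -
  interpret vs: vector_space "scl X" by (rule gw_vector_space[OF assms])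
  show "scl X c (v + w) = scl X c v + scl X c w" "scl X (a + b) v = scl X a v + scl X b v"
    "scl X a (scl X b v) = scl X (a * b) v" "scl X 1 v = v" "scl X 0 v = 0" "scl X c 0 = 0"
    "scl X c (- v) = - scl X c v" "scl X (- c) v = - scl X c v"
    by (simp_all add: vs.scale_left_distrib vs.scale_right_distrib)
qed

lemma scl_sum: "gw_space X \<Longrightarrow> scl X c (sum f I) = (\<Sum>i\<in>I. scl X c (f i))"
  by (induction I rule: infinite_finite_induct) (auto simp: scl_simps)

lemma bas_independent:
  assumes X: "gw_space X" and 0: "(\<Sum>\<alpha>\<in>UNIV. scl X (c \<alpha>) (bas X \<alpha>)) = 0"
  shows "c \<alpha> = 0"
proof -
  interpret vs: vector_space "scl X" by (rule gw_vector_space[OF X])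
  have inj: "inj (bas X)" and ind: "\<not> vs.dependent (range (bas X))" using X by (auto simp: gw_space_def)
  have "(\<Sum>v\<in>range (bas X). scl X (c (inv (bas X) v)) v) = 0"
    using 0 by (subst sum.reindex[OF inj]) (simp add: inj)
  from vs.independentD[OF ind _ _ this, of "bas X \<alpha>"] show ?thesis by (simp add: inj)
qed

text \<open>A kernel vector of the Gram matrix yields an element orthogonal to the basis, hence
  zero. So the matrix is invertible and \<open>matrix_inv\<close> is a genuine inverse.\<close>

lemma gram_inv_mult:
  fixes X :: "('h :: ab_group_add, 'n :: finite) gwdata"
  assumes X: "gw_space X"
  shows "(\<Sum>\<beta>\<in>UNIV. gram_inv X \<alpha> \<beta> * pair X (bas X \<beta>) (bas X \<gamma>)) = (if \<alpha> = \<gamma> then 1 else 0)"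
proof -
  have "x = 0" if "gram X *v x = 0" for x :: "complex ^ 'n"
  proof -
    let ?u = "\<Sum>\<alpha>\<in>UNIV. scl X (vec_nth x \<alpha>) (bas X \<alpha>)"
    have "pair X (bas X \<beta>) ?u = vec_nth (gram X *v x) \<beta>" for \<beta>
      by (simp add: pair_sum_right[OF X] pair_right_simps[OF X] matrix_vector_mult_def gram_def mult.commute)
    then have "?u = 0" using that by (intro pair_eqI_bas[OF X]) (simp add: pair_right_simps[OF X])
    from bas_independent[OF X this] show ?thesis by (simp add: vec_eq_iff)
  qed
  then have "invertible (gram X)"
    unfolding invertible_left_inverse matrix_left_invertible_ker by blast
  then have "matrix_inv (gram X) ** gram X = mat 1"
    unfolding matrix_inv_def invertible_def by (rule someI2_ex) blast
  then have "vec_nth (vec_nth (matrix_inv (gram X) ** gram X) \<alpha>) \<gamma> = (if \<alpha> = \<gamma> then 1 else 0)"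
    by (simp add: mat_def)
  then show ?thesis by (simp add: matrix_matrix_mult_def gram_inv_def gram_def)
qed

lemma pair_cobas_bas:
  assumes X: "gw_space X"
  shows "pair X (cobas X \<alpha>) (bas X \<gamma>) = (if \<alpha> = \<gamma> then 1 else 0)"
  using gram_inv_mult[OF X] by (simp add: cobas_def pair_sum_left[OF X] pair_left_simps[OF X])

lemma cobas_expansion:
  assumes X: "gw_space X"
  shows "v = (\<Sum>\<alpha>\<in>UNIV. scl X (pair X (bas X \<alpha>) v) (cobas X \<alpha>))"
  by (rule pair_eqI_bas[OF X])
    (simp add: pair_sum_right[OF X] pair_right_simps[OF X] pair_commute[OF X, of "bas X _" "cobas X _"]
      pair_cobas_bas[OF X] if_distrib cong: if_cong)

lemma bas_expansion:
  assumes X: "gw_space X"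
  shows "v = (\<Sum>\<alpha>\<in>UNIV. scl X (pair X (cobas X \<alpha>) v) (bas X \<alpha>))"
proof (rule pair_eqI_bas[OF X])
  fix \<beta>
  have "pair X (bas X \<beta>) v = (\<Sum>\<alpha>\<in>UNIV. pair X (bas X \<alpha>) (bas X \<beta>) * pair X (cobas X \<alpha>) v)"
    by (subst cobas_expansion[OF X, of "bas X \<beta>"])
      (simp add: pair_sum_left[OF X] pair_left_simps[OF X])
  then show "pair X (bas X \<beta>) v = pair X (bas X \<beta>) (\<Sum>\<alpha>\<in>UNIV. scl X (pair X (cobas X \<alpha>) v) (bas X \<alpha>))"
    by (simp add: pair_sum_right[OF X] pair_right_simps[OF X] pair_commute[OF X, of "bas X _" "bas X \<beta>"] mult.commute)
qed

lemma coords_bas: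
  assumes X: "gw_space X"
  shows "coords X (bas X) v \<alpha> = pair X (cobas X \<alpha>) v"
proof -
  have "coords X (bas X) v = (\<lambda>\<alpha>. pair X (cobas X \<alpha>) v)"
    unfolding coords_def
  proof (rule the_equality)
    show "v = (\<Sum>\<alpha>\<in>UNIV. scl X (pair X (cobas X \<alpha>) v) (bas X \<alpha>))" by (rule bas_expansion[OF X])
    show "c = (\<lambda>\<alpha>. pair X (cobas X \<alpha>) v)" if "v = (\<Sum>\<alpha>\<in>UNIV. scl X (c \<alpha>) (bas X \<alpha>))" for c
      by (rule ext, subst that)
        (simp add: pair_sum_right[OF X] pair_right_simps[OF X] pair_cobas_bas[OF X] if_distrib cong: if_cong)
  qed
  then show ?thesis by simp
qed

lemma coords_cobas:
  assumes X: "gw_space X"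
  shows "coords X (cobas X) v \<alpha> = pair X (bas X \<alpha>) v"
proof -
  have "coords X (cobas X) v = (\<lambda>\<alpha>. pair X (bas X \<alpha>) v)"
    unfolding coords_def
  proof (rule the_equality)
    show "v = (\<Sum>\<alpha>\<in>UNIV. scl X (pair X (bas X \<alpha>) v) (cobas X \<alpha>))" by (rule cobas_expansion[OF X])
    show "c = (\<lambda>\<alpha>. pair X (bas X \<alpha>) v)" if "v = (\<Sum>\<alpha>\<in>UNIV. scl X (c \<alpha>) (cobas X \<alpha>))" for c
      by (rule ext, subst that)
        (simp add: pair_sum_right[OF X] pair_right_simps[OF X] pair_commute[OF X, of "bas X _" "cobas X _"]
          pair_cobas_bas[OF X] if_distrib cong: if_cong)
  qed
  then show ?thesis by simp
qed

lemma sum_coords_pair: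
  assumes X: "gw_space X"
  shows "(\<Sum>\<beta>\<in>UNIV. pair X (cobas X \<beta>) u * pair X (bas X \<beta>) v) = pair X u v"
  using arg_cong[OF bas_expansion[OF X, of u], of "\<lambda>u. pair X u v"]
  by (simp add: pair_sum_left[OF X] pair_left_simps[OF X])

text \<open>Raising an index, in the form in which the inverse Gram matrix enters the topological
  recursion relation.\<close>

lemma sum_pair_gram_inv:
  assumes X: "gw_space X"
  shows "(\<Sum>\<mu>\<in>UNIV. pair X (bas X \<mu>) v * gram_inv X \<mu> \<nu>) = pair X (cobas X \<nu>) v"
proof -
  have "pair X (cobas X \<nu>) (cobas X \<mu>) = gram_inv X \<mu> \<nu>" for \<mu>
    by (subst (2) cobas_def)
      (simp add: pair_sum_right[OF X] pair_right_simps[OF X] pair_cobas_bas[OF X] if_distrib cong: if_cong)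
  then show ?thesis
    by (subst (2) cobas_expansion[OF X, of v]) (simp add: pair_sum_right[OF X] pair_right_simps[OF X])
qed

abbreviation endo :: "('h :: ab_group_add, 'n) gwdata \<Rightarrow> ('h \<Rightarrow> 'h) \<Rightarrow> bool" where
  "endo X \<equiv> Vector_Spaces.linear (scl X) (scl X)"

lemma endo_simps:
  assumes "endo X T"
  shows "T (u + v) = T u + T v" "T (scl X c v) = scl X c (T v)" "T 0 = 0" "T (- v) = - T v"
    "T (sum f I) = (\<Sum>i\<in>I. T (f i))"
proof -
  interpret Vector_Spaces.linear "scl X" "scl X" T by (rule assms)
  show "T (u + v) = T u + T v" "T (scl X c v) = scl X c (T v)" "T 0 = 0" "T (- v) = - T v"
    "T (sum f I) = (\<Sum>i\<in>I. T (f i))"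
    by (simp_all add: add scale neg sum)
qed

lemma pair_endo_expansion:
  assumes X: "gw_space X" and A: "endo X T"
  shows "pair X w (T u) = (\<Sum>\<beta>\<in>UNIV. pair X (cobas X \<beta>) u * pair X w (T (bas X \<beta>)))"
  using arg_cong[OF bas_expansion[OF X, of u], of "\<lambda>u. pair X w (T u)"]
  by (simp add: endo_simps[OF A] pair_sum_right[OF X] pair_right_simps[OF X])

lemma endoI:
  assumes "gw_space X" "\<And>u v. T (u + v) = T u + T v" "\<And>c v. T (scl X c v) = scl X c (T v)"
  shows "endo X T"
  unfolding Vector_Spaces.linear_iff using assms gw_vector_space by blast

text \<open>The dual basis provides a candidate and nondegeneracy its uniqueness, so the definite
  description in \<open>adj\<close> denotes it.\<close>

lemma pair_adj:
  assumes X: "gw_space X" and T: "endo X T"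
  shows "pair X (adj X T u) v = pair X u (T v)"
proof -
  let ?T' = "\<lambda>u. \<Sum>\<alpha>\<in>UNIV. scl X (pair X u (T (bas X \<alpha>))) (cobas X \<alpha>)"
  have "pair X (?T' u) v = pair X u (T v)" for u v
    by (subst (2) bas_expansion[OF X, of v])
      (simp add: pair_sum_left[OF X] pair_left_simps[OF X] endo_simps[OF T] pair_sum_right[OF X]
        pair_right_simps[OF X] mult.commute)
  then have "adj X T = ?T'"
    unfolding adj_def by (intro the_equality) (auto intro!: ext pair_eqI[OF X])
  with \<open>\<And>u v. pair X (?T' u) v = pair X u (T v)\<close> show ?thesis by simp
qed

text \<open>Membership in the Lie algebra, stated through the form instead of the adjoint; in this
  shape it passes directly to -a.\<close>

definition skew_series :: "('h :: ab_group_add, 'n) gwdata \<Rightarrow> (nat \<Rightarrow> 'h \<Rightarrow> 'h) \<Rightarrow> bool" where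
  "skew_series X a \<longleftrightarrow> (\<forall>v. a 0 v = 0) \<and> (\<forall>i. endo X (a i)) \<and>
     (\<forall>i u v. pair X (a i u) v = (- 1) ^ Suc i * pair X u (a i v))"

lemma skew_series_g_minus:
  assumes X: "gw_space X" and a: "a \<in> g_minus X"
  shows "skew_series X a"
proof -
  have a0: "a 0 = (\<lambda>_. 0)" and e: "\<And>i. endo X (a i)"
    and adj: "\<And>i. i > 0 \<Longrightarrow> adj X (a i) = (\<lambda>v. scl X ((- 1) ^ (i + 1)) (a i v))"
    using a by (auto simp: g_minus_def)
  have "pair X (a i u) v = (- 1) ^ Suc i * pair X u (a i v)" for i u v
  proof (cases "i = 0")
    case False
    then have "pair X u (a i v) = (- 1) ^ Suc i * pair X (a i u) v"
      using pair_adj[OF X e, of i u v] adj[of i] by (simp add: pair_left_simps[OF X])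
    then show ?thesis by (simp add: mult.assoc[symmetric] power_mult_distrib[symmetric])
  qed (simp add: a0 pair_left_simps[OF X] pair_right_simps[OF X])
  then show ?thesis using a0 e by (simp add: skew_series_def)
qed

lemma skew_series_uminus:
  assumes X: "gw_space X" and a: "skew_series X a"
  shows "skew_series X (\<lambda>i v. - a i v)"
proof -
  have e: "endo X (a i)" for i using a by (simp add: skew_series_def)
  show ?thesis
    using a unfolding skew_series_def
    by (auto simp: pair_left_simps[OF X] pair_right_simps[OF X] endo_simps[OF e] scl_simps[OF X]
        intro!: endoI[OF X])
qed

section \<open>Series of endomorphisms and their exponentials\<close>

lemma sum_triangle:
  "(\<Sum>i\<le>(k::nat). \<Sum>j\<le>k - i. f i j) = (\<Sum>m\<le>k. \<Sum>i\<le>m. f i (m - i))"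
proof -
  have "(\<Sum>m\<le>k. \<Sum>i\<le>m. f i (m - i)) = (\<Sum>(i, j)\<in>{(i, j). i + j \<le> k}. f i j)"
    by (rule sum.triangle_reindex_eq[symmetric])
  also have "{(i, j). i + j \<le> k} = Sigma {..k} (\<lambda>i. {..k - i})" by auto
  finally show ?thesis by (simp add: sum.Sigma)
qed

lemma sum_triangle_swap:
  "(\<Sum>i\<le>(k::nat). \<Sum>j\<le>k - i. f i j) = (\<Sum>j\<le>k. \<Sum>i\<le>k - j. f i j)"
proof -
  have "(\<Sum>i\<le>m. f i (m - i)) = (\<Sum>j\<le>m. f (m - j) j)" for m
    by (rule sum.reindex_bij_witness[where i = "\<lambda>i. m - i" and j = "\<lambda>i. m - i"]) auto
  then show ?thesis
    unfolding sum_triangle[of f] sum_triangle[of "\<lambda>j i. f i j"] by simp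
qed

lemma ser_mult_assoc:
  assumes "\<And>i. endo X (A i)"
  shows "ser_mult A (ser_mult B C) = ser_mult (ser_mult A B) C"
proof (intro ext)
  fix k v
  have "ser_mult A (ser_mult B C) k v = (\<Sum>i\<le>k. \<Sum>j\<le>k - i. A i (B j (C (k - i - j) v)))"
    by (simp add: ser_mult_def endo_simps[OF assms])
  also have "\<dots> = (\<Sum>m\<le>k. \<Sum>i\<le>m. A i (B (m - i) (C (k - i - (m - i)) v)))"
    by (rule sum_triangle)
  also have "\<dots> = ser_mult (ser_mult A B) C k v"
    unfolding ser_mult_def by (intro sum.cong refl) auto
  finally show "ser_mult A (ser_mult B C) k v = ser_mult (ser_mult A B) C k v" .
qed

lemma ser_mult_one_left: "ser_mult ser_one A = A"
  by (intro ext) (simp add: ser_mult_def ser_one_def sum.delta' if_distrib[of "\<lambda>f. f _"] cong: if_cong)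

lemma ser_mult_one_right:
  assumes "\<And>i. endo X (A i)"
  shows "ser_mult A ser_one = A"
proof (intro ext)
  fix k v
  have "ser_mult A ser_one k v = (\<Sum>i\<le>k. if i = k then A k v else 0)"
    unfolding ser_mult_def ser_one_def by (intro sum.cong refl) (auto simp: endo_simps[OF assms])
  then show "ser_mult A ser_one k v = A k v" by simp
qed

lemma endo_ser_one: "gw_space X \<Longrightarrow> endo X (ser_one k)"
  by (intro endoI) (auto simp: ser_one_def scl_simps)

lemma endo_ser_mult:
  assumes X: "gw_space X" and "\<And>i. endo X (A i)" "\<And>i. endo X (B i)"
  shows "endo X (ser_mult A B k)"
  by (rule endoI[OF X])
    (simp_all add: ser_mult_def endo_simps[OF assms(2)] endo_simps[OF assms(3)] sum.distrib scl_sum[OF X])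

lemma ser_inv_eqI:
  assumes "\<And>i. endo X (A i)" "\<And>i. endo X (B i)" "ser_mult B A = ser_one" "ser_mult A B = ser_one"
  shows "ser_inv A = B"
  unfolding ser_inv_def
proof (rule the_equality)
  show "C = B" if "ser_mult C A = ser_one \<and> ser_mult A C = ser_one" for C
  proof -
    \<comment> \<open>The description in \<open>ser_inv\<close> ranges over arbitrary maps
      \<open>C\<close>, so associativity is used with the linear series \<open>B\<close> on the
      left.\<close>
    have "B = ser_mult B (ser_mult A C)" using that ser_mult_one_right[OF assms(2)] by simp
    also have "\<dots> = C" by (simp add: ser_mult_assoc[OF assms(2)] assms(3) ser_mult_one_left)
    finally show ?thesis by simp
  qed
qed (use assms in simp)

definition ser_pow :: "(nat \<Rightarrow> 'h \<Rightarrow> 'h) \<Rightarrow> nat \<Rightarrow> nat \<Rightarrow> 'h \<Rightarrow> 'h :: ab_group_add" where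
  "ser_pow A n = (ser_mult A ^^ n) ser_one"

lemma ser_pow_0 [simp]: "ser_pow A 0 = ser_one"
  by (simp add: ser_pow_def)

lemma endo_ser_pow:
  assumes "gw_space X" "\<And>i. endo X (A i)"
  shows "endo X (ser_pow A n k)"
proof (induction n arbitrary: k)
  case (Suc n)
  then show ?case
    using endo_ser_mult[OF assms(1), of A "ser_pow A n" k] assms(2) by (simp add: ser_pow_def)
qed (simp add: endo_ser_one assms)

lemma ser_pow_Suc: "ser_pow A (Suc n) = ser_mult A (ser_pow A n)"
  by (simp add: ser_pow_def)

lemma ser_pow_Suc_right:
  assumes X: "gw_space X" and A: "\<And>i. endo X (A i)"
  shows "ser_pow A (Suc n) = ser_mult (ser_pow A n) A"
proof (induction n)
  case 0
  show ?case by (simp add: ser_pow_Suc ser_mult_one_left ser_mult_one_right[OF A])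
next
  case (Suc n)
  have "ser_pow A (Suc (Suc n)) = ser_mult A (ser_mult (ser_pow A n) A)"
    by (simp only: ser_pow_Suc[of A "Suc n"] Suc)
  also have "\<dots> = ser_mult (ser_mult A (ser_pow A n)) A"
    by (rule ser_mult_assoc[OF A])
  finally show ?case unfolding ser_pow_Suc[of A n, symmetric] .
qed

text \<open>Each of the n factors contributes at least one power of z^{-1}.\<close>

lemma ser_pow_eq_0:
  assumes A: "\<And>i. endo X (A i)" and A0: "\<And>v. A 0 v = 0" and "k < n"
  shows "ser_pow A n k v = 0"
  using assms(3)
proof (induction n arbitrary: k)
  case (Suc n)
  have "A i (ser_pow A n (k - i) v) = 0" if "i \<le> k" for i
  proof (cases "i = 0")
    case False
    then show ?thesis using Suc that by (simp add: endo_simps[OF A])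
  qed (simp add: A0)
  then show ?case by (simp add: ser_pow_Suc ser_mult_def)
qed simp

definition ser_divpow :: "('h :: ab_group_add, 'n) gwdata \<Rightarrow> (nat \<Rightarrow> 'h \<Rightarrow> 'h) \<Rightarrow> nat \<Rightarrow> nat \<Rightarrow> 'h \<Rightarrow> 'h" where
  "ser_divpow X A n k v = scl X (1 / fact n) (ser_pow A n k v)"

lemma endo_ser_divpow:
  assumes X: "gw_space X" and A: "\<And>i. endo X (A i)"
  shows "endo X (ser_divpow X A n k)"
  by (rule endoI[OF X])
    (simp_all add: ser_divpow_def endo_simps[OF endo_ser_pow[OF X A]] scl_simps[OF X] mult.commute)

lemma ser_divpow_0: "gw_space X \<Longrightarrow> ser_divpow X A 0 k v = (if k = 0 then v else 0)"
  by (simp add: ser_divpow_def scl_simps ser_one_def)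

text \<open>The derivative of e^{sA} in s, with the factor A split off on the left or on the
  right.\<close>

lemma ser_divpow_Suc:
  assumes X: "gw_space X" and A: "\<And>i. endo X (A i)"
  shows "scl X (of_nat (Suc n)) (ser_divpow X A (Suc n) k v) = (\<Sum>i\<le>k. A i (ser_divpow X A n (k - i) v))"
    and "scl X (of_nat (Suc n)) (ser_divpow X A (Suc n) k v) = (\<Sum>i\<le>k. ser_divpow X A n (k - i) (A i v))"
proof -
  have c: "of_nat (Suc n) * (1 / fact (Suc n)) = (1 / fact n :: complex)"
    by (simp add: field_simps del: of_nat_Suc)
  show "scl X (of_nat (Suc n)) (ser_divpow X A (Suc n) k v) = (\<Sum>i\<le>k. A i (ser_divpow X A n (k - i) v))"
    unfolding ser_divpow_def scl_simps(3)[OF X] c ser_pow_Suc ser_mult_def scl_sum[OF X] endo_simps[OF A] ..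
  have "(\<Sum>i\<le>k. ser_pow A n (k - i) (A i v)) = (\<Sum>i\<le>k. ser_pow A n i (A (k - i) v))"
    by (rule sum.reindex_bij_witness[where i = "\<lambda>i. k - i" and j = "\<lambda>i. k - i"]) auto
  then show "scl X (of_nat (Suc n)) (ser_divpow X A (Suc n) k v) = (\<Sum>i\<le>k. ser_divpow X A n (k - i) (A i v))"
    unfolding ser_divpow_def scl_simps(3)[OF X] c ser_pow_Suc_right[OF X A] ser_mult_def scl_sum[OF X, symmetric]
    by simp
qed

lemma ser_divpow_eq_0:
  assumes X: "gw_space X" and A: "skew_series X A" and "k < n"
  shows "ser_divpow X A n k v = 0"
proof -
  have e: "endo X (A i)" and A0: "A 0 v = 0" for i v using A by (auto simp: skew_series_def)
  have "ser_pow A n k v = 0" by (rule ser_pow_eq_0[of X A, OF e A0 assms(3)])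
  then show ?thesis by (simp add: ser_divpow_def scl_simps[OF X])
qed

lemma ser_exp_eq:
  assumes X: "gw_space X" and A: "skew_series X A" and "k \<le> N"
  shows "ser_exp X A k v = (\<Sum>n\<le>N. ser_divpow X A n k v)"
proof -
  have "ser_exp X A k v = (\<Sum>n\<le>k. ser_divpow X A n k v)"
    by (simp add: ser_exp_def ser_divpow_def ser_pow_def)
  also have "\<dots> = (\<Sum>n\<le>N. ser_divpow X A n k v)"
    using assms(3) by (intro sum.mono_neutral_left) (auto simp: ser_divpow_eq_0[OF X A])
  finally show ?thesis .
qed

lemma endo_ser_exp:
  assumes X: "gw_space X" and A: "skew_series X A"
  shows "endo X (ser_exp X A k)"
proof -
  have e: "endo X (A i)" for i using A by (simp add: skew_series_def)
  show ?thesis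
    by (rule endoI[OF X])
      (simp_all add: ser_exp_eq[OF X A order_refl] endo_simps[OF endo_ser_divpow[OF X e]] sum.distrib scl_sum[OF X])
qed

lemma ser_exp_0:
  assumes X: "gw_space X" and A: "skew_series X A"
  shows "ser_exp X A 0 v = v"
  by (simp add: ser_exp_eq[OF X A order_refl] ser_divpow_0[OF X])

text \<open>The coefficient of $s^n z^{-k} w^{-l}$ in $(e^{sA(z)}x, e^{sA(w)}y)$.\<close>

definition exp_pair :: "('h :: ab_group_add, 'n) gwdata \<Rightarrow> (nat \<Rightarrow> 'h \<Rightarrow> 'h) \<Rightarrow> nat \<Rightarrow> nat \<Rightarrow> nat \<Rightarrow>
    'h \<Rightarrow> 'h \<Rightarrow> complex" where
  "exp_pair X A n k l x y = (\<Sum>i\<le>n. pair X (ser_divpow X A i k x) (ser_divpow X A (n - i) l y))"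

lemma exp_pair_0: "gw_space X \<Longrightarrow> exp_pair X A 0 k l x y = (if k = 0 \<and> l = 0 then pair X x y else 0)"
  by (simp add: exp_pair_def ser_divpow_0 pair_left_simps pair_right_simps)

lemma exp_pair_eq_0:
  assumes X: "gw_space X" and A: "skew_series X A" and "k + l < n"
  shows "exp_pair X A n k l x y = 0"
  unfolding exp_pair_def
proof (intro sum.neutral ballI)
  fix i assume "i \<in> {..n}"
  then have "k < i \<or> l < n - i" using assms(3) by auto
  then show "pair X (ser_divpow X A i k x) (ser_divpow X A (n - i) l y) = 0"
    by (auto simp: ser_divpow_eq_0[OF X A] pair_left_simps[OF X] pair_right_simps[OF X])
qed

lemma sum_exp_pair:
  assumes X: "gw_space X" and A: "skew_series X A" and N: "k + l \<le> N"
  shows "(\<Sum>n\<le>N. exp_pair X A n k l x y) = pair X (ser_exp X A k x) (ser_exp X A l y)"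
proof -
  let ?H = "\<lambda>i j. pair X (ser_divpow X A i k x) (ser_divpow X A j l y)"
  have H0: "?H i j = 0" if "i > k \<or> j > l" for i j
    using that by (auto simp: ser_divpow_eq_0[OF X A] pair_left_simps[OF X] pair_right_simps[OF X])
  have "(\<Sum>n\<le>N. exp_pair X A n k l x y) = (\<Sum>i\<le>k. \<Sum>j\<le>l. ?H i j)"
    unfolding exp_pair_def by (rule sum_triangle_eq_rectangle[OF H0 N])
  also have "\<dots> = pair X (ser_exp X A k x) (ser_exp X A l y)"
    unfolding ser_exp_eq[OF X A order_refl] pair_sum_left[OF X]
    unfolding pair_sum_right[OF X] ..
  finally show ?thesis .
qed

text \<open>The s-derivative of the pairing: writing n+1 as i + (n+1-i) distributes it over the two
  exponentials.\<close>

lemma exp_pair_Suc: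
  assumes X: "gw_space X" and A: "skew_series X A"
  shows "of_nat (Suc n) * exp_pair X A (Suc n) k l x y =
    (\<Sum>r\<le>k. exp_pair X A n (k - r) l (A r x) y) + (\<Sum>r\<le>l. exp_pair X A n k (l - r) x (A r y))"
proof -
  let ?d = "ser_divpow X A"
  have e: "endo X (A i)" for i using A by (simp add: skew_series_def)
  have L: "of_nat (Suc i) * pair X (?d (Suc i) k x) u = (\<Sum>r\<le>k. pair X (?d i (k - r) (A r x)) u)" for i u
    unfolding pair_left_simps(2)[OF X, symmetric] ser_divpow_Suc(2)[OF X e] pair_sum_left[OF X] ..
  have R: "of_nat (Suc i) * pair X u (?d (Suc i) l y) = (\<Sum>r\<le>l. pair X u (?d i (l - r) (A r y)))" for i u
    unfolding pair_right_simps(2)[OF X, symmetric] ser_divpow_Suc(2)[OF X e] pair_sum_right[OF X] ..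
  have "of_nat (Suc n) * exp_pair X A (Suc n) k l x y =
      (\<Sum>i\<le>Suc n. of_nat i * pair X (?d i k x) (?d (Suc n - i) l y)) +
      (\<Sum>i\<le>Suc n. of_nat (Suc n - i) * pair X (?d i k x) (?d (Suc n - i) l y))"
    unfolding exp_pair_def sum.distrib[symmetric] distrib_right[symmetric] of_nat_add[symmetric] sum_distrib_left
    by (intro sum.cong refl) (simp del: of_nat_Suc)
  also have "(\<Sum>i\<le>Suc n. of_nat i * pair X (?d i k x) (?d (Suc n - i) l y)) =
      (\<Sum>i\<le>n. \<Sum>r\<le>k. pair X (?d i (k - r) (A r x)) (?d (n - i) l y))"
    by (subst sum.atMost_Suc_shift) (simp add: L del: of_nat_Suc)
  also have "\<dots> = (\<Sum>r\<le>k. exp_pair X A n (k - r) l (A r x) y)"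
    unfolding exp_pair_def by (rule sum.swap)
  also have "(\<Sum>i\<le>Suc n. of_nat (Suc n - i) * pair X (?d i k x) (?d (Suc n - i) l y)) =
      (\<Sum>i\<le>n. of_nat (Suc (n - i)) * pair X (?d i k x) (?d (Suc (n - i)) l y))"
    by (subst sum.atMost_Suc, simp only: diff_self_eq_0 of_nat_0 mult_zero_left add_0_right,
        intro sum.cong refl) (simp only: atMost_iff Suc_diff_le)
  also have "\<dots> = (\<Sum>i\<le>n. \<Sum>r\<le>l. pair X (?d i k x) (?d (n - i) (l - r) (A r y)))"
    by (simp only: R)
  also have "\<dots> = (\<Sum>r\<le>l. exp_pair X A n k (l - r) x (A r y))"
    unfolding exp_pair_def by (rule sum.swap)
  finally show ?thesis .
qed

text \<open>The coefficients of $e^{sA(z)}$ in the identity $(e^{sA(-z)})^* e^{sA(z)} = \mathrm{Id}$.\<close>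

lemma exp_pair_symplectic:
  assumes X: "gw_space X" and A: "skew_series X A"
  shows "(\<Sum>j\<le>m. (- 1) ^ j * exp_pair X A n (m - j) j x y) = (if n = 0 \<and> m = 0 then pair X x y else 0)"
proof (induction n arbitrary: m x y)
  case 0
  have "(\<Sum>j\<le>m. (- 1) ^ j * exp_pair X A 0 (m - j) j x y) = (\<Sum>j\<le>m. if j = 0 then if m = 0 then pair X x y else 0 else 0)"
    by (intro sum.cong refl) (auto simp: exp_pair_0[OF X])
  then show ?case by simp
next
  case (Suc n)
  let ?Z = "\<lambda>n m x y. \<Sum>j\<le>m. (- 1) ^ j * exp_pair X A n (m - j) j x y :: complex"
  have "of_nat (Suc n) * ?Z (Suc n) m x y =
      (\<Sum>j\<le>m. (- 1) ^ j * (of_nat (Suc n) * exp_pair X A (Suc n) (m - j) j x y))"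
    by (simp only: sum_distrib_left mult.left_commute)
  also have "\<dots> = (\<Sum>j\<le>m. \<Sum>r\<le>m - j. (- 1) ^ j * exp_pair X A n (m - j - r) j (A r x) y) +
      (\<Sum>j\<le>m. \<Sum>r\<le>j. (- 1) ^ j * exp_pair X A n (m - j) (j - r) x (A r y))"
    unfolding exp_pair_Suc[OF X A] distrib_left sum.distrib sum_distrib_left ..
  also have "(\<Sum>j\<le>m. \<Sum>r\<le>m - j. (- 1) ^ j * exp_pair X A n (m - j - r) j (A r x) y) =
      (\<Sum>r\<le>m. ?Z n (m - r) (A r x) y)"
    by (subst sum_triangle_swap) (simp add: diff_diff_left add.commute)
  also have "(\<Sum>j\<le>m. \<Sum>r\<le>j. (- 1) ^ j * exp_pair X A n (m - j) (j - r) x (A r y)) =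
      (\<Sum>r\<le>m. \<Sum>j\<le>m - r. (- 1) ^ (r + j) * exp_pair X A n (m - r - j) j x (A r y))"
    unfolding sum_triangle by (intro sum.cong refl) auto
  also have "\<dots> = (\<Sum>r\<le>m. (- 1) ^ r * ?Z n (m - r) x (A r y))"
    by (simp add: sum_distrib_left power_add mult.assoc)
  \<comment> \<open>By induction only n = 0 and r = m can contribute, and there the skewness of
    \<open>A\<close> cancels the two terms.\<close>
  also have "(\<Sum>r\<le>m. ?Z n (m - r) (A r x) y) + \<dots> = 0"
  proof (cases "n = 0")
    case True
    have "(\<Sum>r\<le>m. ?Z n (m - r) (A r x) y) = (\<Sum>r\<le>m. if r = m then pair X (A m x) y else 0)"
      unfolding Suc.IH by (intro sum.cong refl) (auto simp: True)
    moreover have "(\<Sum>r\<le>m. (- 1) ^ r * ?Z n (m - r) x (A r y)) =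
        (\<Sum>r\<le>m. if r = m then (- 1) ^ m * pair X x (A m y) else 0)"
      unfolding Suc.IH by (intro sum.cong refl) (auto simp: True)
    moreover have "pair X (A m x) y = - ((- 1) ^ m * pair X x (A m y))"
      using A by (simp add: skew_series_def)
    ultimately show ?thesis by simp
  next
    case False
    then show ?thesis unfolding Suc.IH by simp
  qed
  finally show ?case by (simp del: of_nat_Suc)
qed

text \<open>The coefficient of $s^n w^{-k} z^{-l}$ in
  $((e^{sA(w)}x, e^{sA(z)}y) - (x, y)) / (w^{-1} + z^{-1})$.\<close>

definition quad_coeff :: "('h :: ab_group_add, 'n) gwdata \<Rightarrow> (nat \<Rightarrow> 'h \<Rightarrow> 'h) \<Rightarrow> nat \<Rightarrow> nat \<Rightarrow> nat \<Rightarrow>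
    'h \<Rightarrow> 'h \<Rightarrow> complex" where
  "quad_coeff X A n k l x y = (\<Sum>j\<le>k. (- 1) ^ j * exp_pair X A n (k - j) (l + 1 + j) x y)"

lemma quad_coeff_0: "gw_space X \<Longrightarrow> quad_coeff X A 0 k l x y = 0"
  by (simp add: quad_coeff_def exp_pair_0)

lemma quad_coeff_eq_0:
  assumes "gw_space X" "skew_series X A" "k + l + 1 < n"
  shows "quad_coeff X A n k l x y = 0"
  unfolding quad_coeff_def using assms by (intro sum.neutral ballI) (simp add: exp_pair_eq_0)

text \<open>\<open>A\<close> acts on either argument. On the second one, the shifts with r > l go
  beyond the range of the form; together they make up symplectic sums, which vanish except for the
  source term at n = 0.\<close>

lemma quad_coeff_Suc:
  assumes X: "gw_space X" and A: "skew_series X A"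
  shows "of_nat (Suc n) * quad_coeff X A (Suc n) k l x y =
    (\<Sum>r\<le>k. quad_coeff X A n (k - r) l (A r x) y) + (\<Sum>r\<le>l. quad_coeff X A n k (l - r) x (A r y))
    + (if n = 0 then (- 1) ^ k * pair X x (A (k + l + 1) y) else 0)"
proof -
  have "of_nat (Suc n) * quad_coeff X A (Suc n) k l x y =
      (\<Sum>j\<le>k. (- 1) ^ j * (of_nat (Suc n) * exp_pair X A (Suc n) (k - j) (l + 1 + j) x y))"
    unfolding quad_coeff_def by (simp only: sum_distrib_left mult.left_commute)
  also have "\<dots> = (\<Sum>j\<le>k. \<Sum>r\<le>k - j. (- 1) ^ j * exp_pair X A n (k - j - r) (l + 1 + j) (A r x) y) +
      (\<Sum>j\<le>k. \<Sum>r\<le>l + 1 + j. (- 1) ^ j * exp_pair X A n (k - j) (l + 1 + j - r) x (A r y))"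
    unfolding exp_pair_Suc[OF X A] distrib_left sum.distrib sum_distrib_left ..
  also have "(\<Sum>j\<le>k. \<Sum>r\<le>k - j. (- 1) ^ j * exp_pair X A n (k - j - r) (l + 1 + j) (A r x) y) =
      (\<Sum>r\<le>k. quad_coeff X A n (k - r) l (A r x) y)"
    unfolding quad_coeff_def by (subst sum_triangle_swap) (simp add: diff_diff_left add.commute)
  also have "(\<Sum>j\<le>k. \<Sum>r\<le>l + 1 + j. (- 1) ^ j * exp_pair X A n (k - j) (l + 1 + j - r) x (A r y)) =
      (\<Sum>j\<le>k. (\<Sum>r\<le>l. (- 1) ^ j * exp_pair X A n (k - j) (l - r + 1 + j) x (A r y))
        + (\<Sum>r\<le>j. (- 1) ^ j * exp_pair X A n (k - j) (j - r) x (A (l + 1 + r) y)))"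
  proof (rule sum.cong)
    fix j
    let ?f = "\<lambda>r. (- 1) ^ j * exp_pair X A n (k - j) (l + 1 + j - r) x (A r y) :: complex"
    have "(\<Sum>r\<le>l + 1 + j. ?f r) = (\<Sum>r\<le>l. ?f r) + (\<Sum>r\<in>{l + 1..l + 1 + j}. ?f r)"
    proof -
      have "{..l + 1 + j} = {..l} \<union> {l + 1..l + 1 + j}" by auto
      then show ?thesis by (simp only: sum.union_disjoint[of "{..l}" "{l + 1..l + 1 + j}"] finite_atMost
            finite_atLeastAtMost) (subst sum.union_disjoint, auto)
    qed
    also have "(\<Sum>r\<in>{l + 1..l + 1 + j}. ?f r) = (\<Sum>r\<le>j. ?f (l + 1 + r))"
      by (rule sum.reindex_bij_witness[where i = "\<lambda>r. l + 1 + r" and j = "\<lambda>r. r - (l + 1)"]) auto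
    finally show "(\<Sum>r\<le>l + 1 + j. ?f r) = (\<Sum>r\<le>l. (- 1) ^ j * exp_pair X A n (k - j) (l - r + 1 + j) x (A r y))
        + (\<Sum>r\<le>j. (- 1) ^ j * exp_pair X A n (k - j) (j - r) x (A (l + 1 + r) y))"
      by (simp add: Suc_diff_le)
  qed simp
  also have "\<dots> = (\<Sum>r\<le>l. quad_coeff X A n k (l - r) x (A r y)) +
      (\<Sum>j\<le>k. \<Sum>r\<le>j. (- 1) ^ j * exp_pair X A n (k - j) (j - r) x (A (l + 1 + r) y))"
    unfolding quad_coeff_def sum.distrib by (rule arg_cong2[where f = "(+)"], rule sum.swap, rule refl)
  also have "(\<Sum>j\<le>k. \<Sum>r\<le>j. (- 1) ^ j * exp_pair X A n (k - j) (j - r) x (A (l + 1 + r) y)) =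
      (\<Sum>r\<le>k. \<Sum>j\<le>k - r. (- 1) ^ (r + j) * exp_pair X A n (k - r - j) j x (A (l + 1 + r) y))"
    unfolding sum_triangle by (intro sum.cong refl) auto
  also have "\<dots> = (\<Sum>r\<le>k. (- 1) ^ r * (\<Sum>j\<le>k - r. (- 1) ^ j * exp_pair X A n (k - r - j) j x (A (l + 1 + r) y)))"
    by (simp add: sum_distrib_left power_add mult.assoc)
  also have "\<dots> = (\<Sum>r\<le>k. if r = k then if n = 0 then (- 1) ^ k * pair X x (A (k + l + 1) y) else 0 else 0)"
    unfolding exp_pair_symplectic[OF X A] by (intro sum.cong refl) (auto simp: add_ac)
  finally show ?thesis by (simp add: add.assoc)
qed

text \<open>The definition treats the two indices differently. Symmetry is propagated by the
  recursion in n, whose source term is symmetric because \<open>A\<close> is skew.\<close>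

lemma quad_coeff_sym:
  assumes X: "gw_space X" and A: "skew_series X A"
  shows "quad_coeff X A n k l x y = quad_coeff X A n l k y x"
proof (induction n arbitrary: k l x y)
  case 0
  show ?case by (simp add: quad_coeff_0[OF X])
next
  case (Suc n)
  have "(- 1) ^ k * pair X x (A (k + l + 1) y) = (- 1) ^ l * pair X y (A (l + k + 1) x)"
  proof -
    have "pair X y (A (l + k + 1) x) = (- 1) ^ Suc (l + k + 1) * pair X x (A (l + k + 1) y)"
      using A by (subst pair_commute[OF X]) (simp add: skew_series_def)
    then show ?thesis
      by (simp add: power_add add.commute[of k l] mult.assoc[symmetric] power_mult_distrib[symmetric])
  qed
  then have "of_nat (Suc n) * quad_coeff X A (Suc n) k l x y = of_nat (Suc n) * quad_coeff X A (Suc n) l k y x"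
    unfolding quad_coeff_Suc[OF X A] by (simp add: Suc.IH[of l] Suc.IH[of _ k])
  then show ?case by (simp del: of_nat_Suc)
qed

lemma sum_quad_coeff:
  assumes X: "gw_space X" and A: "skew_series X A" and N: "k + l + 1 \<le> N"
  shows "(\<Sum>n\<le>N. quad_coeff X A n k l x y) =
    (\<Sum>j\<le>k. (- 1) ^ j * pair X (ser_exp X A (k - j) x) (ser_exp X A (l + 1 + j) y))"
proof -
  have "(\<Sum>n\<le>N. quad_coeff X A n k l x y) = (\<Sum>j\<le>k. (- 1) ^ j * (\<Sum>n\<le>N. exp_pair X A n (k - j) (l + 1 + j) x y))"
    unfolding quad_coeff_def sum_distrib_left by (rule sum.swap)
  also have "\<dots> = (\<Sum>j\<le>k. (- 1) ^ j * pair X (ser_exp X A (k - j) x) (ser_exp X A (l + 1 + j) y))"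
    using N by (intro sum.cong refl) (simp add: sum_exp_pair[OF X A])
  finally show ?thesis .
qed

lemma ser_exp_symplectic:
  assumes X: "gw_space X" and A: "skew_series X A"
  shows "(\<Sum>j\<le>m. (- 1) ^ j * pair X (ser_exp X A (m - j) x) (ser_exp X A j y)) = (if m = 0 then pair X x y else 0)"
proof -
  have "(\<Sum>j\<le>m. (- 1) ^ j * pair X (ser_exp X A (m - j) x) (ser_exp X A j y)) =
      (\<Sum>j\<le>m. (- 1) ^ j * (\<Sum>n\<le>m. exp_pair X A n (m - j) j x y))"
    by (intro sum.cong refl) (simp add: sum_exp_pair[OF X A])
  also have "\<dots> = (\<Sum>n\<le>m. \<Sum>j\<le>m. (- 1) ^ j * exp_pair X A n (m - j) j x y)"
    unfolding sum_distrib_left by (rule sum.swap)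
  also have "\<dots> = (\<Sum>n\<le>m. if n = 0 then if m = 0 then pair X x y else 0 else 0)"
    unfolding exp_pair_symplectic[OF X A] by (intro sum.cong refl) auto
  finally show ?thesis by simp
qed

text \<open>The adjoint of e^{-A(z)} is e^{A(-z)}: skewness moves one factor at a time across the
  form.\<close>

lemma pair_ser_exp_uminus:
  assumes X: "gw_space X" and A: "skew_series X A"
  shows "pair X (ser_exp X (\<lambda>i v. - A i v) k x) y = (- 1) ^ k * pair X x (ser_exp X A k y)"
proof -
  let ?B = "\<lambda>i v. - A i v"
  have eA: "endo X (A i)" for i using A by (simp add: skew_series_def)
  have B: "skew_series X ?B" by (rule skew_series_uminus[OF X A])
  have eB: "endo X (?B i)" for i using B by (simp add: skew_series_def)
  have "pair X (ser_divpow X ?B n k x) y = (- 1) ^ k * pair X x (ser_divpow X A n k y)" for n k x y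
  proof (induction n arbitrary: k x y)
    case 0
    show ?case by (simp add: ser_divpow_0[OF X] pair_left_simps[OF X] pair_right_simps[OF X])
  next
    case (Suc n)
    have "of_nat (Suc n) * pair X (ser_divpow X ?B (Suc n) k x) y =
        (\<Sum>i\<le>k. pair X (ser_divpow X ?B n (k - i) (?B i x)) y)"
      unfolding pair_left_simps(2)[OF X, symmetric] ser_divpow_Suc(2)[OF X eB] pair_sum_left[OF X] ..
    also have "\<dots> = (\<Sum>i\<le>k. (- 1) ^ k * pair X x (A i (ser_divpow X A n (k - i) y)))"
    proof (intro sum.cong refl)
      fix i assume "i \<in> {..k}"
      then have "(- 1) ^ k = ((- 1) ^ (k - i) * (- 1) ^ i :: complex)" by (simp add: power_add[symmetric])
      moreover have "pair X (A i x) u = - ((- 1) ^ i * pair X x (A i u))" for u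
        using A by (simp add: skew_series_def)
      ultimately show "pair X (ser_divpow X ?B n (k - i) (?B i x)) y =
          (- 1) ^ k * pair X x (A i (ser_divpow X A n (k - i) y))"
        unfolding Suc.IH by (simp add: pair_left_simps[OF X])
    qed
    also have "\<dots> = of_nat (Suc n) * ((- 1) ^ k * pair X x (ser_divpow X A (Suc n) k y))"
    proof -
      have "of_nat (Suc n) * pair X x (ser_divpow X A (Suc n) k y) =
          (\<Sum>i\<le>k. pair X x (A i (ser_divpow X A n (k - i) y)))"
        unfolding pair_right_simps(2)[OF X, symmetric] ser_divpow_Suc(1)[OF X eA] pair_sum_right[OF X] ..
      then show ?thesis by (simp only: mult.left_commute[of "of_nat (Suc n)"] sum_distrib_left)
    qed
    finally show ?case by (simp del: of_nat_Suc)
  qed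
  then show ?thesis
    by (simp add: ser_exp_eq[OF X A order_refl] ser_exp_eq[OF X B order_refl] pair_sum_left[OF X]
        pair_sum_right[OF X] sum_distrib_left)
qed

text \<open>Move one factor across the form in the symplectic identity for e^{-A}.\<close>

lemma ser_exp_mult_uminus:
  assumes X: "gw_space X" and A: "skew_series X A"
  shows "ser_mult (ser_exp X A) (ser_exp X (\<lambda>i v. - A i v)) = ser_one"
proof (intro ext)
  fix m y
  let ?B = "\<lambda>i v. - A i v"
  have B: "skew_series X ?B" by (rule skew_series_uminus[OF X A])
  show "ser_mult (ser_exp X A) (ser_exp X ?B) m y = ser_one m y"
  proof (rule pair_eqI[OF X])
    fix x
    have "(- 1) ^ m * pair X x (ser_mult (ser_exp X A) (ser_exp X ?B) m y)
        = (\<Sum>i\<le>m. (- 1) ^ m * pair X x (ser_exp X A i (ser_exp X ?B (m - i) y)))"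
      by (simp add: ser_mult_def pair_sum_right[OF X] sum_distrib_left)
    also have "\<dots> = (\<Sum>j\<le>m. (- 1) ^ m * pair X x (ser_exp X A (m - j) (ser_exp X ?B j y)))"
      by (rule sum.reindex_bij_witness[where i = "\<lambda>j. m - j" and j = "\<lambda>j. m - j"]) auto
    also have "\<dots> = (\<Sum>j\<le>m. (- 1) ^ j * pair X (ser_exp X ?B (m - j) x) (ser_exp X ?B j y))"
    proof (intro sum.cong refl)
      fix j assume "j \<in> {..m}"
      then have "(- 1) ^ m = ((- 1) ^ j * (- 1) ^ (m - j) :: complex)" by (simp add: power_add[symmetric])
      then show "(- 1) ^ m * pair X x (ser_exp X A (m - j) (ser_exp X ?B j y)) =
          (- 1) ^ j * pair X (ser_exp X ?B (m - j) x) (ser_exp X ?B j y)"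
        by (simp add: pair_ser_exp_uminus[OF X A])
    qed
    also have "\<dots> = (- 1) ^ m * pair X x (ser_one m y)"
      unfolding ser_exp_symplectic[OF X B] by (simp add: ser_one_def pair_right_simps[OF X])
    finally show "pair X (ser_mult (ser_exp X A) (ser_exp X ?B) m y) x = pair X (ser_one m y) x"
      by (simp add: pair_commute[OF X, of _ x])
  qed
qed

lemma ser_inv_ser_exp:
  assumes X: "gw_space X" and A: "skew_series X A"
  shows "ser_inv (ser_exp X A) = ser_exp X (\<lambda>i v. - A i v)"
proof (rule ser_inv_eqI)
  let ?B = "\<lambda>i v. - A i v"
  have B: "skew_series X ?B" by (rule skew_series_uminus[OF X A])
  show "endo X (ser_exp X A i)" "endo X (ser_exp X ?B i)" for i
    by (rule endo_ser_exp[OF X A] endo_ser_exp[OF X B])+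
  show "ser_mult (ser_exp X A) (ser_exp X ?B) = ser_one" by (rule ser_exp_mult_uminus[OF X A])
  show "ser_mult (ser_exp X ?B) (ser_exp X A) = ser_one" using ser_exp_mult_uminus[OF X B] by simp
qed

text \<open>The matrix of q(z) -> [A(z)q(z)]_+ in the q-coordinates, with \<open>u\<close> the
  target and \<open>v\<close> the source.\<close>

definition opmat :: "('h :: ab_group_add, 'n :: finite) gwdata \<Rightarrow> (nat \<Rightarrow> 'h \<Rightarrow> 'h) \<Rightarrow>
    'n var \<Rightarrow> 'n var \<Rightarrow> complex" where
  "opmat X A u v = (if fst u \<le> fst v then pair X (cobas X (snd u)) (A (fst v - fst u) (bas X (snd v))) else 0)"

lemma lowering_opmat: "lowering (opmat X A)"
  by (simp add: lowering_def opmat_def)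

lemma sum_vars:
  fixes f :: "('n :: finite) var \<Rightarrow> 'b :: comm_monoid_add"
  shows "(\<Sum>u\<in>vars K. f u) = (\<Sum>m\<le>K. \<Sum>\<beta>\<in>UNIV. f (m, \<beta>))"
proof -
  have "vars K = {..K} \<times> (UNIV :: 'n set)" by (auto simp: vars_def)
  then show ?thesis by (simp add: sum.cartesian_product)
qed

text \<open>Truncation is multiplicative here, since \<open>A\<close> never lifts back a negative
  power of z produced by \<open>B\<close>.\<close>

lemma opmat_mult:
  assumes X: "gw_space X" and A: "\<And>i. endo X (A i)" and K: "fst w \<le> K"
  shows "(\<Sum>u\<in>vars K. opmat X A v u * opmat X B u w) = opmat X (ser_mult A B) v w"
proof (cases "fst v \<le> fst w")
  case True
  let ?c = "pair X (cobas X (snd v))"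
  have "(\<Sum>\<beta>\<in>UNIV. opmat X A v (m, \<beta>) * opmat X B (m, \<beta>) w) =
      (if fst v \<le> m \<and> m \<le> fst w then ?c (A (m - fst v) (B (fst w - m) (bas X (snd w)))) else 0)" for m
  proof (cases "fst v \<le> m \<and> m \<le> fst w")
    case True
    then show ?thesis
      by (simp add: opmat_def pair_endo_expansion[OF X A, of _ "m - fst v" "B (fst w - m) (bas X (snd w))"] mult.commute)
  qed (auto simp: opmat_def)
  then have "(\<Sum>u\<in>vars K. opmat X A v u * opmat X B u w) =
      (\<Sum>m\<le>K. if fst v \<le> m \<and> m \<le> fst w then ?c (A (m - fst v) (B (fst w - m) (bas X (snd w)))) else 0)"
    by (simp add: sum_vars)
  also have "\<dots> = (\<Sum>m\<in>{fst v..fst w}. ?c (A (m - fst v) (B (fst w - m) (bas X (snd w)))))"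
    using K by (intro sum.mono_neutral_cong_right) auto
  also have "\<dots> = (\<Sum>i\<le>fst w - fst v. ?c (A i (B (fst w - fst v - i) (bas X (snd w)))))"
    by (rule sum.reindex_bij_witness[where i = "\<lambda>i. i + fst v" and j = "\<lambda>m. m - fst v"])
      (use True in auto)
  finally show ?thesis using True by (simp add: opmat_def ser_mult_def pair_sum_right[OF X])
next
  case False
  then show ?thesis by (auto simp: opmat_def intro!: sum.neutral)
qed

lemma opmat_ser_one:
  assumes X: "gw_space X"
  shows "opmat X ser_one v w = (if v = w then 1 else 0)"
  by (auto simp: opmat_def ser_one_def pair_cobas_bas[OF X] pair_right_simps[OF X] prod_eq_iff)

lemma hpow_opmat:
  assumes X: "gw_space X" and A: "\<And>i. endo X (A i)"
  shows "hpow (opmat X A) n v w = opmat X (ser_pow A n) v w"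
proof (induction n arbitrary: v w)
  case 0
  show ?case by (simp add: opmat_ser_one[OF X])
next
  case (Suc n)
  then show ?case
    by (simp add: ser_pow_Suc_right[OF X A] opmat_mult[OF X endo_ser_pow[OF X A] order_refl])
qed

lemma hexp_opmat:
  assumes X: "gw_space X" and A: "skew_series X A"
  shows "hexp (opmat X A) v w = opmat X (ser_exp X A) v w"
proof -
  have e: "endo X (A i)" for i using A by (simp add: skew_series_def)
  show ?thesis
    by (simp add: hexp_def hpow_opmat[OF X e] opmat_def ser_exp_eq[OF X A, of "fst w - fst v" "fst w"]
        ser_divpow_def pair_sum_right[OF X] pair_right_simps[OF X])
qed

section \<open>Hamiltonians and Darboux coordinates\<close>

lemma minus_one_powi_minus: "((- 1) powi (- 1 - int l) :: complex) = (- 1) ^ Suc l"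
proof -
  have "((- 1) powi (- 1 - int l) :: complex) = inverse ((- 1) powi int (Suc l))"
    by (subst power_int_minus[symmetric]) simp
  then show ?thesis by (simp add: power_int_of_nat del: of_nat_Suc flip: power_inverse)
qed

lemma act_monomial:
  assumes A: "\<And>i. endo X (A i)"
  shows "act A (\<lambda>k. if k = N then x else 0) k = (if k \<le> N then A (nat (N - k)) x else 0)"
proof -
  have "act A (\<lambda>k. if k = N then x else 0) k = (\<Sum>i\<in>{nat (N - k)}. A i (if k + int i = N then x else 0))"
    unfolding act_def by (rule Sum_any.expand_superset) (auto simp: endo_simps[OF A])
  then show ?thesis by (auto simp: endo_simps[OF A])
qed

lemma Omega_monomial:
  assumes X: "gw_space X"
  shows "Omega X f (\<lambda>k. if k = M then y else 0) = (- 1) powi (- 1 - M) * pair X (f (- 1 - M)) y"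
proof -
  have "Omega X f (\<lambda>k. if k = M then y else 0) =
      (\<Sum>k\<in>{- 1 - M}. (- 1) powi k * pair X (f k) (if - 1 - k = M then y else 0))"
    unfolding Omega_def by (rule Sum_any.expand_superset) (auto simp: pair_right_simps[OF X])
  then show ?thesis by simp
qed

lemma qbas_eq: "qbas X (n, \<alpha>) = (\<lambda>k. if k = int n then bas X \<alpha> else 0)"
  by (simp add: qbas_def)

lemma pbas_eq: "pbas X (n, \<alpha>) = (\<lambda>k. if k = - int n - 1 then scl X ((- 1) ^ (n + 1)) (cobas X \<alpha>) else 0)"
  by (simp add: pbas_def)

lemma ham2_monomials:
  assumes X: "gw_space X" and A: "\<And>i. endo X (a i)"
  shows "ham2 X a (\<lambda>k. if k = N then x else 0) (\<lambda>k. if k = M then y else 0) =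
    (if - 1 - M \<le> N then (- 1) powi (- 1 - M) * pair X (a (nat (N + M + 1)) x) y / 2 else 0)"
  by (simp add: ham2_def Omega_monomial[OF X] act_monomial[OF A] pair_left_simps[OF X] algebra_simps)

text \<open>\<open>a\<close> keeps negative powers of z negative, and the residue pairing of two
  series in negative powers is zero.\<close>

lemma ham2_pp:
  assumes X: "gw_space X" and a: "skew_series X a"
  shows "ham2 X a (pbas X u) (pbas X v) = 0"
proof -
  have A: "\<And>i. endo X (a i)" using a by (simp add: skew_series_def)
  obtain m \<beta> n \<alpha> where "u = (m, \<beta>)" "v = (n, \<alpha>)" by (cases u, cases v)
  then show ?thesis by (simp add: pbas_eq ham2_monomials[OF X A])
qed

lemma ham2_qq:
  assumes X: "gw_space X" and a: "skew_series X a"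
  shows "ham2 X a (qbas X u) (qbas X v) =
    (- 1) ^ fst u * pair X (bas X (snd u)) (- a (fst u + fst v + 1) (bas X (snd v))) / 2"
proof -
  have A: "\<And>i. endo X (a i)" using a by (simp add: skew_series_def)
  obtain k \<alpha> l \<beta> where uv: "u = (k, \<alpha>)" "v = (l, \<beta>)" by (cases u, cases v)
  have n: "nat (int k + int l + 1) = k + l + 1" by simp
  have "ham2 X a (qbas X u) (qbas X v) =
      (- 1) ^ Suc l * pair X (a (k + l + 1) (bas X \<alpha>)) (bas X \<beta>) / 2"
    unfolding uv qbas_eq ham2_monomials[OF X A] minus_one_powi_minus n by simp
  also have "pair X (a (k + l + 1) (bas X \<alpha>)) (bas X \<beta>) =
      (- 1) ^ Suc (k + l + 1) * pair X (bas X \<alpha>) (a (k + l + 1) (bas X \<beta>))"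
    using a by (simp only: skew_series_def)
  finally show ?thesis
    by (simp add: uv pair_right_simps[OF X] power_add mult.assoc[symmetric] power_mult_distrib[symmetric])
qed

text \<open>The two orders of the arguments contribute equally because \<open>a\<close> is
  infinitesimally symplectic; this cancels the 1/2 in the Hamiltonian and leaves the field q ->
  -[aq]_+.\<close>

lemma ham2_pq:
  assumes X: "gw_space X" and a: "skew_series X a"
  shows "ham2 X a (pbas X u) (qbas X v) + ham2 X a (qbas X v) (pbas X u) = opmat X (\<lambda>i v. - a i v) u v"
proof -
  have A: "\<And>i. endo X (a i)" using a by (simp add: skew_series_def)
  obtain m \<beta> n \<alpha> where uv: "u = (m, \<beta>)" "v = (n, \<alpha>)" by (cases u, cases v)
  show ?thesis
  proof (cases "m \<le> n")
    case True
    let ?p = "pair X (cobas X \<beta>) (a (n - m) (bas X \<alpha>))"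
    have skew: "pair X (a i x) y = (- 1) ^ Suc i * pair X x (a i y)" for i x y
      using a by (simp only: skew_series_def)
    have nat: "nat (- int m - 1 + int n + 1) = n - m" "nat (int n + (- int m - 1) + 1) = n - m"
      using True by auto
    have "ham2 X a (pbas X u) (qbas X v) =
        (- 1) ^ Suc n * pair X (a (n - m) (scl X ((- 1) ^ (m + 1)) (cobas X \<beta>))) (bas X \<alpha>) / 2"
      unfolding uv qbas_eq pbas_eq ham2_monomials[OF X A] minus_one_powi_minus nat using True by simp
    also have "\<dots> = (- 1) ^ (n + 1 + (m + 1) + (n - m + 1)) * ?p / 2"
      unfolding skew by (simp add: pair_left_simps[OF X] power_add)
    also have "\<dots> = - ?p / 2"
    proof -
      \<comment> \<open>An odd exponent: residue, basis and skewness signs multiply to -1.\<close>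
      have "n + 1 + (m + 1) + (n - m + 1) = 2 * n + 3" using True by simp
      then show ?thesis by (simp only: power_add power_mult) simp
    qed
    finally have 1: "ham2 X a (pbas X u) (qbas X v) = - ?p / 2" .
    have "- 1 - (- int m - 1) = int m" by simp
    then have "ham2 X a (qbas X v) (pbas X u) =
        (- 1) powi int m * pair X (a (n - m) (bas X \<alpha>)) (scl X ((- 1) ^ (m + 1)) (cobas X \<beta>)) / 2"
      unfolding uv qbas_eq pbas_eq ham2_monomials[OF X A] nat using True by simp
    also have "\<dots> = (- 1) ^ (m + (m + 1)) * ?p / 2"
      by (simp add: pair_right_simps[OF X] pair_commute[OF X, of "a (n - m) (bas X \<alpha>)"] power_add power_int_of_nat)
    also have "\<dots> = - ?p / 2"
    proof -
      have "m + (m + 1) = 2 * m + 1" by simp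
      then show ?thesis by (simp only: power_add power_mult) simp
    qed
    finally show ?thesis using 1 True by (simp add: uv opmat_def pair_right_simps[OF X])
  next
    case False
    then show ?thesis by (simp add: uv qbas_eq pbas_eq ham2_monomials[OF X A] opmat_def)
  qed
qed

section \<open>The action on the loop space in Darboux coordinates\<close>

lemma HH_bound:
  assumes "f \<in> HH"
  obtains K :: nat where "\<And>k. k > int K \<Longrightarrow> f k = 0"
proof -
  obtain K where K: "\<forall>k>K. f k = 0" using assms by (auto simp: HH_def)
  then have "f k = 0" if "k > int (nat K)" for k using that by (auto split: if_splits)
  then show thesis by (rule that)
qed

lemma act_eq_sum:
  assumes A: "\<And>i. endo X (A i)" and f: "\<And>k. k > int K \<Longrightarrow> f k = 0" and N: "k + int N \<ge> int K"
  shows "act A f k = (\<Sum>i\<le>N. A i (f (k + int i)))"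
  unfolding act_def
proof (rule Sum_any.expand_superset)
  show "{i. A i (f (k + int i)) \<noteq> 0} \<subseteq> {..N}"
  proof
    fix i assume "i \<in> {i. A i (f (k + int i)) \<noteq> 0}"
    then have "f (k + int i) \<noteq> 0" by (auto simp: endo_simps[OF A])
    then have "k + int i \<le> int K" using f by (meson not_le)
    then show "i \<in> {..N}" using N by auto
  qed
qed simp

lemma act_bound:
  assumes A: "\<And>i. endo X (A i)" and f: "\<And>k. k > int K \<Longrightarrow> f k = 0" and k: "k > int K"
  shows "act A f k = 0"
  using act_eq_sum[of X A K f k 0, OF A f] k by (simp add: f endo_simps[OF A])

lemma act_HH: "(\<And>i. endo X (A i)) \<Longrightarrow> f \<in> HH \<Longrightarrow> act A f \<in> HH"
  by (rule HH_bound[of f]) (auto simp: HH_def intro!: act_bound)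

lemma act_ser_mult:
  assumes A: "\<And>i. endo X (A i)" and B: "\<And>i. endo X (B i)" and AB: "\<And>i. endo X (ser_mult A B i)"
    and f: "f \<in> HH"
  shows "act A (act B f) = act (ser_mult A B) f"
proof
  fix k
  obtain K where K: "\<And>k. k > int K \<Longrightarrow> f k = 0" using HH_bound[OF f] by blast
  define N where "N = nat (int K - k)"
  have "act A (act B f) k = (\<Sum>i\<le>N. A i (act B f (k + int i)))"
    by (rule act_eq_sum[where K = K, OF A act_bound[OF B K]]) (auto simp: N_def)
  also have "\<dots> = (\<Sum>i\<le>N. \<Sum>j\<le>N - i. A i (B j (f (k + int (i + j)))))"
    by (intro sum.cong refl, subst act_eq_sum[where N = "N - i" for i, OF B K]) (auto simp: N_def endo_simps[OF A] add.assoc)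
  also have "\<dots> = (\<Sum>m\<le>N. \<Sum>i\<le>m. A i (B (m - i) (f (k + int m))))"
    unfolding sum_triangle by (intro sum.cong refl) auto
  also have "\<dots> = act (ser_mult A B) f k"
    by (subst act_eq_sum[where N = N, OF AB K]) (auto simp: N_def ser_mult_def)
  finally show "act A (act B f) k = act (ser_mult A B) f k" .
qed

lemma act_ser_one: "act ser_one f = f"
proof
  fix k
  have "act ser_one f k = (\<Sum>i\<in>{0}. ser_one i (f (k + int i)))"
    unfolding act_def by (rule Sum_any.expand_superset) (auto simp: ser_one_def)
  then show "act ser_one f k = f k" by (simp add: ser_one_def)
qed

lemma qcoord_eq:
  shows "gw_space X \<Longrightarrow> qcoord X f v = pair X (cobas X (snd v)) (f (int (fst v)))"
  by (cases v) (simp add: qcoord_def coords_bas)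

lemma pcoord_eq:
  shows "gw_space X \<Longrightarrow> pcoord X f v = (- 1) ^ (fst v + 1) * pair X (bas X (snd v)) (f (- int (fst v) - 1))"
  by (cases v) (simp add: pcoord_def coords_cobas pair_right_simps)

lemma qcoord_act:
  assumes X: "gw_space X" and A: "\<And>i. endo X (A i)" and f: "\<And>k. k > int K \<Longrightarrow> f k = 0"
  shows "qcoord X (act A f) v = (\<Sum>u\<in>vars K. opmat X A v u * qcoord X f u)"
proof -
  let ?c = "pair X (cobas X (snd v))"
  have "qcoord X (act A f) v = (\<Sum>i\<le>K. ?c (A i (f (int (fst v + i)))))"
    by (subst qcoord_eq[OF X], subst act_eq_sum[of X A K f _ K, OF A f]) (auto simp: pair_sum_right[OF X])
  also have "\<dots> = (\<Sum>m\<in>{fst v..fst v + K}. ?c (A (m - fst v) (f (int m))))"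
    by (rule sum.reindex_bij_witness[where i = "\<lambda>m. m - fst v" and j = "\<lambda>i. fst v + i"]) auto
  also have "\<dots> = (\<Sum>m\<in>{..fst v + K}. if fst v \<le> m then ?c (A (m - fst v) (f (int m))) else 0)"
    by (rule sum.mono_neutral_cong_left) auto
  also have "\<dots> = (\<Sum>m\<le>K. if fst v \<le> m then ?c (A (m - fst v) (f (int m))) else 0)"
    by (rule sum.mono_neutral_right) (auto simp: f endo_simps[OF A] pair_right_simps[OF X])
  also have "\<dots> = (\<Sum>m\<le>K. \<Sum>\<beta>\<in>UNIV. opmat X A v (m, \<beta>) * qcoord X f (m, \<beta>))"
  proof (intro sum.cong refl)
    fix m
    show "(if fst v \<le> m then ?c (A (m - fst v) (f (int m))) else 0) =
        (\<Sum>\<beta>\<in>UNIV. opmat X A v (m, \<beta>) * qcoord X f (m, \<beta>))"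
      using pair_endo_expansion[OF X A, of "cobas X (snd v)" "m - fst v" "f (int m)"]
      by (simp add: opmat_def qcoord_eq[OF X] mult.commute)
  qed
  finally show ?thesis by (simp add: sum_vars)
qed

definition quad_mat :: "('h :: ab_group_add, 'n) gwdata \<Rightarrow> (nat \<Rightarrow> 'h \<Rightarrow> 'h) \<Rightarrow> nat \<Rightarrow>
    'n var \<Rightarrow> 'n var \<Rightarrow> complex" where
  "quad_mat X A n u v = quad_coeff X A n (fst u) (fst v) (bas X (snd u)) (bas X (snd v))"

text \<open>The value at s = 1, because higher powers of s do not occur at these indices.\<close>

definition quad_total :: "('h :: ab_group_add, 'n) gwdata \<Rightarrow> (nat \<Rightarrow> 'h \<Rightarrow> 'h) \<Rightarrow>
    'n var \<Rightarrow> 'n var \<Rightarrow> complex" where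
  "quad_total X A u v = (\<Sum>n\<le>fst u + fst v + 1. quad_mat X A n u v)"

lemma quad_mat_0: "gw_space X \<Longrightarrow> quad_mat X A 0 u v = 0"
  by (simp add: quad_mat_def quad_coeff_0)

lemma quad_mat_sym: "gw_space X \<Longrightarrow> skew_series X A \<Longrightarrow> quad_mat X A n u v = quad_mat X A n v u"
  unfolding quad_mat_def by (rule quad_coeff_sym)

lemma quad_total_sym: "gw_space X \<Longrightarrow> skew_series X A \<Longrightarrow> quad_total X A u v = quad_total X A v u"
  by (simp only: quad_total_def quad_mat_sym[of X A _ u v] add.commute[of "fst u" "fst v"])

lemma quad_mat_sums:
  assumes "gw_space X" "skew_series X A"
  shows "(\<lambda>n. quad_mat X A n u v) sums quad_total X A u v"
  unfolding quad_total_def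
  by (rule sums_finite) (auto simp: quad_mat_def quad_coeff_eq_0[OF assms])

lemma quad_total_eq:
  assumes "gw_space X" "skew_series X A"
  shows "quad_total X A u v = (\<Sum>j\<le>fst u. (- 1) ^ j *
    pair X (ser_exp X A (fst u - j) (bas X (snd u))) (ser_exp X A (fst v + 1 + j) (bas X (snd v))))"
  unfolding quad_total_def quad_mat_def by (rule sum_quad_coeff[OF assms order_refl])

lemma exp_pair_expansion:
  assumes X: "gw_space X" and A: "skew_series X A"
  shows "exp_pair X A n k l x y = (\<Sum>\<beta>\<in>UNIV. pair X (cobas X \<beta>) x * exp_pair X A n k l (bas X \<beta>) y)"
    and "exp_pair X A n k l x y = (\<Sum>\<beta>\<in>UNIV. pair X (cobas X \<beta>) y * exp_pair X A n k l x (bas X \<beta>))"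
proof -
  have e: "endo X (A i)" for i using A by (simp add: skew_series_def)
  have *: "pair X w (ser_divpow X A i k x) =
      (\<Sum>\<beta>\<in>UNIV. pair X (cobas X \<beta>) x * pair X w (ser_divpow X A i k (bas X \<beta>)))" for w i k x
    by (rule pair_endo_expansion[OF X endo_ser_divpow[OF X e]])
  have **: "pair X (ser_divpow X A i k x) w =
      (\<Sum>\<beta>\<in>UNIV. pair X (cobas X \<beta>) x * pair X (ser_divpow X A i k (bas X \<beta>)) w)" for w i k x
    unfolding pair_commute[OF X, of _ w] by (rule * )
  have "exp_pair X A n k l x y = (\<Sum>i\<le>n. \<Sum>\<beta>\<in>UNIV. pair X (cobas X \<beta>) x *
      pair X (ser_divpow X A i k (bas X \<beta>)) (ser_divpow X A (n - i) l y))"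
    unfolding exp_pair_def by (intro sum.cong refl **)
  then show "exp_pair X A n k l x y = (\<Sum>\<beta>\<in>UNIV. pair X (cobas X \<beta>) x * exp_pair X A n k l (bas X \<beta>) y)"
    unfolding exp_pair_def sum_distrib_left by (simp only: sum.swap[of _ UNIV])
  have "exp_pair X A n k l x y = (\<Sum>i\<le>n. \<Sum>\<beta>\<in>UNIV. pair X (cobas X \<beta>) y *
      pair X (ser_divpow X A i k x) (ser_divpow X A (n - i) l (bas X \<beta>)))"
    unfolding exp_pair_def by (intro sum.cong refl *)
  then show "exp_pair X A n k l x y = (\<Sum>\<beta>\<in>UNIV. pair X (cobas X \<beta>) y * exp_pair X A n k l x (bas X \<beta>))"
    unfolding exp_pair_def sum_distrib_left by (simp only: sum.swap[of _ UNIV])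
qed

lemma quad_coeff_expansion:
  assumes X: "gw_space X" and A: "skew_series X A"
  shows "quad_coeff X A n k l x y = (\<Sum>\<beta>\<in>UNIV. pair X (cobas X \<beta>) x * quad_coeff X A n k l (bas X \<beta>) y)"
    and "quad_coeff X A n k l x y = (\<Sum>\<beta>\<in>UNIV. pair X (cobas X \<beta>) y * quad_coeff X A n k l x (bas X \<beta>))"
proof -
  note * = exp_pair_expansion(1)[OF X A, of n _ _ x] and ** = exp_pair_expansion(2)[OF X A, of n _ _ x y]
  have "quad_coeff X A n k l x y = (\<Sum>j\<le>k. (- 1) ^ j *
      (\<Sum>\<beta>\<in>UNIV. pair X (cobas X \<beta>) x * exp_pair X A n (k - j) (l + 1 + j) (bas X \<beta>) y))"
    unfolding quad_coeff_def by (intro sum.cong refl arg_cong2[where f = times] *)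
  then show "quad_coeff X A n k l x y = (\<Sum>\<beta>\<in>UNIV. pair X (cobas X \<beta>) x * quad_coeff X A n k l (bas X \<beta>) y)"
    unfolding quad_coeff_def sum_distrib_left mult.left_commute[of "(- 1) ^ _"]
    by (simp only: sum.swap[of _ UNIV])
  have "quad_coeff X A n k l x y = (\<Sum>j\<le>k. (- 1) ^ j *
      (\<Sum>\<beta>\<in>UNIV. pair X (cobas X \<beta>) y * exp_pair X A n (k - j) (l + 1 + j) x (bas X \<beta>)))"
    unfolding quad_coeff_def by (intro sum.cong refl arg_cong2[where f = times] **)
  then show "quad_coeff X A n k l x y = (\<Sum>\<beta>\<in>UNIV. pair X (cobas X \<beta>) y * quad_coeff X A n k l x (bas X \<beta>))"
    unfolding quad_coeff_def sum_distrib_left mult.left_commute[of "(- 1) ^ _"]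
    by (simp only: sum.swap[of _ UNIV])
qed

lemma quad_mat_Suc:
  assumes X: "gw_space X" and A: "skew_series X A"
  shows "of_nat (Suc n) * quad_mat X A (Suc n) u v =
    (\<Sum>w\<in>vars (fst u). opmat X A w u * quad_mat X A n w v)
    + (\<Sum>w\<in>vars (fst v). quad_mat X A n u w * opmat X A w v)
    + (if n = 0 then (- 1) ^ fst u * pair X (bas X (snd u)) (A (fst u + fst v + 1) (bas X (snd v))) else 0)"
proof -
  obtain k \<alpha> l \<beta> where uv: "u = (k, \<alpha>)" "v = (l, \<beta>)" by (cases u, cases v)
  have rev: "(\<Sum>r\<le>k. f r) = (\<Sum>m\<le>k. f (k - m))" for f :: "nat \<Rightarrow> complex" and k
    by (rule sum.reindex_bij_witness[where i = "\<lambda>m. k - m" and j = "\<lambda>m. k - m"]) auto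
  have 1: "(\<Sum>r\<le>k. quad_coeff X A n (k - r) l (A r (bas X \<alpha>)) (bas X \<beta>)) =
      (\<Sum>w\<in>vars k. opmat X A w u * quad_mat X A n w v)"
    unfolding sum_vars
    by (subst rev, intro sum.cong refl, subst quad_coeff_expansion(1)[OF X A]) (simp add: opmat_def quad_mat_def uv)
  have 2: "(\<Sum>r\<le>l. quad_coeff X A n k (l - r) (bas X \<alpha>) (A r (bas X \<beta>))) =
      (\<Sum>w\<in>vars l. quad_mat X A n u w * opmat X A w v)"
    unfolding sum_vars
    by (subst rev, intro sum.cong refl, subst quad_coeff_expansion(2)[OF X A]) (simp add: opmat_def quad_mat_def uv mult.commute)
  show ?thesis
    unfolding quad_mat_def[of X A "Suc n"] quad_coeff_Suc[OF X A] using 1 2 by (simp add: uv)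
qed

text \<open>In row 0 the alternating sum has a single term, and e^A starts with the identity. The
  topological recursion relation rests on this row.\<close>

lemma quad_total_zero_row:
  assumes X: "gw_space X" and A: "skew_series X A"
  shows "quad_total X A (0, \<mu>) (k, \<alpha>) = pair X (bas X \<mu>) (ser_exp X A (Suc k) (bas X \<alpha>))"
  by (simp add: quad_total_eq[OF X A] ser_exp_0[OF X A])

text \<open>The shape is that of the chain rule: transposed Jacobian plus quadratic term. The
  symplectic identity recovers the negative part of \<open>g\<close> from that of e^A g; what the
  non-negative part of \<open>g\<close> leaks into negative powers is compensated by the quadratic
  form.\<close>

lemma pcoord_act_inverse:
  assumes X: "gw_space X" and A: "skew_series X A" and g: "\<And>k. k > int K \<Longrightarrow> g k = 0"
  shows "pcoord X g u = (\<Sum>v\<in>vars (fst u). opmat X (ser_exp X A) v u * pcoord X (act (ser_exp X A) g) v)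
    + (\<Sum>v\<in>vars K. quad_total X A u v * qcoord X g v)"
proof -
  let ?S = "ser_exp X A"
  have e: "endo X (?S i)" for i by (rule endo_ser_exp[OF X A])
  obtain k \<alpha> where u: "u = (k, \<alpha>)" by (cases u)
  let ?x = "bas X \<alpha>"
  \<comment> \<open>Split by the origin of the terms: negative powers of \<open>g\<close> first,
    then non-negative ones.\<close>
  have dec: "act ?S g (- int j - 1) = (\<Sum>i\<le>j. ?S i (g (- int (j - i) - 1))) + (\<Sum>l\<le>K. ?S (l + 1 + j) (g (int l)))"
    if "j \<le> k" for j
  proof -
    have "act ?S g (- int j - 1) = (\<Sum>i\<le>j + (K + 1). ?S i (g (- int j - 1 + int i)))"
      by (rule act_eq_sum[OF e g]) auto
    also have "{..j + (K + 1)} = {..j} \<union> {j + 1..j + 1 + K}" by auto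
    also have "(\<Sum>i\<in>{..j} \<union> {j + 1..j + 1 + K}. ?S i (g (- int j - 1 + int i))) =
        (\<Sum>i\<le>j. ?S i (g (- int j - 1 + int i))) + (\<Sum>i\<in>{j + 1..j + 1 + K}. ?S i (g (- int j - 1 + int i)))"
      by (rule sum.union_disjoint) auto
    also have "(\<Sum>i\<in>{j + 1..j + 1 + K}. ?S i (g (- int j - 1 + int i))) = (\<Sum>l\<le>K. ?S (l + 1 + j) (g (int l)))"
      by (rule sum.reindex_bij_witness[where i = "\<lambda>l. l + 1 + j" and j = "\<lambda>i. i - (j + 1)"]) (auto simp: algebra_simps)
    also have "(\<Sum>i\<le>j. ?S i (g (- int j - 1 + int i))) = (\<Sum>i\<le>j. ?S i (g (- int (j - i) - 1)))"
      by (intro sum.cong refl arg_cong[where f = "?S _"] arg_cong[where f = g]) (auto simp: algebra_simps)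
    finally show ?thesis .
  qed
  have "(\<Sum>v\<in>vars k. opmat X ?S v u * pcoord X (act ?S g) v) =
      (\<Sum>j\<le>k. (- 1) ^ (j + 1) * pair X (?S (k - j) ?x) (act ?S g (- int j - 1)))"
    unfolding sum_vars
  proof (intro sum.cong refl)
    fix j assume "j \<in> {..k}"
    then have "(\<Sum>\<beta>\<in>UNIV. opmat X ?S (j, \<beta>) u * pcoord X (act ?S g) (j, \<beta>)) =
        (- 1) ^ (j + 1) * (\<Sum>\<beta>\<in>UNIV. pair X (cobas X \<beta>) (?S (k - j) ?x) * pair X (bas X \<beta>) (act ?S g (- int j - 1)))"
      by (simp add: opmat_def u pcoord_eq[OF X] sum_distrib_left mult.left_commute sum_negf)
    then show "(\<Sum>\<beta>\<in>UNIV. opmat X ?S (j, \<beta>) u * pcoord X (act ?S g) (j, \<beta>)) =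
        (- 1) ^ (j + 1) * pair X (?S (k - j) ?x) (act ?S g (- int j - 1))"
      by (simp only: sum_coords_pair[OF X])
  qed
  also have "\<dots> = (\<Sum>j\<le>k. \<Sum>i\<le>j. (- 1) ^ (j + 1) * pair X (?S (k - j) ?x) (?S i (g (- int (j - i) - 1))))
      + (\<Sum>j\<le>k. \<Sum>l\<le>K. (- 1) ^ (j + 1) * pair X (?S (k - j) ?x) (?S (l + 1 + j) (g (int l))))"
    unfolding sum.distrib[symmetric]
    by (intro sum.cong refl)
      (simp only: dec atMost_iff pair_right_simps[OF X] pair_sum_right[OF X] distrib_left sum_distrib_left)
  also have "(\<Sum>j\<le>k. \<Sum>i\<le>j. (- 1) ^ (j + 1) * pair X (?S (k - j) ?x) (?S i (g (- int (j - i) - 1)))) =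
      (\<Sum>l\<le>k. \<Sum>i\<le>k - l. (- 1) ^ (i + l + 1) * pair X (?S (k - l - i) ?x) (?S i (g (- int l - 1))))"
  proof -
    let ?G = "\<lambda>l i. (- 1) ^ (i + l + 1) * pair X (?S (k - l - i) ?x) (?S i (g (- int l - 1))) :: complex"
    have "(\<Sum>l\<le>k. \<Sum>i\<le>k - l. ?G l i) = (\<Sum>i\<le>k. \<Sum>l\<le>k - i. ?G l i)"
      by (rule sum_triangle_swap)
    also have "\<dots> = (\<Sum>j\<le>k. \<Sum>i\<le>j. ?G (j - i) i)"
      by (rule sum_triangle)
    finally show ?thesis by (auto intro!: sum.cong)
  qed
  also have "\<dots> = (\<Sum>l\<le>k. (- 1) ^ (l + 1) * (\<Sum>i\<le>k - l. (- 1) ^ i * pair X (?S (k - l - i) ?x) (?S i (g (- int l - 1)))))"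
    unfolding sum_distrib_left by (intro sum.cong refl) (simp add: power_add)
  also have "\<dots> = (\<Sum>l\<le>k. if l = k then (- 1) ^ (k + 1) * pair X ?x (g (- int k - 1)) else 0)"
    unfolding ser_exp_symplectic[OF X A] by (intro sum.cong refl) auto
  also have "\<dots> = pcoord X g u" by (simp add: pcoord_eq[OF X] u)
  also have "(\<Sum>j\<le>k. \<Sum>l\<le>K. (- 1) ^ (j + 1) * pair X (?S (k - j) ?x) (?S (l + 1 + j) (g (int l)))) =
      - (\<Sum>v\<in>vars K. quad_total X A u v * qcoord X g v)"
  proof -
    have "(\<Sum>v\<in>vars K. quad_total X A u v * qcoord X g v) =
        (\<Sum>l\<le>K. \<Sum>j\<le>k. (- 1) ^ j * pair X (?S (k - j) ?x) (?S (l + 1 + j) (g (int l))))"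
      unfolding sum_vars
    proof (intro sum.cong refl)
      fix l
      have "(\<Sum>\<beta>\<in>UNIV. quad_total X A u (l, \<beta>) * qcoord X g (l, \<beta>)) =
          (\<Sum>j\<le>k. (- 1) ^ j * (\<Sum>\<beta>\<in>UNIV. pair X (cobas X \<beta>) (g (int l)) *
            pair X (?S (k - j) ?x) (?S (l + 1 + j) (bas X \<beta>))))"
        unfolding quad_total_eq[OF X A] sum_distrib_right sum_distrib_left
        by (subst sum.swap) (simp add: u qcoord_eq[OF X] mult_ac)
      then show "(\<Sum>\<beta>\<in>UNIV. quad_total X A u (l, \<beta>) * qcoord X g (l, \<beta>)) =
          (\<Sum>j\<le>k. (- 1) ^ j * pair X (?S (k - j) ?x) (?S (l + 1 + j) (g (int l))))"
        by (simp only: pair_endo_expansion[OF X e, symmetric])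
    qed
    then show ?thesis by (subst sum.swap) (simp add: sum_negf)
  qed
  finally show ?thesis by (simp add: u)
qed

lemma ser_exp_1:
  assumes X: "gw_space X" and A: "skew_series X A"
  shows "ser_exp X A (Suc 0) v = A (Suc 0) v"
proof -
  have e: "endo X (A i)" for i using A by (simp add: skew_series_def)
  have "ser_exp X A (Suc 0) v = ser_divpow X A 1 (Suc 0) v"
    by (simp add: ser_exp_eq[OF X A order_refl] ser_divpow_0[OF X])
  also have "\<dots> = A (Suc 0) v"
    using ser_divpow_Suc(1)[OF X e, where n = 0 and k = "Suc 0" and v = v]
    by (simp add: ser_divpow_0[OF X] scl_simps[OF X] endo_simps[OF e])
  finally show ?thesis .
qed

text \<open>The right-hand side is the t-value of the image of t = 0, that is, of q(z) = -z1. It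
  sits in index 0, where the coefficient of e^A involved is A_1.\<close>

lemma translation_vec_opmat:
  assumes X: "gw_space X" and A: "skew_series X A"
  shows "translation_vec X (opmat X A) v =
    (if v = (1, unit_ix X) then 1 else 0) - opmat X (ser_exp X A) v (1, unit_ix X)"
proof -
  obtain n \<alpha> where v: "v = (n, \<alpha>)" by (cases v)
  consider "n = 0" | "n = 1" | "n > 1" by linarith
  then show ?thesis
    by cases (auto simp: v translation_vec_def opmat_def ser_exp_1[OF X A] ser_exp_0[OF X A] pair_cobas_bas[OF X])
qed

lemma mcoeff_tparam:
  fixes X :: "('h :: ab_group_add, 'n :: finite) gwdata"
  shows "mcoeff (tparam X f v) \<mu> = qcoord X (f \<mu>) v + (if \<mu> = {#} \<and> v = (1, unit_ix X) then 1 else 0)"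
  by (simp add: tparam_def mcoeff_mconst)

lemma change_of_vars_eq:
  fixes X :: "('h :: ab_group_add, 'n :: finite) gwdata"
  assumes X: "gw_space X" and A: "skew_series X A"
  shows "tparam X (\<lambda>\<mu>. act (ser_exp X A) (generic_q X \<mu>)) v =
    linser (opmat X (ser_exp X A) v) + mconst (translation_vec X (opmat X A) v)"
proof (rule mfps_eqI)
  fix \<mu> :: "'n var multiset"
  have e: "endo X (ser_exp X A i)" for i by (rule endo_ser_exp[OF X A])
  let ?e = "(1, unit_ix X)"
  have q: "qcoord X (act (ser_exp X A) (qbas X w)) v = opmat X (ser_exp X A) v w" for w
    by (cases w) (auto simp: qbas_eq act_monomial[OF e] qcoord_eq[OF X] opmat_def pair_right_simps[OF X] nat_diff_distrib')
  have neg: "- qbas X ?e k = (if k = 1 then - bas X (unit_ix X) else 0)" for k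
    by (simp add: qbas_eq)
  have q': "qcoord X (act (ser_exp X A) (\<lambda>k. - qbas X ?e k)) v = - opmat X (ser_exp X A) v ?e"
    unfolding neg
    by (auto simp: act_monomial[OF e] qcoord_eq[OF X] opmat_def pair_right_simps[OF X] nat_diff_distrib'
        endo_simps[OF e])
  show "mcoeff (tparam X (\<lambda>\<mu>. act (ser_exp X A) (generic_q X \<mu>)) v) \<mu> =
      mcoeff (linser (opmat X (ser_exp X A) v) + mconst (translation_vec X (opmat X A) v)) \<mu>"
  proof (cases "size \<mu> = 1")
    case True
    then obtain w where "\<mu> = {#w#}" using size_1_singleton_mset by metis
    then show ?thesis by (simp add: mcoeff_tparam generic_q_def q mcoeff_mconst)
  next
    case size: False
    show ?thesis
    proof (cases "\<mu> = {#}")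
      case True
      then show ?thesis
        by (simp add: mcoeff_tparam generic_q_def q'[simplified] translation_vec_opmat[OF X A] mcoeff_mconst)
    next
      case False
      have "generic_q X \<mu> = (\<lambda>_. 0)" using size False by (auto simp: generic_q_def)
      moreover have "act (ser_exp X A) (\<lambda>_. 0) = (\<lambda>_. 0)"
        by (rule ext) (simp add: act_def endo_simps[OF e])
      ultimately show ?thesis
        using size False by (simp add: mcoeff_tparam mcoeff_linser_eq_0 mcoeff_mconst qcoord_eq[OF X]
            pair_right_simps[OF X])
    qed
  qed
qed

text \<open>The germ condition removes the constant terms, and each coefficient of the family has
  only finitely many non-negative powers of z.\<close>

lemma formal_fam_tparam:
  fixes X :: "('h :: ab_group_add, 'n :: finite) gwdata"
  assumes X: "gw_space X" and g: "\<And>\<mu>. g \<mu> \<in> HH" "g \<in> formal_germ X"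
  shows "formal_fam (tparam X g)"
  unfolding formal_fam_def
proof (intro conjI allI)
  show "mcoeff (tparam X g v) {#} = 0" for v using g(2) unfolding formal_germ_def by blast
  fix \<mu> :: "'n var multiset"
  obtain K where K: "\<And>k. k > int K \<Longrightarrow> g \<mu> k = 0" using HH_bound[OF g(1)] by blast
  have "{v. mcoeff (tparam X g v) \<mu> \<noteq> 0} \<subseteq> vars (max 1 K)"
  proof
    fix v assume "v \<in> {v. mcoeff (tparam X g v) \<mu> \<noteq> 0}"
    then have "qcoord X (g \<mu>) v \<noteq> 0 \<or> v = (1, unit_ix X)" by (auto simp: mcoeff_tparam split: if_splits)
    then show "v \<in> vars (max 1 K)"
      using K[of "int (fst v)"] by (auto simp: qcoord_eq[OF X] pair_right_simps[OF X] not_le intro: ccontr)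
  qed
  then show "finite {v. mcoeff (tparam X g v) \<mu> \<noteq> 0}" by (rule finite_subset) simp
qed

text \<open>Acting on a family of points amounts to substituting it into the affine change of
  variables; this links the cones with the chain rule.\<close>

lemma tparam_act:
  fixes X :: "('h :: ab_group_add, 'n :: finite) gwdata"
  assumes X: "gw_space X" and A: "skew_series X A" and g: "\<And>\<mu>. g \<mu> \<in> HH" "g \<in> formal_germ X"
  shows "tparam X (\<lambda>\<mu>. act (ser_exp X A) (g \<mu>)) v =
    subst (linser (opmat X (ser_exp X A) v) + mconst (translation_vec X (opmat X A) v)) (tparam X g)"
proof (rule mfps_eqI)
  fix \<mu> :: "'n var multiset"
  let ?P = "opmat X (ser_exp X A)" and ?e = "(1, unit_ix X)"
  have e: "endo X (ser_exp X A i)" for i by (rule endo_ser_exp[OF X A])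
  note ff = formal_fam_tparam[OF X g]
  obtain K' where K': "\<And>k. k > int K' \<Longrightarrow> g \<mu> k = 0" using HH_bound[OF g(1)] by blast
  define K where "K = max 1 K'"
  have K: "g \<mu> k = 0" if "k > int K" for k using K'[of k] that by (simp add: K_def)
  have "mcoeff (subst (linser (?P v)) (tparam X g)) \<mu> = (\<Sum>u\<in>vars K. ?P v u * mcoeff (tparam X g u) \<mu>)"
  proof (rule subst_linser)
    fix u :: "'n var" assume "u \<notin> vars K"
    then have "g \<mu> (int (fst u)) = 0" "u \<noteq> ?e" by (auto intro!: K simp: K_def)
    then show "mcoeff (tparam X g u) \<mu> = 0"
      by (simp add: mcoeff_tparam qcoord_eq[OF X] pair_right_simps[OF X])
  qed simp
  also have "\<dots> = (\<Sum>u\<in>vars K. ?P v u * qcoord X (g \<mu>) u) + (\<Sum>u\<in>vars K. if u = ?e then if \<mu> = {#} then ?P v ?e else 0 else 0)"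
    unfolding sum.distrib[symmetric] by (intro sum.cong refl) (auto simp: mcoeff_tparam ring_distribs)
  also have "\<dots> = qcoord X (act (ser_exp X A) (g \<mu>)) v + (if \<mu> = {#} then ?P v ?e else 0)"
    by (simp add: qcoord_act[OF X e K] K_def)
  finally show "mcoeff (tparam X (\<lambda>\<mu>. act (ser_exp X A) (g \<mu>)) v) \<mu> =
      mcoeff (subst (linser (?P v) + mconst (translation_vec X (opmat X A) v)) (tparam X g)) \<mu>"
    by (simp add: subst_add subst_defined_formal[OF ff] subst_mconst mcoeff_mconst mcoeff_tparam
        translation_vec_opmat[OF X A])
qed

section \<open>The quantized action\<close>

text \<open>The linear form with coefficients \<open>l\<close> in the dilaton-shifted coordinates q,
  expressed in t.\<close>

definition qlin :: "('h, 'n) gwdata \<Rightarrow> ('n var \<Rightarrow> complex) \<Rightarrow> 'n tser" where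
  "qlin X l = linser l - mconst (l (1, unit_ix X))"

lemma agree_qlin:
  fixes X :: "('h, 'n :: finite) gwdata"
  assumes K: "K \<ge> 1"
  shows "agree K (qlin X l) (\<Sum>v\<in>vars K. mconst (l v) * qvar X v)"
  unfolding agree_def
proof (intro allI impI)
  fix m :: "'n var multiset" assume m: "\<forall>v\<in>#m. fst v \<le> K"
  have eq: "mcoeff (\<Sum>v\<in>vars K. mconst (l v) * qvar X v) m =
      (\<Sum>v\<in>vars K. if m = {#v#} then l v else 0) - (\<Sum>v\<in>vars K. if v = (1, unit_ix X) then if m = {#} then l v else 0 else 0)"
    unfolding mcoeff_sum sum_subtractf[symmetric]
    by (intro sum.cong refl) (simp add: qvar_def mcoeff_mvar mcoeff_mconst)
  show "mcoeff (qlin X l) m = mcoeff (\<Sum>v\<in>vars K. mconst (l v) * qvar X v) m"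
  proof (cases "size m = 1")
    case True
    then obtain w where "m = {#w#}" using size_1_singleton_mset by metis
    then show ?thesis using K m unfolding eq by (simp add: qlin_def mcoeff_mconst)
  next
    case False
    then have "m \<noteq> {#v#}" for v by auto
    then show ?thesis using K False unfolding eq by (simp add: qlin_def mcoeff_mconst mcoeff_linser_eq_0)
  qed
qed

lemma mderiv_qlin: "mderiv u (qlin X l) = mconst (l u)"
  by (simp add: qlin_def mderiv_diff mderiv_linser)

lemma mderiv_qform_upto:
  fixes X :: "('h, 'n :: finite) gwdata" and B :: "'n var \<Rightarrow> 'n var \<Rightarrow> 'a :: comm_ring_1"
  assumes "fst u \<le> K"
  shows "mderiv u (\<Sum>w\<in>vars K. \<Sum>x\<in>vars K. mconst (B w x) * qvar X w * qvar X x) =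
    (\<Sum>x\<in>vars K. mconst (B u x) * qvar X x) + (\<Sum>w\<in>vars K. mconst (B w u) * qvar X w)"
proof -
  have "mderiv u (\<Sum>w\<in>vars K. \<Sum>x\<in>vars K. mconst (B w x) * qvar X w * qvar X x) =
      (\<Sum>w\<in>vars K. \<Sum>x\<in>vars K. if w = u then mconst (B u x) * qvar X x else 0)
      + (\<Sum>w\<in>vars K. \<Sum>x\<in>vars K. if x = u then mconst (B w u) * qvar X w else 0)"
    unfolding mderiv_sum sum.distrib[symmetric]
    by (intro sum.cong refl) (auto simp: mderiv_mult mderiv_qvar)
  also have "(\<Sum>w\<in>vars K. \<Sum>x\<in>vars K. if w = u then mconst (B u x) * qvar X x else 0) =
      (\<Sum>x\<in>vars K. mconst (B u x) * qvar X x)"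
    using assms by (subst sum.swap) simp
  also have "(\<Sum>w\<in>vars K. \<Sum>x\<in>vars K. if x = u then mconst (B w u) * qvar X w else 0) =
      (\<Sum>w\<in>vars K. mconst (B w u) * qvar X w)"
    using assms by simp
  finally show ?thesis .
qed

lemma mderiv_qform:
  fixes X :: "('h, 'n :: finite) gwdata"
  shows "mderiv u (qform X B) = qlin X (\<lambda>v. B u v + B v u)"
proof (rule agree_imp_eq)
  fix K assume K: "K \<ge> max 1 (fst u)"
  have "agree K (mderiv u (qform X B))
      (mderiv u (\<Sum>w\<in>vars K. \<Sum>x\<in>vars K. mconst (B w x) * qvar X w * qvar X x))"
    using K by (intro agree_mderiv agree_qform) auto
  also have "\<dots> = (\<Sum>v\<in>vars K. mconst (B u v + B v u) * qvar X v)"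
    using K by (subst mderiv_qform_upto) (auto simp: mconst_add ring_distribs sum.distrib)
  finally show "agree K (mderiv u (qform X B)) (qlin X (\<lambda>v. B u v + B v u))"
    using agree_qlin[of K X "\<lambda>v. B u v + B v u"] K by (auto intro: agree_trans agree_sym)
qed

text \<open>The Lie derivative of a quadratic form: the field acts on each of the two
  arguments.\<close>

lemma vfield_qform:
  fixes X :: "('h, 'n :: finite) gwdata" and B :: "'n var \<Rightarrow> 'n var \<Rightarrow> 'a :: comm_ring_1"
  assumes h: "lowering h"
  shows "vfield X h (qform X B) = qform X (\<lambda>u v.
    (\<Sum>w\<in>vars (fst u). h w u * B w v) + (\<Sum>w\<in>vars (fst v). B u w * h w v))"
proof (rule agree_imp_eq)
  fix K :: nat assume K: "K \<ge> 1"
  let ?S = "\<Sum>w\<in>vars K. \<Sum>x\<in>vars K. mconst (B w x) * qvar X w * qvar X x"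
  let ?B = "\<lambda>u v. (\<Sum>w\<in>vars (fst u). h w u * B w v) + (\<Sum>w\<in>vars (fst v). B u w * h w v)"
  have ext: "(\<Sum>w\<in>vars (fst u). h w u * c w) = (\<Sum>w\<in>vars K. h w u * c w)"
    "(\<Sum>w\<in>vars (fst u). c w * h w u) = (\<Sum>w\<in>vars K. c w * h w u)" if "fst u \<le> K" for u c
    using that by (auto intro!: sum.mono_neutral_left simp: loweringD[OF h] not_le)
  have "vfield_upto X h K ?S =
      (\<Sum>v\<in>vars K. \<Sum>u\<in>vars K. \<Sum>x\<in>vars K. mconst (h u v * B u x) * qvar X v * qvar X x)
      + (\<Sum>v\<in>vars K. \<Sum>u\<in>vars K. \<Sum>w\<in>vars K. mconst (B w u * h u v) * qvar X w * qvar X v)"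
    unfolding vfield_upto_def sum.distrib[symmetric]
    by (intro sum.cong refl, subst mderiv_qform_upto)
      (simp_all add: ring_distribs sum_distrib_left mconst_mult mult_ac sum.distrib)
  also have "(\<Sum>v\<in>vars K. \<Sum>u\<in>vars K. \<Sum>x\<in>vars K. mconst (h u v * B u x) * qvar X v * qvar X x) =
      (\<Sum>v\<in>vars K. \<Sum>x\<in>vars K. mconst (\<Sum>u\<in>vars K. h u v * B u x) * qvar X v * qvar X x)"
    unfolding mconst_sum sum_distrib_right by (intro sum.cong[OF refl] sum.swap)
  also have "(\<Sum>v\<in>vars K. \<Sum>u\<in>vars K. \<Sum>w\<in>vars K. mconst (B w u * h u v) * qvar X w * qvar X v) =
      (\<Sum>v\<in>vars K. \<Sum>w\<in>vars K. mconst (\<Sum>u\<in>vars K. B w u * h u v) * qvar X w * qvar X v)"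
    unfolding mconst_sum sum_distrib_right by (intro sum.cong[OF refl] sum.swap)
  also have "\<dots> = (\<Sum>w\<in>vars K. \<Sum>v\<in>vars K. mconst (\<Sum>u\<in>vars K. B w u * h u v) * qvar X w * qvar X v)"
    by (rule sum.swap)
  also have "(\<Sum>v\<in>vars K. \<Sum>x\<in>vars K. mconst (\<Sum>u\<in>vars K. h u v * B u x) * qvar X v * qvar X x) + \<dots> =
      (\<Sum>u\<in>vars K. \<Sum>v\<in>vars K. mconst (?B u v) * qvar X u * qvar X v)"
    unfolding sum.distrib[symmetric] by (intro sum.cong refl) (simp add: ext mconst_add ring_distribs)
  finally have eq: "vfield_upto X h K ?S = \<dots>" .
  show "agree K (vfield X h (qform X B)) (qform X ?B)"
    by (rule agree_trans[OF agree_vfield_cong[OF h K agree_qform[OF K]]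
          agree_eq_trans(2)[OF eq agree_sym[OF agree_qform[OF K]]]])
qed

lemma mcoeff_qform:
  fixes X :: "('h, 'n :: finite) gwdata"
  assumes "K \<ge> 1" "\<forall>v\<in>#m. fst v \<le> K"
  shows "mcoeff (qform X B) m = (\<Sum>u\<in>vars K. \<Sum>v\<in>vars K. B u v * mcoeff (qvar X u * qvar X v) m)"
  using agreeD[OF agree_qform[OF assms(1)], of m X B] assms(2)
  by (simp add: mcoeff_sum mult.assoc)

lemma qform_add:
  fixes X :: "('h, 'n :: finite) gwdata"
  shows "qform X B + qform X C = qform X (\<lambda>u v. B u v + C u v)"
proof (rule mfps_eqI)
  fix m :: "'n var multiset"
  obtain K where K: "K \<ge> 1" "\<forall>v\<in>#m. fst v \<le> K" by (rule mset_index_ball)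
  show "mcoeff (qform X B + qform X C) m = mcoeff (qform X (\<lambda>u v. B u v + C u v)) m"
    by (simp add: mcoeff_qform[OF K] sum.distrib ring_distribs)
qed

lemma qform_scale:
  fixes X :: "('h, 'n :: finite) gwdata"
  shows "mconst c * qform X B = qform X (\<lambda>u v. c * B u v)"
proof (rule mfps_eqI)
  fix m :: "'n var multiset"
  obtain K where K: "K \<ge> 1" "\<forall>v\<in>#m. fst v \<le> K" by (rule mset_index_ball)
  show "mcoeff (mconst c * qform X B) m = mcoeff (qform X (\<lambda>u v. c * B u v)) m"
    by (simp add: mcoeff_qform[OF K] sum_distrib_left mult.assoc)
qed

lemma qform_0:
  fixes X :: "('h, 'n :: finite) gwdata"
  shows "qform X (\<lambda>_ _. 0) = 0"
  using qform_scale[of 0 X "\<lambda>_ _. 0"] by simp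

lemma qform_sums:
  fixes X :: "('h, 'n :: finite) gwdata"
  assumes "\<And>u v. (\<lambda>n. B n u v :: complex) sums C u v"
  shows "(\<lambda>n. mcoeff (qform X (B n)) m) sums mcoeff (qform X C) m"
proof -
  obtain K where K: "K \<ge> 1" "\<forall>v\<in>#m. fst v \<le> K" by (rule mset_index_ball)
  show ?thesis unfolding mcoeff_qform[OF K] by (intro sums_sum sums_mult2 assms)
qed

text \<open>An output coefficient involves finitely many input coefficients. This carries linear
  equations along the flow to s = 1.\<close>

lemma vfield_sums:
  fixes X :: "('h, 'n :: finite) gwdata" and g :: "nat \<Rightarrow> 'n tser"
  assumes h: "lowering h" and g: "\<And>m. (\<lambda>n. mcoeff (g n) m) sums mcoeff G m"
  shows "(\<lambda>n. mcoeff (vfield X h (g n)) m) sums mcoeff (vfield X h G) m"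
proof -
  obtain K where K: "K \<ge> 1" "\<forall>v\<in>#m. fst v \<le> K" by (rule mset_index_ball)
  have d: "(\<lambda>n. mcoeff (mderiv u (g n)) m) sums mcoeff (mderiv u G) m" for u m
    unfolding mcoeff_mderiv by (intro sums_mult g)
  have q: "(\<lambda>n. mcoeff (qvar X v * mderiv u (g n)) m) sums mcoeff (qvar X v * mderiv u G) m" for u v
    unfolding mcoeff_qvar_mult by (intro sums_diff) (auto intro: d)
  have eq: "mcoeff (vfield X h f) m = (\<Sum>v\<in>vars K. \<Sum>u\<in>vars K. h u v * mcoeff (qvar X v * mderiv u f) m)" for f
    using agreeD[OF agree_vfield[OF h K(1)], of m X f] K(2)
    by (simp add: vfield_upto_def mcoeff_sum mult.assoc)
  show ?thesis unfolding eq by (intro sums_sum sums_mult q)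
qed

text \<open>For A = -a this is the qq-part of the Hamiltonian, the source of the flow.\<close>

definition initial_quad :: "('h :: ab_group_add, 'n) gwdata \<Rightarrow> (nat \<Rightarrow> 'h \<Rightarrow> 'h) \<Rightarrow> 'n var \<Rightarrow> 'n var \<Rightarrow> complex" where
  "initial_quad X A u v = (- 1) ^ fst u * pair X (bas X (snd u)) (A (fst u + fst v + 1) (bas X (snd v))) / 2"

lemma strictly_lowering_opmat:
  assumes "gw_space X" "skew_series X A"
  shows "strictly_lowering (opmat X A)"
  unfolding strictly_lowering_def
proof (intro allI impI)
  fix u v assume "opmat X A u v \<noteq> 0"
  moreover have "A 0 x = 0" for x using assms by (simp add: skew_series_def)
  ultimately show "fst u < fst v"
    using assms by (auto simp: opmat_def pair_right_simps le_less split: if_splits)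
qed

text \<open>Half of \<open>quad_mat\<close> solves the flow equation with the source and zero
  initial value; it is the part of the solution independent of F.\<close>

lemma quad_flow:
  assumes X: "gw_space X" and A: "skew_series X A"
  shows "mconst (of_nat (Suc n)) * qform X (\<lambda>u v. quad_mat X A (Suc n) u v / 2) =
    vfield X (opmat X A) (qform X (\<lambda>u v. quad_mat X A n u v / 2))
    + (if n = 0 then qform X (initial_quad X A) else 0)"
proof -
  have "(if n = 0 then qform X (initial_quad X A) else 0) = qform X (\<lambda>u v. if n = 0 then initial_quad X A u v else 0)"
    by (simp add: qform_0)
  moreover have "of_nat (Suc n) * (quad_mat X A (Suc n) u v / 2) =
      (\<Sum>w\<in>vars (fst u). opmat X A w u * (quad_mat X A n w v / 2))
      + (\<Sum>w\<in>vars (fst v). quad_mat X A n u w / 2 * opmat X A w v)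
      + (if n = 0 then initial_quad X A u v else 0)" for u v
    using quad_mat_Suc[OF X A, of n u v]
    by (simp add: initial_quad_def add_divide_distrib sum_divide_distrib del: of_nat_Suc)
  ultimately show ?thesis
    unfolding qform_scale vfield_qform[OF lowering_opmat] by (simp only: qform_add)
qed

text \<open>The coefficient of $s^n$ in the genus zero part of $\log(\exp(s \widehat H_a) e^{F/\hbar})$.\<close>

definition genus0_flow :: "('h :: ab_group_add, 'n :: finite) gwdata \<Rightarrow> (nat \<Rightarrow> 'h \<Rightarrow> 'h) \<Rightarrow> 'n tser \<Rightarrow>
    nat \<Rightarrow> 'n tser" where
  "genus0_flow X A F n = divpow (vfield X (opmat X A)) n F + qform X (\<lambda>u v. quad_mat X A n u v / 2)"

lemma genus0_flow_0: 
  shows "gw_space X \<Longrightarrow> genus0_flow X A F 0 = F"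
  by (simp add: genus0_flow_def quad_mat_0 qform_0)

lemma genus0_flow_Suc:
  assumes X: "gw_space X" and A: "skew_series X A"
  shows "mconst (of_nat (Suc n)) * genus0_flow X A F (Suc n) =
    vfield X (opmat X A) (genus0_flow X A F n) + (if n = 0 then qform X (initial_quad X A) else 0)"
proof -
  have "mconst (of_nat (Suc n)) * divpow (vfield X (opmat X A)) (Suc n) F =
      vfield X (opmat X A) (divpow (vfield X (opmat X A)) n F)"
    unfolding mconst_of_nat by (rule apply_divpow[symmetric]) (rule vfield_mconst_mult[OF lowering_opmat])
  then show ?thesis
    unfolding genus0_flow_def distrib_left quad_flow[OF X A] vfield_add[OF lowering_opmat]
    by (simp only: add.assoc)
qed

text \<open>q -> [e^A q]_+ in the coordinates t; for A = -a it is the change of variables induced by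
  S.\<close>

definition exp_cov :: "('h :: ab_group_add, 'n :: finite) gwdata \<Rightarrow> (nat \<Rightarrow> 'h \<Rightarrow> 'h) \<Rightarrow> 'n var \<Rightarrow> 'n tser" where
  "exp_cov X A v = linser (opmat X (ser_exp X A) v) + mconst (translation_vec X (opmat X A) v)"

lemma opmat_exp_inverse:
  assumes X: "gw_space X" and A: "skew_series X A" and "fst w \<le> K"
  shows "(\<Sum>u\<in>vars K. opmat X (ser_exp X A) v u * opmat X (ser_exp X (\<lambda>i v. - A i v)) u w) =
    (if v = w then 1 else 0)"
  by (simp add: opmat_mult[OF X endo_ser_exp[OF X A] assms(3)] ser_exp_mult_uminus[OF X A] opmat_ser_one[OF X])

lemma divpow_flow_sums:
  assumes X: "gw_space X" and A: "skew_series X A" and f: "subst_defined f (exp_cov X A)"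
  shows "(\<lambda>n. mcoeff (divpow (vfield X (opmat X A)) n f) m) sums mcoeff (subst f (exp_cov X A)) m"
proof -
  have hexp: "hexp (opmat X A) = opmat X (ser_exp X A)"
    by (intro ext) (rule hexp_opmat[OF X A])
  have exp_cov: "exp_cov X A = (\<lambda>v. linser (hexp (opmat X A) v) + mconst (translation_vec X (opmat X A) v))"
    by (rule ext) (simp add: exp_cov_def hexp)
  show ?thesis
    unfolding exp_cov
  proof (rule divpow_vfield_sums[OF strictly_lowering_opmat[OF X A]])
    show "lowering (hexp (opmat X A))" unfolding hexp by (rule lowering_opmat)
    show "lowering (opmat X (ser_exp X (\<lambda>i v. - A i v)))" by (rule lowering_opmat)
    show "(\<Sum>u\<in>vars (fst w). hexp (opmat X A) v u * opmat X (ser_exp X (\<lambda>i v. - A i v)) u w) =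
        (if v = w then 1 else 0)" for v w
      unfolding hexp by (rule opmat_exp_inverse[OF X A order_refl])
    show "subst_defined f (\<lambda>v. linser (hexp (opmat X A) v) + mconst (translation_vec X (opmat X A) v))"
      using f unfolding exp_cov .
  qed
qed

definition genus0_result :: "('h :: ab_group_add, 'n :: finite) gwdata \<Rightarrow> (nat \<Rightarrow> 'h \<Rightarrow> 'h) \<Rightarrow> 'n tser \<Rightarrow> 'n tser" where
  "genus0_result X A F = subst F (exp_cov X A) + qform X (\<lambda>u v. quad_total X A u v / 2)"

lemma genus0_flow_sums:
  assumes X: "gw_space X" and A: "skew_series X A" and F: "subst_defined F (exp_cov X A)"
  shows "(\<lambda>n. mcoeff (genus0_flow X A F n) m) sums mcoeff (genus0_result X A F) m"
  unfolding genus0_flow_def genus0_result_def mcoeff_add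
  by (intro sums_add divpow_flow_sums assms qform_sums sums_divide quad_mat_sums)

lemma hbar_comp_log_pot: "hbar_comp k (log_pot Fs) = (if k < - 1 then 0 else Fs (nat (k + 1)))"
  by (rule mfps_eqI) (simp add: log_pot_def)

text \<open>The flow equation provides one admissible W, and injectivity of the formal exponential
  excludes any other; limits at s = 1 are unique. The source has order hbar^{-1}, so positive genera
  are merely substituted.\<close>

lemma quantized_action_iff:
  assumes X: "gw_space X" and a: "skew_series X a"
    and F: "\<And>g. subst_defined (Fs g) (exp_cov X (\<lambda>i v. - a i v))"
  shows "quantized_action X a Fs Gs \<longleftrightarrow>
    Gs = (\<lambda>g. if g = 0 then genus0_result X (\<lambda>i v. - a i v) (Fs 0) else subst (Fs g) (exp_cov X (\<lambda>i v. - a i v)))"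
proof -
  define b where "b = (\<lambda>i v. - a i v)"
  have b: "skew_series X b" unfolding b_def by (rule skew_series_uminus[OF X a])
  define h where "h = opmat X b"
  define V where "V = vfield X (\<lambda>u v. fls_const (h u v))"
  define Q where "Q = hqform X (initial_quad X b)"
  define E where "E = log_pot Fs"
  have low: "lowering h" unfolding h_def by (rule lowering_opmat)
  have low': "lowering (\<lambda>u v. fls_const (h u v))" using low by (auto simp: lowering_def)
  \<comment> \<open>The power series solution of W' = VW + Q; the source is constant in s and so
    enters at n = 0 only.\<close>
  define W where "W = rec_nat E (\<lambda>n x. hscalar (1 / of_nat (Suc n)) 0 * (V x + (if n = 0 then Q else 0)))"
  have W_Suc: "W (Suc n) = hscalar (1 / of_nat (Suc n)) 0 * (V (W n) + (if n = 0 then Q else 0))" for n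
    by (simp add: W_def)
  have eq: "exp_quant X a E = fps_expo (Abs_fps W - fps_const E)"
  proof (rule exp_quant_eq_fps_expo[where V = V and Q = Q])
    show "V (x + y) = V x + V y" for x y unfolding V_def by (rule vfield_add[OF low'])
    show "V (x * y) = V x * y + x * V y" for x y unfolding V_def by (rule vfield_mult[OF low'])
    show "V (hscalar c 0) = 0" for c by (simp add: V_def hscalar_def)
    show "quant X a (exp_deriv E) P = V P + (V E + Q) * P" for P
      unfolding V_def Q_def
      by (rule quant_exp_deriv[OF ham2_pp[OF X a] _ _ low])
        (simp_all add: ham2_pq[OF X a] h_def b_def ham2_qq[OF X a] initial_quad_def)
    show "of_nat (Suc n) * Abs_fps W $ Suc n = V (Abs_fps W $ n) + (if n = 0 then Q else 0)" for n
      unfolding fps_nth_Abs_fps W_Suc by (rule of_nat_mult_hscalar) simp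
  qed (simp add: W_def)
  have comp: "hbar_comp k (W n) =
      divpow (vfield X h) n (hbar_comp k E) + (if k = - 1 then qform X (\<lambda>u v. quad_mat X b n u v / 2) else 0)"
    for k n
  proof (induction n)
    case 0
    show ?case by (simp add: W_def quad_mat_0[OF X] qform_0)
  next
    case (Suc n)
    let ?R = "\<lambda>n. divpow (vfield X h) n (hbar_comp k E) + (if k = - 1 then qform X (\<lambda>u v. quad_mat X b n u v / 2) else 0)"
    have "hbar_comp k (W (Suc n)) = mconst (1 / of_nat (Suc n)) *
        (vfield X h (?R n) + (if n = 0 \<and> k = - 1 then qform X (initial_quad X b) else 0))"
      unfolding W_Suc hbar_comp_hscalar_mult hbar_comp_add V_def Q_def
      by (simp add: hbar_comp_vfield[OF low] Suc hbar_comp_hqform del: of_nat_Suc)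
    also have "vfield X h (?R n) + (if n = 0 \<and> k = - 1 then qform X (initial_quad X b) else 0) =
        mconst (of_nat (Suc n)) * ?R (Suc n)"
    proof -
      have d: "mconst (of_nat (Suc n)) * divpow (vfield X h) (Suc n) (hbar_comp k E) =
          vfield X h (divpow (vfield X h) n (hbar_comp k E))"
        unfolding mconst_of_nat by (rule apply_divpow[symmetric]) (rule vfield_mconst_mult[OF low])
      show ?thesis
        unfolding distrib_left d vfield_add[OF low]
        using quad_flow[OF X b, of n] by (simp add: h_def del: of_nat_Suc)
    qed
    finally show ?case
      by (simp add: mult.assoc[symmetric] mconst_mult[symmetric] del: of_nat_Suc)
  qed
  have sums: "(\<lambda>n. mcoeff (W n) m $$ k) sums (mcoeff (log_pot (\<lambda>g. if g = 0 then genus0_result X b (Fs 0)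
      else subst (Fs g) (exp_cov X b))) m $$ k)" for m k
  proof -
    have "(\<lambda>n. mcoeff (hbar_comp k (W n)) m) sums mcoeff (hbar_comp k (log_pot (\<lambda>g.
        if g = 0 then genus0_result X b (Fs 0) else subst (Fs g) (exp_cov X b)))) m"
    proof (cases "k < - 1")
      case True
      have "(vfield X h ^^ n) 0 = 0" for n by (induction n) simp_all
      then have "divpow (vfield X h) n 0 = 0" for n by (simp add: divpow_def)
      with True show ?thesis by (simp add: comp hbar_comp_log_pot E_def)
    next
      case False
      then have Ek: "hbar_comp k E = Fs (nat (k + 1))" by (simp add: E_def hbar_comp_log_pot)
      show ?thesis
      proof (cases "k = - 1")
        case True
        then show ?thesis
          using genus0_flow_sums[OF X b F[of 0, folded b_def], of m]
          using Ek by (simp add: comp hbar_comp_log_pot genus0_flow_def h_def)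
      next
        case k: False
        then have "nat (k + 1) \<noteq> 0" using False by auto
        then show ?thesis
          using k False divpow_flow_sums[OF X b F[of "nat (k + 1)", folded b_def], of m]
          by (simp add: comp Ek hbar_comp_log_pot h_def)
      qed
    qed
    then show ?thesis by simp
  qed
  show ?thesis
  proof
    assume "quantized_action X a Fs Gs"
    then obtain W' where W': "W' $ 0 = E" "exp_quant X a E = fps_expo (W' - fps_const E)"
      "\<And>m k. (\<lambda>n. mcoeff (W' $ n) m $$ k) sums (mcoeff (log_pot Gs) m $$ k)"
      unfolding quantized_action_def E_def by blast
    have "W' - fps_const E = Abs_fps W - fps_const E"
      by (rule fps_expo_inject) (use eq W' in \<open>auto simp: W_def\<close>)
    then have "W' = Abs_fps W" by simp
    then have "mcoeff (log_pot Gs) m $$ k = mcoeff (log_pot (\<lambda>g. if g = 0 then genus0_result X b (Fs 0)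
        else subst (Fs g) (exp_cov X b))) m $$ k" for m k
      using sums_unique2[OF W'(3)[of m k]] sums[of m k] by simp
    then have "hbar_comp k (log_pot Gs) = hbar_comp k (log_pot (\<lambda>g. if g = 0 then genus0_result X b (Fs 0)
        else subst (Fs g) (exp_cov X b)))" for k
      by (intro mfps_eqI) simp
    \<comment> \<open>Genus g sits at the power g - 1 of hbar.\<close>
    from this[of "int g - 1" for g]
    have "Gs g = (if g = 0 then genus0_result X b (Fs 0) else subst (Fs g) (exp_cov X b))" for g
      by (simp add: hbar_comp_log_pot)
    then show "Gs = (\<lambda>g. if g = 0 then genus0_result X (\<lambda>i v. - a i v) (Fs 0) else subst (Fs g) (exp_cov X (\<lambda>i v. - a i v)))"
      unfolding b_def by (rule ext)
  next
    assume Gs: "Gs = (\<lambda>g. if g = 0 then genus0_result X (\<lambda>i v. - a i v) (Fs 0) else subst (Fs g) (exp_cov X (\<lambda>i v. - a i v)))"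
    show "quantized_action X a Fs Gs"
      unfolding quantized_action_def
    proof (intro exI[of _ "Abs_fps W"] conjI allI)
      show "Abs_fps W $ 0 = log_pot Fs" by (simp add: W_def E_def)
      show "exp_quant X a (log_pot Fs) = fps_expo (Abs_fps W - fps_const (log_pot Fs))"
        using eq by (simp only: E_def)
      show "(\<lambda>n. mcoeff (Abs_fps W $ n) m $$ k) sums (mcoeff (log_pot Gs) m $$ k)" for m k
        unfolding Gs fps_nth_Abs_fps using sums[of m k] unfolding b_def .
    qed
  qed
qed

section \<open>Membership in $GW_0$\<close>

text \<open>The field of this series is the string operator, as the field of the identity series is
  the dilaton operator. Both thereby become comparable with V.\<close>

definition z_inverse :: "nat \<Rightarrow> 'h \<Rightarrow> 'h :: zero" where
  "z_inverse i v = (if i = 1 then v else 0)"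

lemma opmat_shift:
  assumes X: "gw_space X"
  shows "opmat X z_inverse u v = (if fst v = Suc (fst u) \<and> snd u = snd v then 1 else 0)"
  by (auto simp: opmat_def z_inverse_def pair_cobas_bas[OF X] pair_right_simps[OF X])

lemma mconst_mult_cancel:
  assumes "c \<noteq> 0" "mconst c * f = mconst c * (g :: ('v, complex) mfps)"
  shows "f = g"
proof (rule mfps_eqI)
  fix m
  have "mcoeff (mconst c * f) m = mcoeff (mconst c * g) m" using assms by simp
  then show "mcoeff f m = mcoeff g m" using assms(1) by simp
qed

lemma euler_eq_vfield:
  fixes X :: "('h :: ab_group_add, 'n :: finite) gwdata"
  assumes X: "gw_space X"
  shows "formal_sum (\<lambda>v. qvar X v * mderiv v F) = vfield X (opmat X ser_one) (F :: 'n tser)"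
proof (rule agree_imp_eq)
  fix K :: nat assume K: "K \<ge> 1"
  have "agree K (formal_sum (\<lambda>v. qvar X v * mderiv v F)) (\<Sum>v\<in>vars K. qvar X v * mderiv v F)"
  proof (rule agree_formal_sum)
    fix v :: "'n var" assume "v \<notin> vars K"
    then have "agree K (qvar X v * mderiv v F) (0 * mderiv v F)"
      using K by (intro agree_mult agree_qvar_0 agree_refl) auto
    then show "agree K (qvar X v * mderiv v F) 0" by simp
  qed simp
  also have "(\<Sum>v\<in>vars K. qvar X v * mderiv v F) = vfield_upto X (opmat X ser_one) K F"
  proof -
    have "(\<Sum>u\<in>vars K. mconst (opmat X ser_one u v) * qvar X v * mderiv u F) = qvar X v * mderiv v F"
      if "v \<in> vars K" for v
    proof -
      have "(\<Sum>u\<in>vars K. mconst (opmat X ser_one u v) * qvar X v * mderiv u F) =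
          (\<Sum>u\<in>vars K. if u = v then qvar X v * mderiv v F else 0)"
        by (intro sum.cong refl) (auto simp: opmat_ser_one[OF X])
      then show ?thesis using that by simp
    qed
    then show ?thesis by (simp add: vfield_upto_def)
  qed
  finally show "agree K (formal_sum (\<lambda>v. qvar X v * mderiv v F)) (vfield X (opmat X ser_one) F)"
    by (rule agree_trans) (rule agree_sym[OF agree_vfield[OF lowering_opmat K]])
qed

lemma string_eq_vfield:
  fixes X :: "('h :: ab_group_add, 'n :: finite) gwdata"
  assumes X: "gw_space X"
  shows "formal_sum (\<lambda>(i, \<alpha>). qvar X (Suc i, \<alpha>) * mderiv (i, \<alpha>) F) =
    vfield X (opmat X z_inverse) (F :: 'n tser)"
proof (rule agree_imp_eq)
  fix K :: nat assume K: "K \<ge> 1"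
  let ?Z = "opmat X z_inverse"
  let ?f = "\<lambda>u. qvar X (Suc (fst u), snd u) * mderiv u F"
  have 0: "agree K (?f u) 0" if "fst u \<ge> K" for u
  proof -
    have "agree K (?f u) (0 * mderiv u F)"
      using K that by (intro agree_mult agree_qvar_0 agree_refl) auto
    then show ?thesis by simp
  qed
  have "agree K (formal_sum ?f) (\<Sum>u\<in>vars K. ?f u)"
    by (rule agree_formal_sum) (simp_all add: 0)
  \<comment> \<open>For derivatives of top index the shifted variable has index K + 1 and is zero
    modulo the cutoff.\<close>
  also have "agree K (\<Sum>u\<in>vars K. ?f u) (\<Sum>u\<in>vars K. if fst u < K then ?f u else 0)"
  proof (rule agree_sum)
    fix u :: "'n var"
    show "agree K (?f u) (if fst u < K then ?f u else 0)"
    proof (cases "fst u < K")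
      case False
      then have "agree K (?f u) 0" by (intro 0) simp
      with False show ?thesis by simp
    qed simp
  qed
  also have "(\<Sum>u\<in>vars K. if fst u < K then ?f u else 0) = vfield_upto X ?Z K F"
  proof -
    have "(\<Sum>v\<in>vars K. mconst (?Z u v) * qvar X v * mderiv u F) = (if fst u < K then ?f u else 0)" for u
    proof -
      have "(\<Sum>v\<in>vars K. mconst (?Z u v) * qvar X v * mderiv u F) =
          (\<Sum>v\<in>vars K. if v = (Suc (fst u), snd u) then ?f u else 0)"
        by (intro sum.cong refl) (auto simp: opmat_shift[OF X] prod_eq_iff)
      then show ?thesis by simp
    qed
    then show ?thesis unfolding vfield_upto_def by (subst sum.swap) simp
  qed
  finally show "agree K (formal_sum (\<lambda>(i, \<alpha>). qvar X (Suc i, \<alpha>) * mderiv (i, \<alpha>) F)) (vfield X ?Z F)"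
    using agree_sym[OF agree_vfield[OF lowering_opmat[of X z_inverse] K, of X F]]
    by (auto simp: case_prod_unfold intro: agree_trans)
qed

definition string_quad :: "('h :: ab_group_add, 'n) gwdata \<Rightarrow> 'n var \<Rightarrow> 'n var \<Rightarrow> complex" where
  "string_quad X u v = (if fst u = 0 \<and> fst v = 0 then - pair X (bas X (snd u)) (bas X (snd v)) / 2 else 0)"

lemma string_rhs_eq_qform:
  fixes X :: "('h :: ab_group_add, 'n :: finite) gwdata"
  shows "mconst (- 1 / 2) * (\<Sum>\<alpha>\<in>UNIV. \<Sum>\<beta>\<in>UNIV. mconst (pair X (bas X \<alpha>) (bas X \<beta>)) *
    qvar X (0, \<alpha>) * qvar X (0, \<beta>)) = qform X (string_quad X)"
proof (rule agree_imp_eq)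
  fix K :: nat assume K: "K \<ge> 1"
  have z: "(\<Sum>m\<le>K. \<Sum>\<beta>\<in>UNIV. if m = 0 then f \<beta> else (0 :: 'n tser)) = (\<Sum>\<beta>\<in>UNIV. f \<beta>)" for f :: "'n \<Rightarrow> 'n tser"
  proof -
    have "(\<Sum>m\<le>K. \<Sum>\<beta>\<in>UNIV. if m = 0 then f \<beta> else 0) = (\<Sum>m\<le>K. if m = 0 then \<Sum>\<beta>\<in>UNIV. f \<beta> else 0)"
      by (intro sum.cong refl) auto
    then show ?thesis by simp
  qed
  have "(\<Sum>u\<in>vars K. \<Sum>v\<in>vars K. mconst (string_quad X u v) * qvar X u * qvar X v) =
      (\<Sum>m\<le>K. \<Sum>\<alpha>\<in>UNIV. if m = 0 then (\<Sum>m'\<le>K. \<Sum>\<beta>\<in>UNIV. if m' = 0 then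
        mconst (- pair X (bas X \<alpha>) (bas X \<beta>) / 2) * qvar X (0, \<alpha>) * qvar X (0, \<beta>) else 0) else 0)"
    unfolding sum_vars
  proof (intro sum.cong refl)
    fix m \<alpha>
    show "(\<Sum>m'\<le>K. \<Sum>\<beta>\<in>UNIV. mconst (string_quad X (m, \<alpha>) (m', \<beta>)) * qvar X (m, \<alpha>) * qvar X (m', \<beta>)) =
        (if m = 0 then (\<Sum>m'\<le>K. \<Sum>\<beta>\<in>UNIV. if m' = 0 then
        mconst (- pair X (bas X \<alpha>) (bas X \<beta>) / 2) * qvar X (0, \<alpha>) * qvar X (0, \<beta>) else 0) else 0)"
    proof (cases "m = 0")
      case True
      then show ?thesis by (auto simp: string_quad_def intro!: sum.cong)
    qed (simp add: string_quad_def)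
  qed
  also have "\<dots> = (\<Sum>\<alpha>\<in>UNIV. \<Sum>\<beta>\<in>UNIV. mconst (- pair X (bas X \<alpha>) (bas X \<beta>) / 2) * qvar X (0, \<alpha>) * qvar X (0, \<beta>))"
    unfolding z ..
  also have "\<dots> = mconst (- 1 / 2) * (\<Sum>\<alpha>\<in>UNIV. \<Sum>\<beta>\<in>UNIV. mconst (pair X (bas X \<alpha>) (bas X \<beta>)) *
    qvar X (0, \<alpha>) * qvar X (0, \<beta>))"
    unfolding sum_distrib_left by (simp add: mult.assoc[symmetric] mconst_mult[symmetric])
  finally show "agree K (mconst (- 1 / 2) * (\<Sum>\<alpha>\<in>UNIV. \<Sum>\<beta>\<in>UNIV. mconst (pair X (bas X \<alpha>) (bas X \<beta>)) *
    qvar X (0, \<alpha>) * qvar X (0, \<beta>))) (qform X (string_quad X))"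
    using agree_sym[OF agree_qform[OF K, of X "string_quad X"]] by simp
qed

text \<open>Commuting series have commuting matrices because truncation is multiplicative.\<close>

lemma vfield_opmat_commute:
  fixes X :: "('h :: ab_group_add, 'n :: finite) gwdata"
  assumes X: "gw_space X" and A: "\<And>i. endo X (A i)" and B: "\<And>i. endo X (B i)"
    and comm: "ser_mult A B = ser_mult B A"
  shows "vfield X (opmat X B) (vfield X (opmat X A) f) = vfield X (opmat X A) (vfield X (opmat X B) (f :: 'n tser))"
  by (rule vfield_commute[OF lowering_opmat lowering_opmat])
    (simp add: opmat_mult[OF X A] opmat_mult[OF X B] comm)

text \<open>The Euler field commutes with V and has eigenvalue 2 on quadratic forms in q, so the
  recursion preserves the eigenvalue.\<close>

lemma genus0_flow_euler:
  fixes X :: "('h :: ab_group_add, 'n :: finite) gwdata"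
  assumes X: "gw_space X" and A: "skew_series X A"
    and F: "vfield X (opmat X ser_one) F = mconst 2 * F"
  shows "vfield X (opmat X ser_one) (genus0_flow X A F n) = mconst 2 * genus0_flow X A F n"
proof (induction n)
  case 0
  show ?case by (simp add: genus0_flow_0[OF X] F)
next
  case (Suc n)
  have e: "endo X (A i)" for i using A by (simp add: skew_series_def)
  let ?E = "vfield X (opmat X ser_one)" and ?V = "vfield X (opmat X A)"
  have comm: "?E (?V f) = ?V (?E f)" for f
    by (rule vfield_opmat_commute[OF X e endo_ser_one[OF X]])
      (simp add: ser_mult_one_left ser_mult_one_right[OF e])
  have Q: "?E (qform X B) = mconst 2 * qform X B" for B
  proof -
    have "(\<Sum>w\<in>vars (fst u). opmat X ser_one w u * c w) = c u"
      "(\<Sum>w\<in>vars (fst u). c w * opmat X ser_one w u) = c u" for u and c :: "'n var \<Rightarrow> complex"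
      by (simp_all add: opmat_ser_one[OF X] if_distrib[of "\<lambda>x. x * _"] if_distrib[of "\<lambda>x. _ * x"] cong: if_cong)
    then show ?thesis by (simp add: vfield_qform[OF lowering_opmat] qform_scale)
  qed
  have "mconst (of_nat (Suc n)) * ?E (genus0_flow X A F (Suc n)) = ?E (mconst (of_nat (Suc n)) * genus0_flow X A F (Suc n))"
    by (rule vfield_mconst_mult[OF lowering_opmat, symmetric])
  also have "\<dots> = mconst 2 * (?V (genus0_flow X A F n) + (if n = 0 then qform X (initial_quad X A) else 0))"
    unfolding genus0_flow_Suc[OF X A] vfield_add[OF lowering_opmat] comm Suc
    by (simp add: vfield_mconst_mult[OF lowering_opmat] Q ring_distribs)
  also have "\<dots> = mconst (of_nat (Suc n)) * (mconst 2 * genus0_flow X A F (Suc n))"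
    unfolding genus0_flow_Suc[OF X A, symmetric] by (rule mult.left_commute)
  finally show ?case by (rule mconst_mult_cancel[rotated]) (simp del: of_nat_Suc)
qed

text \<open>This is the qq-part of the vanishing Poisson bracket between the Hamiltonians of
  \<open>A\<close> and z^{-1}.\<close>

lemma initial_quad_shift:
  fixes X :: "('h :: ab_group_add, 'n :: finite) gwdata"
  assumes X: "gw_space X" and A: "skew_series X A"
  shows "vfield X (opmat X z_inverse) (qform X (initial_quad X A)) =
    - vfield X (opmat X A) (qform X (string_quad X))"
proof -
  let ?Z = "opmat X z_inverse"
  have e: "endo X (A i)" for i using A by (simp add: skew_series_def)
  have A0: "A 0 v = 0" for v using A by (simp add: skew_series_def)
  have Zsum: "(\<Sum>w\<in>vars (fst u). ?Z w u * c w) = (case fst u of 0 \<Rightarrow> 0 | Suc k \<Rightarrow> c (k, snd u))"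
    "(\<Sum>w\<in>vars (fst u). c w * ?Z w u) = (case fst u of 0 \<Rightarrow> 0 | Suc k \<Rightarrow> c (k, snd u))"
    for u and c :: "'n var \<Rightarrow> complex"
  proof -
    have *: "(\<Sum>w\<in>vars (fst u). ?Z w u * c w) = (case fst u of 0 \<Rightarrow> 0 | Suc k \<Rightarrow> c (k, snd u))"
    proof (cases "fst u")
      case (Suc k)
      have "(\<Sum>w\<in>vars (fst u). ?Z w u * c w) = (\<Sum>w\<in>vars (fst u). if w = (k, snd u) then c (k, snd u) else 0)"
        by (intro sum.cong refl) (auto simp: opmat_shift[OF X] Suc prod_eq_iff)
      then show ?thesis by (simp add: Suc)
    qed (simp add: opmat_shift[OF X])
    then show "(\<Sum>w\<in>vars (fst u). ?Z w u * c w) = (case fst u of 0 \<Rightarrow> 0 | Suc k \<Rightarrow> c (k, snd u))" .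
    show "(\<Sum>w\<in>vars (fst u). c w * ?Z w u) = (case fst u of 0 \<Rightarrow> 0 | Suc k \<Rightarrow> c (k, snd u))"
      using * by (simp add: mult.commute)
  qed
  have R1: "(\<Sum>w\<in>vars k. opmat X A w u * string_quad X w v) =
      (if fst v = 0 then - pair X (A (fst u) (bas X (snd u))) (bas X (snd v)) / 2 else 0)" if "k = fst u" for u v k
  proof -
    have "(\<Sum>w\<in>vars k. opmat X A w u * string_quad X w v) =
        (\<Sum>m\<le>k. if m = 0 then \<Sum>\<beta>\<in>UNIV. opmat X A (0, \<beta>) u * string_quad X (0, \<beta>) v else 0)"
      unfolding sum_vars by (intro sum.cong refl) (auto simp: string_quad_def)
    also have "\<dots> = (if fst v = 0 then - (\<Sum>\<beta>\<in>UNIV. pair X (cobas X \<beta>) (A (fst u) (bas X (snd u))) * pair X (bas X \<beta>) (bas X (snd v))) / 2 else 0)"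
      by (simp add: opmat_def string_quad_def sum_negf sum_divide_distrib)
    finally show ?thesis by (simp only: sum_coords_pair[OF X])
  qed
  have R2: "(\<Sum>w\<in>vars (fst v). string_quad X u w * opmat X A w v) =
      (if fst u = 0 then - pair X (bas X (snd u)) (A (fst v) (bas X (snd v))) / 2 else 0)" for u v
  proof -
    have "string_quad X u w = string_quad X w u" for w by (auto simp: string_quad_def pair_commute[OF X])
    then show ?thesis using R1[of "fst v" v u] by (simp add: mult.commute pair_commute[OF X, of "A _ _"])
  qed
  have "vfield X (opmat X A) (qform X (string_quad X)) + vfield X ?Z (qform X (initial_quad X A)) = qform X (\<lambda>_ _. 0)"
    unfolding vfield_qform[OF lowering_opmat] qform_add
  proof (rule arg_cong[where f = "qform X"], intro ext)
    fix u v :: "'n var"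
    obtain k \<alpha> l \<beta> where uv: "u = (k, \<alpha>)" "v = (l, \<beta>)" by (cases u, cases v)
    have skew: "pair X (A i x) y = - ((- 1) ^ i * pair X x (A i y))" for i x y
      using A by (simp add: skew_series_def)
    show "(\<Sum>w\<in>vars (fst u). opmat X A w u * string_quad X w v)
        + (\<Sum>w\<in>vars (fst v). string_quad X u w * opmat X A w v)
        + ((\<Sum>w\<in>vars (fst u). ?Z w u * initial_quad X A w v)
        + (\<Sum>w\<in>vars (fst v). initial_quad X A u w * ?Z w v)) = 0"
      unfolding R1[OF refl] R2 Zsum
      \<comment> \<open>For positive indices the two shifted terms have opposite signs; when just
        one index is zero, the only shifted term cancels against the string term.\<close>
      by (cases k; cases l)
        (simp_all add: uv initial_quad_def A0 skew pair_right_simps[OF X] pair_left_simps[OF X])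
  qed
  then show ?thesis unfolding qform_0 by (simp add: eq_neg_iff_add_eq_0 add.commute)
qed

text \<open>The string operator commutes with V, so its value can change only through the source at
  the first step; there \<open>initial_quad_shift\<close> gives cancellation.\<close>

lemma genus0_flow_string:
  assumes X: "gw_space X" and A: "skew_series X A"
    and F: "vfield X (opmat X z_inverse) F = qform X (string_quad X)"
  shows "vfield X (opmat X z_inverse) (genus0_flow X A F n) =
    (if n = 0 then qform X (string_quad X) else 0)"
proof (induction n)
  case 0
  show ?case by (simp add: genus0_flow_0[OF X] F)
next
  case (Suc n)
  have e: "endo X (A i)" for i using A by (simp add: skew_series_def)
  let ?z = z_inverse
  let ?Z = "vfield X (opmat X ?z)" and ?V = "vfield X (opmat X A)"
  have ez: "endo X (?z i)" for i by (rule endoI[OF X]) (auto simp: z_inverse_def scl_simps[OF X])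
  have "ser_mult A ?z = ser_mult ?z A"
  proof (intro ext)
    fix k v
    have "ser_mult A ?z k v = (\<Sum>i\<le>k. if Suc i = k then A i v else 0)"
      unfolding ser_mult_def by (intro sum.cong refl) (auto simp: z_inverse_def endo_simps[OF e])
    also have "\<dots> = (\<Sum>i\<le>k. if i = 1 then A (k - i) v else 0)"
      by (cases k) auto
    also have "\<dots> = ser_mult ?z A k v"
      unfolding ser_mult_def by (intro sum.cong refl) (auto simp: z_inverse_def)
    finally show "ser_mult A ?z k v = ser_mult ?z A k v" .
  qed
  then have comm: "?Z (?V f) = ?V (?Z f)" for f
    by (rule vfield_opmat_commute[OF X e ez])
  have "mconst (of_nat (Suc n)) * ?Z (genus0_flow X A F (Suc n)) = ?Z (mconst (of_nat (Suc n)) * genus0_flow X A F (Suc n))"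
    by (rule vfield_mconst_mult[OF lowering_opmat, symmetric])
  also have "\<dots> = mconst (of_nat (Suc n)) * 0"
    unfolding genus0_flow_Suc[OF X A] vfield_add[OF lowering_opmat] comm Suc
    by (simp add: initial_quad_shift[OF X A])
  finally show ?case by (simp del: of_nat_Suc) (rule mconst_mult_cancel[of "of_nat (Suc n)"], simp_all del: of_nat_Suc)
qed

section \<open>The chain rule along the change of variables and topological recursion\<close>

lemma mderiv_exp_cov:
  fixes X :: "('h :: ab_group_add, 'n :: finite) gwdata"
  shows "mderiv u (exp_cov X A v) = mconst (opmat X (ser_exp X A) v u)"
  by (simp add: exp_cov_def mderiv_add mderiv_linser)

text \<open>The Jacobian is the matrix of e^A; its columns are finite and the matrix of e^{-A}
  inverts it.\<close>

lemma subst_defined_exp_cov_mderiv: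
  assumes X: "gw_space X" and A: "skew_series X A" and f: "subst_defined f (exp_cov X A)"
  shows "subst_defined (mderiv w f) (exp_cov X A)"
proof (rule subst_defined_mderiv[OF f mderiv_exp_cov])
  show "finite {v. opmat X (ser_exp X A) v u \<noteq> 0}" for u
    by (rule finite_subset[of _ "vars (fst u)"]) (auto simp: opmat_def)
  show "(\<Sum>u\<in>vars (fst w). opmat X (ser_exp X A) v u * opmat X (ser_exp X (\<lambda>i v. - A i v)) u w) =
      (if v = w then 1 else 0)" for v
    by (rule opmat_exp_inverse[OF X A order_refl])
qed simp

text \<open>The vector field on the source of the change of variables that is related to $\partial_u$.\<close>

definition pull_deriv :: "('h :: ab_group_add, 'n :: finite) gwdata \<Rightarrow> (nat \<Rightarrow> 'h \<Rightarrow> 'h) \<Rightarrow> 'n var \<Rightarrow>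
    'n tser \<Rightarrow> 'n tser" where
  "pull_deriv X A u f = (\<Sum>v\<in>vars (fst u). mconst (opmat X (ser_exp X A) v u) * mderiv v f)"

lemma mderiv_subst_exp_cov:
  assumes X: "gw_space X" and A: "skew_series X A" and f: "subst_defined f (exp_cov X A)"
  shows "subst_defined (pull_deriv X A u f) (exp_cov X A)"
    and "mderiv u (subst f (exp_cov X A)) = subst (pull_deriv X A u f) (exp_cov X A)"
    and "mderiv u (subst f (exp_cov X A)) =
      (\<Sum>v\<in>vars (fst u). mconst (opmat X (ser_exp X A) v u) * subst (mderiv v f) (exp_cov X A))"
proof -
  note d = subst_defined_exp_cov_mderiv[OF X A f]
  have s: "subst_defined (pull_deriv X A u f) (exp_cov X A) \<and> subst (pull_deriv X A u f) (exp_cov X A) =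
      (\<Sum>v\<in>vars (fst u). subst (mconst (opmat X (ser_exp X A) v u) * mderiv v f) (exp_cov X A))"
    unfolding pull_deriv_def by (rule subst_sum) (rule subst_mconst_mult[OF d])
  then show "subst_defined (pull_deriv X A u f) (exp_cov X A)" by simp
  show "mderiv u (subst f (exp_cov X A)) =
      (\<Sum>v\<in>vars (fst u). mconst (opmat X (ser_exp X A) v u) * subst (mderiv v f) (exp_cov X A))"
    by (rule mderiv_subst[OF f d mderiv_exp_cov]) (auto simp: opmat_def)
  then show "mderiv u (subst f (exp_cov X A)) = subst (pull_deriv X A u f) (exp_cov X A)"
    using s by (simp add: subst_mconst_mult[OF d])
qed

text \<open>Symmetry of the form merges the two terms of its derivative and absorbs the factor
  1/2.\<close>

lemma mderiv_genus0_result: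
  assumes X: "gw_space X" and A: "skew_series X A"
  shows "mderiv u (genus0_result X A F) = mderiv u (subst F (exp_cov X A)) + qlin X (quad_total X A u)"
proof -
  have "quad_total X A u v / 2 + quad_total X A v u / 2 = quad_total X A u v" for v
    using quad_total_sym[OF X A, of v u] by simp
  then show ?thesis by (simp add: genus0_result_def mderiv_add mderiv_qform)
qed

text \<open>The recursion relation with the second derivative replaced by a general series
  \<open>f\<close>. It is linear in \<open>f\<close> and so survives the constant combinations
  produced by the chain rule.\<close>

definition trr_factor :: "('h :: ab_group_add, 'n :: finite) gwdata \<Rightarrow> 'n tser \<Rightarrow> 'n tser \<Rightarrow> bool" where
  "trr_factor X F f \<longleftrightarrow> (\<forall>k \<alpha>. mderiv (Suc k, \<alpha>) f = (\<Sum>\<mu>\<in>UNIV. \<Sum>\<nu>\<in>UNIV.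
     mderiv (k, \<alpha>) (mderiv (0, \<mu>) F) * mconst (gram_inv X \<mu> \<nu>) * mderiv (0, \<nu>) f))"

lemma trr_factor_sum:
  assumes "\<And>i. i \<in> I \<Longrightarrow> trr_factor X F (f i)"
  shows "trr_factor X F (\<Sum>i\<in>I. mconst (c i) * f i)"
  unfolding trr_factor_def
proof (intro allI)
  fix k \<alpha>
  let ?g = "\<lambda>\<mu> \<nu>. mderiv (k, \<alpha>) (mderiv (0, \<mu>) F) * mconst (gram_inv X \<mu> \<nu>)"
  have "mderiv (Suc k, \<alpha>) (\<Sum>i\<in>I. mconst (c i) * f i) =
      (\<Sum>i\<in>I. \<Sum>\<mu>\<in>UNIV. \<Sum>\<nu>\<in>UNIV. ?g \<mu> \<nu> * (mconst (c i) * mderiv (0, \<nu>) (f i)))"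
    using assms by (auto simp: trr_factor_def mderiv_sum mderiv_mconst_mult sum_distrib_left
        mult.left_commute[of "mconst (c _)"] intro!: sum.cong)
  also have "\<dots> = (\<Sum>\<mu>\<in>UNIV. \<Sum>i\<in>I. \<Sum>\<nu>\<in>UNIV. ?g \<mu> \<nu> * (mconst (c i) * mderiv (0, \<nu>) (f i)))"
    by (rule sum.swap)
  also have "\<dots> = (\<Sum>\<mu>\<in>UNIV. \<Sum>\<nu>\<in>UNIV. \<Sum>i\<in>I. ?g \<mu> \<nu> * (mconst (c i) * mderiv (0, \<nu>) (f i)))"
    by (intro sum.cong[OF refl] sum.swap)
  finally show "mderiv (Suc k, \<alpha>) (\<Sum>i\<in>I. mconst (c i) * f i) =
      (\<Sum>\<mu>\<in>UNIV. \<Sum>\<nu>\<in>UNIV. ?g \<mu> \<nu> * mderiv (0, \<nu>) (\<Sum>i\<in>I. mconst (c i) * f i))"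
    by (simp add: mderiv_sum mderiv_mconst_mult sum_distrib_left)
qed

text \<open>The pulled-back derivative of index k+1 has a term of index 0, and the relation for F
  lowers the index of all others. The former supplies the quadratic correction, the latter the
  second derivative of the substituted F, in the corresponding derivative of the new
  potential.\<close>

lemma genus0_result_trr:
  assumes X: "gw_space X" and A: "skew_series X A" and F: "subst_defined F (exp_cov X A)"
    and trr: "\<And>u v. trr_factor X F (mderiv u (mderiv v F))"
  shows "trr_factor X (genus0_result X A F) (mderiv v (mderiv w (genus0_result X A F)))"
  unfolding trr_factor_def
proof (intro allI)
  fix k \<alpha>
  let ?G = "genus0_result X A F" and ?P = "opmat X (ser_exp X A)"
  let ?T = "\<lambda>f. subst f (exp_cov X A)" and ?good = "\<lambda>f. subst_defined f (exp_cov X A)" and ?p = "pull_deriv X A"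
  define Y where "Y = ?p v (?p w F)"
  have gw: "?good (?p w F)" by (rule mderiv_subst_exp_cov[OF X A F])
  have gY: "?good Y" unfolding Y_def by (rule mderiv_subst_exp_cov[OF X A gw])
  have gd: "?good (mderiv u f)" if "?good f" for u f by (rule subst_defined_exp_cov_mderiv[OF X A that])
  have dd: "mderiv u (mderiv w ?G) = ?T (?p u (?p w F)) + mconst (quad_total X A w u)" for u w
    unfolding mderiv_genus0_result[OF X A] mderiv_add mderiv_qlin mderiv_subst_exp_cov(2)[OF X A F]
      mderiv_subst_exp_cov(2)[OF X A mderiv_subst_exp_cov(1)[OF X A F]] ..
  \<comment> \<open>The second derivatives of the quadratic form are constants and disappear in
    third derivatives.\<close>
  have ddd: "mderiv u (mderiv v (mderiv w ?G)) = mderiv u (?T Y)" for u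
    by (simp add: dd mderiv_add Y_def)
  have p0: "?p (0, \<nu>) f = mderiv (0, \<nu>) f" for \<nu> f
  proof -
    have "?p (0, \<nu>) f = (\<Sum>\<beta>\<in>UNIV. mconst (?P (0, \<beta>) (0, \<nu>)) * mderiv (0, \<beta>) f)"
      by (simp add: pull_deriv_def sum_vars)
    also have "\<dots> = (\<Sum>\<beta>\<in>UNIV. if \<beta> = \<nu> then mderiv (0, \<nu>) f else 0)"
      by (intro sum.cong refl) (auto simp: opmat_def ser_exp_0[OF X A] pair_cobas_bas[OF X])
    finally show ?thesis by simp
  qed
  have "trr_factor X F Y"
    unfolding Y_def pull_deriv_def mderiv_sum mderiv_mconst_mult by (intro trr_factor_sum trr)
  then have trrY: "mderiv (Suc i, \<beta>) Y = (\<Sum>\<mu>\<in>UNIV. \<Sum>\<nu>\<in>UNIV.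
      mderiv (i, \<beta>) (mderiv (0, \<mu>) F) * mconst (gram_inv X \<mu> \<nu>) * mderiv (0, \<nu>) Y)" for i \<beta>
    by (simp add: trr_factor_def)
  \<comment> \<open>Entries of \<open>opmat\<close> depend only on the index difference, so below
    row 0 column k+1 repeats column k.\<close>
  have "?p (Suc k, \<alpha>) Y = (\<Sum>\<beta>\<in>UNIV. mconst (?P (0, \<beta>) (Suc k, \<alpha>)) * mderiv (0, \<beta>) Y)
      + (\<Sum>i\<le>k. \<Sum>\<beta>\<in>UNIV. mconst (?P (i, \<beta>) (k, \<alpha>)) * mderiv (Suc i, \<beta>) Y)"
    unfolding pull_deriv_def by (simp add: sum_vars sum.atMost_Suc_shift opmat_def del: sum.atMost_Suc)
  also have "(\<Sum>i\<le>k. \<Sum>\<beta>\<in>UNIV. mconst (?P (i, \<beta>) (k, \<alpha>)) * mderiv (Suc i, \<beta>) Y) =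
      (\<Sum>\<mu>\<in>UNIV. \<Sum>\<nu>\<in>UNIV. ?p (k, \<alpha>) (mderiv (0, \<mu>) F) * mconst (gram_inv X \<mu> \<nu>) * mderiv (0, \<nu>) Y)"
  proof -
    have "(\<Sum>i\<le>k. \<Sum>\<beta>\<in>UNIV. mconst (?P (i, \<beta>) (k, \<alpha>)) * mderiv (Suc i, \<beta>) Y) =
        (\<Sum>u\<in>vars k. \<Sum>\<mu>\<in>UNIV. \<Sum>\<nu>\<in>UNIV. mconst (?P u (k, \<alpha>)) * (mderiv u (mderiv (0, \<mu>) F) *
          mconst (gram_inv X \<mu> \<nu>) * mderiv (0, \<nu>) Y))"
      unfolding trrY sum_vars sum_distrib_left ..
    also have "\<dots> = (\<Sum>\<mu>\<in>UNIV. \<Sum>u\<in>vars k. \<Sum>\<nu>\<in>UNIV. mconst (?P u (k, \<alpha>)) * (mderiv u (mderiv (0, \<mu>) F) *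
          mconst (gram_inv X \<mu> \<nu>) * mderiv (0, \<nu>) Y))"
      by (rule sum.swap)
    also have "\<dots> = (\<Sum>\<mu>\<in>UNIV. \<Sum>\<nu>\<in>UNIV. \<Sum>u\<in>vars k. mconst (?P u (k, \<alpha>)) * (mderiv u (mderiv (0, \<mu>) F) *
          mconst (gram_inv X \<mu> \<nu>) * mderiv (0, \<nu>) Y))"
      by (intro sum.cong[OF refl] sum.swap)
    finally show ?thesis by (simp add: pull_deriv_def sum_distrib_right mult.assoc)
  qed
  finally have pY: "?p (Suc k, \<alpha>) Y = (\<Sum>\<beta>\<in>UNIV. mconst (?P (0, \<beta>) (Suc k, \<alpha>)) * mderiv (0, \<beta>) Y)
      + (\<Sum>\<mu>\<in>UNIV. \<Sum>\<nu>\<in>UNIV. ?p (k, \<alpha>) (mderiv (0, \<mu>) F) * mconst (gram_inv X \<mu> \<nu>) * mderiv (0, \<nu>) Y)" .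
  have gc: "?good (mconst c * mderiv u Y)" and Tc: "?T (mconst c * mderiv u Y) = mconst c * ?T (mderiv u Y)" for c u
    by (rule subst_mconst_mult[OF gd[OF gY]])+
  have gp: "?good (?p (k, \<alpha>) (mderiv (0, \<mu>) F))" for \<mu> by (rule mderiv_subst_exp_cov[OF X A gd[OF F]])
  have gpg: "?good (?p (k, \<alpha>) (mderiv (0, \<mu>) F) * mconst c)"
    and Tpg: "?T (?p (k, \<alpha>) (mderiv (0, \<mu>) F) * mconst c) = ?T (?p (k, \<alpha>) (mderiv (0, \<mu>) F)) * mconst c" for \<mu> c
    using subst_mult[OF gp subst_mconst(1)] by (simp_all add: subst_mconst(2))
  have g3: "?good (?p (k, \<alpha>) (mderiv (0, \<mu>) F) * mconst c * mderiv u Y)"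
    and T3: "?T (?p (k, \<alpha>) (mderiv (0, \<mu>) F) * mconst c * mderiv u Y) =
      ?T (?p (k, \<alpha>) (mderiv (0, \<mu>) F)) * mconst c * ?T (mderiv u Y)" for \<mu> c u
    using subst_mult[OF gpg gd[OF gY]] by (simp_all add: Tpg)
  note s1 = subst_sum[of UNIV "\<lambda>\<beta>. mconst (?P (0, \<beta>) (Suc k, \<alpha>)) * mderiv (0, \<beta>) Y" "exp_cov X A", OF gc]
  note s2 = subst_sum[of UNIV "\<lambda>\<nu>. ?p (k, \<alpha>) (mderiv (0, \<mu>) F) * mconst (gram_inv X \<mu> \<nu>) * mderiv (0, \<nu>) Y"
      "exp_cov X A" for \<mu>, OF g3]
  note s3 = subst_sum[of UNIV "\<lambda>\<mu>. \<Sum>\<nu>\<in>UNIV. ?p (k, \<alpha>) (mderiv (0, \<mu>) F) * mconst (gram_inv X \<mu> \<nu>) * mderiv (0, \<nu>) Y"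
      "exp_cov X A", OF conjunct1[OF s2]]
  have "mderiv (Suc k, \<alpha>) (?T Y) = (\<Sum>\<nu>\<in>UNIV. mconst (?P (0, \<nu>) (Suc k, \<alpha>)) * ?T (mderiv (0, \<nu>) Y))
      + (\<Sum>\<mu>\<in>UNIV. \<Sum>\<nu>\<in>UNIV. ?T (?p (k, \<alpha>) (mderiv (0, \<mu>) F)) * mconst (gram_inv X \<mu> \<nu>) * ?T (mderiv (0, \<nu>) Y))"
    unfolding mderiv_subst_exp_cov(2)[OF X A gY] pY subst_add(2)[OF conjunct1[OF s1] conjunct1[OF s3]]
      conjunct2[OF s1] conjunct2[OF s3] conjunct2[OF s2] Tc T3 ..
  also have "(\<Sum>\<nu>\<in>UNIV. mconst (?P (0, \<nu>) (Suc k, \<alpha>)) * ?T (mderiv (0, \<nu>) Y)) =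
      (\<Sum>\<mu>\<in>UNIV. \<Sum>\<nu>\<in>UNIV. mconst (quad_total X A (0, \<mu>) (k, \<alpha>)) * mconst (gram_inv X \<mu> \<nu>) * ?T (mderiv (0, \<nu>) Y))"
  proof -
    have "?P (0, \<nu>) (Suc k, \<alpha>) = (\<Sum>\<mu>\<in>UNIV. quad_total X A (0, \<mu>) (k, \<alpha>) * gram_inv X \<mu> \<nu>)" for \<nu>
      by (simp add: opmat_def quad_total_zero_row[OF X A] sum_pair_gram_inv[OF X])
    then show ?thesis
      by (subst sum.swap) (simp add: mconst_sum mconst_mult sum_distrib_right)
  qed
  also have "\<dots> + (\<Sum>\<mu>\<in>UNIV. \<Sum>\<nu>\<in>UNIV. ?T (?p (k, \<alpha>) (mderiv (0, \<mu>) F)) * mconst (gram_inv X \<mu> \<nu>) * ?T (mderiv (0, \<nu>) Y)) =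
      (\<Sum>\<mu>\<in>UNIV. \<Sum>\<nu>\<in>UNIV. mderiv (k, \<alpha>) (mderiv (0, \<mu>) ?G) * mconst (gram_inv X \<mu> \<nu>) * mderiv (0, \<nu>) (?T Y))"
    unfolding sum.distrib[symmetric] dd p0 mderiv_subst_exp_cov(2)[OF X A gY]
    by (intro sum.cong refl) (simp add: ring_distribs)
  finally show "mderiv (Suc k, \<alpha>) (mderiv v (mderiv w ?G)) = (\<Sum>\<mu>\<in>UNIV. \<Sum>\<nu>\<in>UNIV.
      mderiv (k, \<alpha>) (mderiv (0, \<mu>) ?G) * mconst (gram_inv X \<mu> \<nu>) * mderiv (0, \<nu>) (mderiv v (mderiv w ?G)))"
    unfolding ddd .
qed

lemma GW0_iff:
  fixes X :: "('h :: ab_group_add, 'n :: finite) gwdata"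
  assumes X: "gw_space X"
  shows "F \<in> GW0 X \<longleftrightarrow> vfield X (opmat X ser_one) F = mconst 2 * F \<and>
    vfield X (opmat X z_inverse) F = qform X (string_quad X) \<and>
    (\<forall>u v. trr_factor X F (mderiv u (mderiv v F)))"
proof -
  have two: "(2 :: 'n tser) = mconst 2"
    using mconst_of_nat[of 2] by simp
  show ?thesis
    unfolding GW0_def mem_Collect_eq euler_eq_vfield[OF X] string_eq_vfield[OF X] string_rhs_eq_qform two
      trr_factor_def by force
qed

text \<open>The dilaton and string equations are linear, hold at each power of s and pass to the
  sum. The recursion relation is quadratic in the potential and is checked on the closed
  formula.\<close>

lemma genus0_result_GW0:
  assumes X: "gw_space X" and A: "skew_series X A" and F: "subst_defined F (exp_cov X A)" and GW: "F \<in> GW0 X"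
  shows "genus0_result X A F \<in> GW0 X"
  unfolding GW0_iff[OF X]
proof (intro conjI allI)
  note FE = GW[unfolded GW0_iff[OF X]]
  note sums = genus0_flow_sums[OF X A F]
  show "vfield X (opmat X ser_one) (genus0_result X A F) = mconst 2 * genus0_result X A F"
  proof (rule mfps_eqI)
    fix m
    have "(\<lambda>n. mcoeff (mconst 2 * genus0_flow X A F n) m) sums mcoeff (vfield X (opmat X ser_one) (genus0_result X A F)) m"
      using vfield_sums[OF lowering_opmat[of X ser_one] sums, of X m] FE by (simp add: genus0_flow_euler[OF X A])
    then show "mcoeff (vfield X (opmat X ser_one) (genus0_result X A F)) m = mcoeff (mconst 2 * genus0_result X A F) m"
      using sums_mult[OF sums[of m], of 2] by (simp add: sums_unique2)
  qed
  show "vfield X (opmat X z_inverse) (genus0_result X A F) = qform X (string_quad X)"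
  proof (rule mfps_eqI)
    fix m
    have "(\<lambda>n. if n = 0 then mcoeff (qform X (string_quad X)) m else 0) sums
        mcoeff (vfield X (opmat X z_inverse) (genus0_result X A F)) m"
      using vfield_sums[OF lowering_opmat[of X z_inverse] sums, of X m] FE
      by (simp add: genus0_flow_string[OF X A] if_distrib[of "\<lambda>f. mcoeff f m"] cong: if_cong)
    then show "mcoeff (vfield X (opmat X z_inverse) (genus0_result X A F)) m =
        mcoeff (qform X (string_quad X)) m"
      using sums_single[of 0 "\<lambda>_. mcoeff (qform X (string_quad X)) m"] by (simp add: sums_unique2)
  qed
  show "trr_factor X (genus0_result X A F) (mderiv u (mderiv v (genus0_result X A F)))" for u v
    by (rule genus0_result_trr[OF X A F]) (use FE in blast)
qed

section \<open>Lagrangian cones\<close>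

text \<open>The dilaton shifts in \<open>qlin\<close> and \<open>tparam\<close> cancel, leaving the
  linear form evaluated at the q-coordinates.\<close>

lemma mcoeff_subst_qlin:
  fixes X :: "('h :: ab_group_add, 'n :: finite) gwdata"
  assumes X: "gw_space X" and g: "\<And>\<mu>. g \<mu> \<in> HH" "g \<in> formal_germ X" and K: "\<And>k. k > int K \<Longrightarrow> g \<mu> k = 0"
  shows "mcoeff (subst (qlin X l) (tparam X g)) \<mu> = (\<Sum>v\<in>vars K. l v * qcoord X (g \<mu>) v)"
proof -
  let ?e = "(1, unit_ix X)" and ?K = "max 1 K"
  note ff = formal_fam_tparam[OF X g]
  have q0: "qcoord X (g \<mu>) u = 0" if "fst u > K" for u
    using K[of "int (fst u)"] that by (simp add: qcoord_eq[OF X] pair_right_simps[OF X])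
  have "qlin X l = linser l + mconst (- l ?e)" by (simp add: qlin_def mconst_uminus)
  then have "subst (qlin X l) (tparam X g) = subst (linser l) (tparam X g) + mconst (- l ?e)"
    by (simp only: subst_add(2)[OF subst_defined_formal[OF ff] subst_mconst(1)] subst_mconst(2))
  moreover have "mcoeff (subst (linser l) (tparam X g)) \<mu> = (\<Sum>u\<in>vars ?K. l u * mcoeff (tparam X g u) \<mu>)"
  proof (rule subst_linser)
    fix u :: "'n var" assume "u \<notin> vars ?K"
    then show "mcoeff (tparam X g u) \<mu> = 0" by (auto simp: mcoeff_tparam q0)
  qed simp
  moreover have "\<dots> = (\<Sum>u\<in>vars ?K. l u * qcoord X (g \<mu>) u) + (\<Sum>u\<in>vars ?K. if u = ?e then if \<mu> = {#} then l ?e else 0 else 0)"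
    unfolding sum.distrib[symmetric] by (intro sum.cong refl) (auto simp: mcoeff_tparam ring_distribs)
  moreover have "(\<Sum>u\<in>vars ?K. l u * qcoord X (g \<mu>) u) = (\<Sum>u\<in>vars K. l u * qcoord X (g \<mu>) u)"
    by (rule sum.mono_neutral_right) (auto simp: q0)
  ultimately show ?thesis by (simp add: mcoeff_mconst)
qed

text \<open>The transposed matrix of e^{-A} undoes that of e^A, all sums being finite by
  triangularity.\<close>

lemma opmat_exp_inject:
  fixes X :: "('h :: ab_group_add, 'n :: finite) gwdata"
  assumes X: "gw_space X" and A: "skew_series X A"
    and eq: "\<And>u. (\<Sum>v\<in>vars (fst u). opmat X (ser_exp X A) v u * x v) = (\<Sum>v\<in>vars (fst u). opmat X (ser_exp X A) v u * y v)"
  shows "x w = y w"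
proof -
  let ?P = "opmat X (ser_exp X A)" and ?Q = "opmat X (ser_exp X (\<lambda>i v. - A i v))"
  have *: "(\<Sum>u\<in>vars (fst w). (\<Sum>v\<in>vars (fst u). ?P v u * x v) * ?Q u w) = x w" for x :: "'n var \<Rightarrow> complex"
  proof -
    have "(\<Sum>u\<in>vars (fst w). (\<Sum>v\<in>vars (fst u). ?P v u * x v) * ?Q u w) =
        (\<Sum>u\<in>vars (fst w). \<Sum>v\<in>vars (fst w). ?P v u * ?Q u w * x v)"
    proof (intro sum.cong refl)
      fix u :: "'n var" assume "u \<in> vars (fst w)"
      then have h: "(\<Sum>v\<in>vars (fst u). ?P v u * x v) = (\<Sum>v\<in>vars (fst w). ?P v u * x v)"
        by (intro sum.mono_neutral_left) (auto simp: opmat_def)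
      show "(\<Sum>v\<in>vars (fst u). ?P v u * x v) * ?Q u w = (\<Sum>v\<in>vars (fst w). ?P v u * ?Q u w * x v)"
        unfolding h sum_distrib_right by (simp add: mult_ac)
    qed
    also have "\<dots> = (\<Sum>v\<in>vars (fst w). (\<Sum>u\<in>vars (fst w). ?P v u * ?Q u w) * x v)"
      unfolding sum_distrib_right by (rule sum.swap)
    also have "\<dots> = (\<Sum>v\<in>vars (fst w). if v = w then x w else 0)"
      unfolding opmat_exp_inverse[OF X A order_refl] by (intro sum.cong refl) auto
    finally show ?thesis by simp
  qed
  show ?thesis using *[of x] *[of y] by (simp add: eq)
qed

text \<open>The p-coordinates of \<open>g\<close> and the derivatives of the new potential at
  \<open>g\<close> arise from the data at e^A g by the same transposed matrix and the same quadratic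
  term. The term cancels and the matrix is injective.\<close>

lemma cone_point_iff:
  assumes X: "gw_space X" and A: "skew_series X A" and F: "subst_defined F (exp_cov X A)"
    and g: "\<And>\<mu>. g \<mu> \<in> HH" "g \<in> formal_germ X"
  shows "g \<in> ext_cone X (genus0_result X A F) \<longleftrightarrow> (\<lambda>\<mu>. act (ser_exp X A) (g \<mu>)) \<in> ext_cone X F"
proof -
  let ?S = "ser_exp X A" and ?f = "\<lambda>\<mu>. act (ser_exp X A) (g \<mu>)" and ?G = "genus0_result X A F"
  let ?P = "opmat X ?S"
  have e: "endo X (?S i)" for i by (rule endo_ser_exp[OF X A])
  note ff = formal_fam_tparam[OF X g]
  have t: "tparam X ?f = (\<lambda>v. subst (exp_cov X A v) (tparam X g))"
    by (rule ext) (simp add: exp_cov_def tparam_act[OF X A g])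
  have gd: "subst_defined (mderiv v F) (exp_cov X A)" for v by (rule subst_defined_exp_cov_mderiv[OF X A F])
  \<comment> \<open>Convergence at the moved family is automatic, as it is \<open>exp_cov\<close>
    followed by a formal family.\<close>
  have d: "subst_defined (mderiv v F) (tparam X ?f)" for v
    unfolding t by (rule subst_subst(1)[OF gd ff])
  have s: "subst (subst (mderiv v F) (exp_cov X A)) (tparam X g) = subst (mderiv v F) (tparam X ?f)" for v
    unfolding t by (rule subst_subst(2)[OF gd ff, symmetric])
  have dG: "mcoeff (subst (mderiv u ?G) (tparam X g)) \<mu> =
      (\<Sum>v\<in>vars (fst u). ?P v u * mcoeff (subst (mderiv v F) (tparam X ?f)) \<mu>)
      + mcoeff (subst (qlin X (quad_total X A u)) (tparam X g)) \<mu>" for u \<mu>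
  proof -
    have "subst (mderiv u (subst F (exp_cov X A))) (tparam X g) =
        (\<Sum>v\<in>vars (fst u). mconst (?P v u) * subst (mderiv v F) (tparam X ?f))"
      unfolding mderiv_subst_exp_cov(3)[OF X A F]
      using subst_sum[of "vars (fst u)" "\<lambda>v. mconst (?P v u) * subst (mderiv v F) (exp_cov X A)" "tparam X g"]
      by (simp add: subst_defined_formal[OF ff] subst_mconst_mult(2) s)
    then show ?thesis
      by (simp add: mderiv_genus0_result[OF X A] subst_add(2) subst_defined_formal[OF ff] mcoeff_sum)
  qed
  have p: "pcoord X (g \<mu>) u = (\<Sum>v\<in>vars (fst u). ?P v u * pcoord X (?f \<mu>) v)
      + mcoeff (subst (qlin X (quad_total X A u)) (tparam X g)) \<mu>" for u \<mu>
  proof -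
    obtain K where K: "\<And>k. k > int K \<Longrightarrow> g \<mu> k = 0" using HH_bound[OF g(1)] by blast
    show ?thesis
      by (simp add: mcoeff_subst_qlin[OF X g K] pcoord_act_inverse[OF X A K, where u = u])
  qed
  have key: "(\<forall>u. pparam X g u = subst (mderiv u ?G) (tparam X g)) \<longleftrightarrow>
      (\<forall>v. pparam X ?f v = subst (mderiv v F) (tparam X ?f))"
  proof
    assume *: "\<forall>u. pparam X g u = subst (mderiv u ?G) (tparam X g)"
    show "\<forall>v. pparam X ?f v = subst (mderiv v F) (tparam X ?f)"
    proof (intro allI mfps_eqI)
      fix v \<mu>
      have "pcoord X (g \<mu>) u = mcoeff (subst (mderiv u ?G) (tparam X g)) \<mu>" for u
        using *[rule_format, of u, symmetric] by (simp add: pparam_def)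
      then have "(\<Sum>v\<in>vars (fst u). ?P v u * pcoord X (?f \<mu>) v) =
          (\<Sum>v\<in>vars (fst u). ?P v u * mcoeff (subst (mderiv v F) (tparam X ?f)) \<mu>)" for u
        unfolding p dG by simp
      then have "pcoord X (?f \<mu>) v = mcoeff (subst (mderiv v F) (tparam X ?f)) \<mu>"
        by (rule opmat_exp_inject[OF X A, where x = "pcoord X (?f \<mu>)"
              and y = "\<lambda>v. mcoeff (subst (mderiv v F) (tparam X ?f)) \<mu>" and w = v])
      then show "mcoeff (pparam X ?f v) \<mu> = mcoeff (subst (mderiv v F) (tparam X ?f)) \<mu>"
        by (simp add: pparam_def)
    qed
  next
    assume *: "\<forall>v. pparam X ?f v = subst (mderiv v F) (tparam X ?f)"
    have "pcoord X (?f \<mu>) v = mcoeff (subst (mderiv v F) (tparam X ?f)) \<mu>" for v \<mu>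
      using *[rule_format, of v, symmetric] by (simp add: pparam_def)
    then have "mcoeff (pparam X g u) \<mu> = mcoeff (subst (mderiv u ?G) (tparam X g)) \<mu>" for u \<mu>
      unfolding pparam_def mcoeff_Mfps p dG by simp
    then show "\<forall>u. pparam X g u = subst (mderiv u ?G) (tparam X g)" by (auto intro: mfps_eqI)
  qed
  have "?f \<mu> \<in> HH" for \<mu> by (rule act_HH[OF e g(1)])
  then show ?thesis
    using key g(1) d subst_defined_formal[OF ff] unfolding ext_cone_def by blast
qed

text \<open>S and its inverse e^{-a} act as mutually inverse maps on the loop space, so
  \<open>cone_point_iff\<close> for -a gives both inclusions.\<close>

lemma cone_genus0_result:
  assumes X: "gw_space X" and a: "skew_series X a" and F: "subst_defined F (exp_cov X (\<lambda>i v. - a i v))"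
  shows "cone X (genus0_result X (\<lambda>i v. - a i v) F) = cone_image X (ser_exp X a) F"
proof -
  let ?b = "\<lambda>i v. - a i v" and ?S = "ser_exp X a"
  let ?S' = "ser_exp X ?b"
  have b: "skew_series X ?b" by (rule skew_series_uminus[OF X a])
  have e: "endo X (?S i)" "endo X (?S' i)" for i
    by (rule endo_ser_exp[OF X a] endo_ser_exp[OF X b])+
  have "ser_mult ?S ?S' = ser_one" "ser_mult ?S' ?S = ser_one"
    using ser_exp_mult_uminus[OF X a] ser_exp_mult_uminus[OF X b] by simp_all
  then have inv: "act ?S (act ?S' f) = f" "act ?S' (act ?S f) = f" if "f \<in> HH" for f
    using act_ser_mult[OF e(1) e(2) _ that] act_ser_mult[OF e(2) e(1) _ that] endo_ser_one[OF X]
    by (simp_all add: act_ser_one)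
  show ?thesis
  proof (intro equalityI subsetI)
    fix g assume g: "g \<in> cone X (genus0_result X ?b F)"
    then have g': "\<And>\<mu>. g \<mu> \<in> HH" "g \<in> formal_germ X" by (auto simp: cone_def ext_cone_def)
    have "(\<lambda>\<mu>. act ?S' (g \<mu>)) \<in> ext_cone X F"
      using g cone_point_iff[OF X b F g'] by (simp add: cone_def)
    moreover have "g = (\<lambda>\<mu>. act ?S (act ?S' (g \<mu>)))" by (simp add: inv g')
    ultimately show "g \<in> cone_image X ?S F"
      using g'(2) unfolding cone_image_def
      by (intro IntI image_eqI[where x = "\<lambda>\<mu>. act ?S' (g \<mu>)"])
  next
    fix g assume "g \<in> cone_image X ?S F"
    then obtain f where f: "f \<in> ext_cone X F" and gf: "g = (\<lambda>\<mu>. act ?S (f \<mu>))" and gg: "g \<in> formal_germ X"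
      by (auto simp: cone_image_def)
    have fH: "f \<mu> \<in> HH" for \<mu> using f by (simp add: ext_cone_def)
    then have gH: "g \<mu> \<in> HH" for \<mu> unfolding gf by (intro act_HH[OF e(1)])
    have "(\<lambda>\<mu>. act ?S' (g \<mu>)) = f" unfolding gf by (simp add: inv fH)
    then show "g \<in> cone X (genus0_result X ?b F)"
      using cone_point_iff[OF X b F gH gg] f gg by (simp add: cone_def)
  qed
qed

text \<open>The cone contains a family parametrized by all of it, so it determines the derivatives of
  the potential, and the dilaton equation recovers the potential from these.\<close>

lemma cone_inject_GW0:
  fixes X :: "('h :: ab_group_add, 'n :: finite) gwdata"
  assumes X: "gw_space X" and G: "G \<in> GW0 X" and G': "G' \<in> GW0 X" and eq: "cone X G = cone X G'"
  shows "G = G'"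
proof -
  \<comment> \<open>The generic point in the q-directions, with p-coordinates forced by
    \<open>G\<close>. At negative \<open>k\<close> the index is n = -1-k, and the sign is that of
    (-z)^{-n-1}.\<close>
  define g :: "('h, 'n) family" where "g \<mu> k = (if k \<ge> 0 then generic_q X \<mu> k else
      (\<Sum>\<alpha>\<in>UNIV. scl X ((- 1) ^ (nat (- 1 - k) + 1) * mcoeff (mderiv (nat (- 1 - k), \<alpha>) G) \<mu>) (cobas X \<alpha>)))" for \<mu> k
  have gH: "g \<mu> \<in> HH" for \<mu>
  proof -
    have "\<exists>K. \<forall>k>K. generic_q X \<mu> k = 0"
    proof (cases "\<exists>v. \<mu> = {#v#}")
      case True
      then obtain n \<alpha> where "\<mu> = {#(n, \<alpha>)#}" by auto
      then show ?thesis by (intro exI[of _ "int n"]) (simp add: generic_q_def qbas_eq)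
    next
      case False
      then show ?thesis by (intro exI[of _ 1]) (simp add: generic_q_def qbas_eq)
    qed
    then obtain K where "\<forall>k>K. generic_q X \<mu> k = 0" by blast
    then show ?thesis unfolding HH_def by (intro CollectI exI[of _ "max K 0"]) (simp add: g_def)
  qed
  have t: "tparam X g v = mvar v" for v
  proof (rule mfps_eqI)
    fix \<mu> :: "'n var multiset"
    have "qcoord X (g \<mu>) v = pair X (cobas X (snd v)) (generic_q X \<mu> (int (fst v)))"
      by (simp add: qcoord_eq[OF X] g_def)
    then show "mcoeff (tparam X g v) \<mu> = mcoeff (mvar v) \<mu>"
      by (cases v) (auto simp: mcoeff_tparam mcoeff_mvar generic_q_def qbas_def pair_right_simps[OF X]
          pair_cobas_bas[OF X] split: prod.splits)
  qed
  have germ: "g \<in> formal_germ X"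
    unfolding formal_germ_def by (simp add: t mcoeff_mvar)
  have p: "pparam X g v = mderiv v G" for v
  proof (rule mfps_eqI)
    fix \<mu> :: "'n var multiset"
    obtain n \<alpha> where v: "v = (n, \<alpha>)" by (cases v)
    have n: "nat (- 1 - (- int n - 1)) = n" by simp
    have "pcoord X (g \<mu>) v = (- 1) ^ (n + 1) * pair X (bas X \<alpha>) (\<Sum>\<beta>\<in>UNIV.
        scl X ((- 1) ^ (n + 1) * mcoeff (mderiv (n, \<beta>) G) \<mu>) (cobas X \<beta>))"
      unfolding pcoord_eq[OF X] g_def v fst_conv snd_conv n by simp
    also have "\<dots> = (- 1) ^ (n + 1) * (\<Sum>\<beta>\<in>UNIV. if \<beta> = \<alpha> then (- 1) ^ (n + 1) * mcoeff (mderiv (n, \<alpha>) G) \<mu> else 0)"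
      unfolding pair_sum_right[OF X]
      by (intro arg_cong2[where f = times] refl sum.cong)
        (auto simp: pair_right_simps[OF X] pair_commute[OF X, of "bas X \<alpha>"] pair_cobas_bas[OF X])
    also have "\<dots> = mcoeff (mderiv v G) \<mu>"
      by (simp add: v mult.assoc[symmetric] power_mult_distrib[symmetric])
    finally show "mcoeff (pparam X g v) \<mu> = mcoeff (mderiv v G) \<mu>" by (simp add: pparam_def)
  qed
  have id: "subst_defined f mvar" "subst f mvar = f" for f :: "'n tser"
    using row_finite_hom_eq_subst[OF row_finite_id] by auto
  have t': "tparam X g = mvar" by (rule ext) (rule t)
  have "g \<in> cone X G"
    using gH germ by (simp add: cone_def ext_cone_def t' p id)
  then have "g \<in> cone X G'" using eq by simp
  then have "pparam X g v = subst (mderiv v G') (tparam X g)" for v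
    unfolding cone_def ext_cone_def by blast
  then have "mderiv v G = mderiv v G'" for v
    by (simp only: p t' id)
  then have "2 * G = 2 * G'" using G G' by (simp add: GW0_def)
  moreover have "(2 :: 'n tser) = mconst 2" using mconst_of_nat[of 2] by simp
  ultimately have "mconst 2 * G = mconst 2 * G'" by (simp only:)
  from mconst_mult_cancel[OF _ this] show ?thesis by simp
qed

theorem corollary2p1:
  fixes X :: "('h :: ab_group_add, 'n :: finite) gwdata"
    and a S :: "nat \<Rightarrow> 'h \<Rightarrow> 'h"
    and F :: "'n tser"
    and Fs :: "nat \<Rightarrow> 'n tser"
  assumes "gw_space X"
    and "a \<in> g_minus X" and "S \<in> G_minus X" and "S = ser_exp X a"
    and "F \<in> GW0 X" and "Fs 0 = F"
    and "\<And>g. subst_defined (Fs g) (change_of_vars X S)"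
  shows "(\<exists>!Gs. quantized_action X a Fs Gs) \<and>
         (\<forall>Gs. quantized_action X a Fs Gs \<longrightarrow> is_cone_action X S F (Gs 0))"
proof -
  let ?b = "\<lambda>i v. - a i v"
  note X = assms(1)
  have a: "skew_series X a" by (rule skew_series_g_minus[OF X assms(2)])
  have b: "skew_series X ?b" by (rule skew_series_uminus[OF X a])
  have "change_of_vars X S = exp_cov X ?b"
    unfolding change_of_vars_def assms(4) ser_inv_ser_exp[OF X a]
    by (rule ext) (simp add: change_of_vars_eq[OF X b] exp_cov_def)
  then have Fs: "subst_defined (Fs g) (exp_cov X ?b)" for g using assms(7) by simp
  note qa = quantized_action_iff[OF X a Fs]
  have F: "subst_defined F (exp_cov X ?b)" using Fs[of 0] assms(6) by simp
  have "is_cone_action X S F (genus0_result X ?b F)"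
    unfolding is_cone_action_def
  proof (intro conjI ballI impI)
    show G: "genus0_result X ?b F \<in> GW0 X" by (rule genus0_result_GW0[OF X b F assms(5)])
    show c: "cone X (genus0_result X ?b F) = cone_image X S F"
      unfolding assms(4) by (rule cone_genus0_result[OF X a F])
    show "G' = genus0_result X ?b F" if "G' \<in> GW0 X" "cone X G' = cone_image X S F" for G'
      using cone_inject_GW0[OF X that(1) G] that(2) c by simp
  qed
  then show ?thesis unfolding qa using assms(6) by auto
qed

end
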